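(* Let $\zeta$ be a formal parameter, let $U(\mathfrak{sl}_4)[[\zeta]]$ carry the standard (undeformed) coproduct $\Delta$, and put $\sigma=\ln(1-\zeta E_{12})$. Then the element $$ \begin{aligned} F_{\mathfrak p}={}&\bigl(1\otimes 1-\zeta\,1\otimes E_{23}+\zeta^{2}D_{3}\otimes E_{13}e^{-\sigma}\bigr)^{(D_{3}\otimes 1)}\cdot\bigl(1\otimes 1-\zeta\,1\otimes E_{34}\bigr)^{(D_{3}\otimes 1)}\\ &\cdot\exp\bigl(-\zeta^{2}E_{43}(D_{2}+D_{3})\otimes E_{14}e^{-\sigma}\bigr)\cdot\exp\bigl(\zeta\,E_{43}\otimes(E_{24}-\zeta E_{34}E_{13}e^{-\sigma})\bigr)\\ &\cdot\exp\bigl(\zeta\,E_{43}\otimes E_{13}e^{-\sigma}\bigr)\cdot\bigl(1\otimes 1-\zeta\,1\otimes E_{23}+\zeta^{2}D_{2}\otimes E_{13}e^{-\sigma}\bigr)^{((D_{2}-D_{3})\otimes 1)}\\ &\cdot\exp\bigl(\zeta\,E_{32}\otimes E_{13}e^{-\sigma}+\zeta\,E_{42}\otimes E_{14}e^{-\sigma}\bigr)\cdot\exp\bigl(D_{1}\otimes\sigma\bigr) \end{aligned} $$ of $(U(\mathfrak{sl}_4)\otimes U(\mathfrak{sl}_4))[[\zeta]]$ is a twist of $U(\mathfrak{sl}_4)[[\zeta]]$, and the corresponding universal $R$-matrix $R_{\mathfrak p}=(F_{\mathfrak p})_{21}F_{\mathfrak p}^{-1}$ satisfies $$ R_{\mathfrak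 p}=1\otimes 1+\zeta\, r_{\mathfrak p}+O(\zeta^{2}), $$ $$ r_{\mathfrak p}=D_{1}\wedge E_{12}+E_{14}\wedge E_{42}+E_{13}\wedge E_{32}+D_{2}\wedge E_{23}+E_{24}\wedge E_{43}+D_{3}\wedge E_{34}+E_{13}\wedge E_{43}. $$
   Context: $E_{ij}$ ($1\le i,j\le 4$) are the matrix units; $E_{ij}$ with $i\ne j$, and the traceless diagonal combinations of the $E_{ii}$, are viewed as elements of $\mathfrak{sl}_4\subset U(\mathfrak{sl}_4)$ over a field of characteristic $0$. For $p=1,2,3$, $$D_p=\frac{4-p}{4}(E_{11}+\cdots+E_{pp})-\frac p4(E_{p+1,p+1}+\cdots+E_{44}).$$ Thus $e^{-\sigma}=(1-\zeta E_{12})^{-1}$. All tensor products are $\zeta$-adically completed. For $D$ in the Cartan subalgebra and $x\in\zeta\,(U\otimes U)[[\zeta]]$ commuting with $D\otimes 1$, $(1\otimes 1+x)^{(D\otimes 1)}:=\exp\bigl((D\otimes 1)\ln(1\otimes 1+x)\bigr)$. A twist of a (topological) Hopf algebra $H$ with coproduct $\Delta$ and counit $\varepsilon$ is an invertible element $F\in H\otimes H$ satisfying the Drinfeld equation $F_{12}(\Delta\otimes\mathrm{id})(F)=F_{23}(\mathrm{id}\otimes\Delta)(F)$ and $(\varepsilon\otimes\mathrm{id})(F)=(\mathrm{id}\otimes\varepsilon)(F)=1$. $F_{21}$ is $F$ with its tensor factors interchanged, and $a\wedge b=a\otimes b-b\otimes a$. *)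

theory Defs
  imports
    "HOL-Analysis.Analysis"
    "HOL-Library.Poly_Mapping"
    "HOL-Computational_Algebra.Formal_Power_Series"
begin

section \<open>Associative algebras over a field\<close>

locale assoc_algebra = vector_space scale
  for scale :: "'k::field \<Rightarrow> 'a::ring_1 \<Rightarrow> 'a" +
  assumes scale_mult_left: "scale c x * y = scale c (x * y)"
    and scale_mult_right: "x * scale c y = scale c (x * y)"

lemma assoc_algebra_field: "assoc_algebra ((*) :: 'k::field \<Rightarrow> 'k \<Rightarrow> 'k)"
  by unfold_locales (auto simp: algebra_simps)

text \<open>For a monoid \<open>'m\<close> written additively, \<open>'m \<Rightarrow>\<^sub>0 'k\<close> is the monoid algebra \<open>k['m]\<close>.\<close>

definition ma_scale :: "'k::field \<Rightarrow> ('m::monoid_add \<Rightarrow>\<^sub>0 'k) \<Rightarrow> ('m \<Rightarrow>\<^sub>0 'k)" where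
  "ma_scale c p = Poly_Mapping.single 0 c * p"

definition lin_ext :: "('k::field \<Rightarrow> 'a \<Rightarrow> 'a) \<Rightarrow> ('m \<Rightarrow> 'a) \<Rightarrow> ('m \<Rightarrow>\<^sub>0 'k) \<Rightarrow> 'a::comm_monoid_add" where
  "lin_ext s f p = (\<Sum>m\<in>Poly_Mapping.keys p. s (Poly_Mapping.lookup p m) (f m))"

lemma pm_induct [case_names zero single add]:
  fixes p :: "'m \<Rightarrow>\<^sub>0 'k::comm_monoid_add"
  assumes "P 0" and "\<And>m c. P (Poly_Mapping.single m c)"
    and "\<And>p q. P p \<Longrightarrow> P q \<Longrightarrow> P (p + q)"
  shows "P p"
proof (induction p rule: update_induct)
  case const
  show ?case by fact
next
  case (update f a b)
  have "Poly_Mapping.update a b f = Poly_Mapping.single a b + f"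
    using update(1)
    by (intro poly_mapping_eqI)
      (auto simp: lookup_add Poly_Mapping.lookup_update lookup_single not_in_keys_iff_lookup_eq_zero when_def)
  then show ?case using assms(3)[OF assms(2) update(3)] by simp
qed

lemma ma_scale_single [simp]: "ma_scale c (Poly_Mapping.single m d) = Poly_Mapping.single m (c * d)"
  by (simp add: ma_scale_def mult_single)

lemma single_central: "Poly_Mapping.single 0 c * p = p * Poly_Mapping.single 0 (c::'k::field)"
  by (induction p rule: pm_induct) (auto simp: mult_single algebra_simps)

lemma assoc_algebra_ma: "assoc_algebra (ma_scale :: 'k::field \<Rightarrow> ('m::monoid_add \<Rightarrow>\<^sub>0 'k) \<Rightarrow> _)"
proof unfold_locales
  fix a b :: 'k and x y :: "'m \<Rightarrow>\<^sub>0 'k"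
  show "ma_scale a (x + y) = ma_scale a x + ma_scale a y"
    by (simp add: ma_scale_def algebra_simps)
  show "ma_scale (a + b) x = ma_scale a x + ma_scale b x"
    by (simp add: ma_scale_def algebra_simps single_add)
  show "ma_scale a (ma_scale b x) = ma_scale (a * b) x"
    by (simp add: ma_scale_def mult.assoc[symmetric] mult_single)
  show "ma_scale 1 x = x"
    by (simp add: ma_scale_def)
  show "ma_scale a x * y = ma_scale a (x * y)"
    by (simp add: ma_scale_def algebra_simps)
  show "x * ma_scale a y = ma_scale a (x * y)"
    by (metis ma_scale_def mult.assoc single_central)
qed

interpretation ma: assoc_algebra "ma_scale :: 'k::field \<Rightarrow> ('m::monoid_add \<Rightarrow>\<^sub>0 'k) \<Rightarrow> _"
  by (rule assoc_algebra_ma)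

context vector_space
begin

lemma lin_ext_single: "lin_ext scale f (Poly_Mapping.single m c) = scale c (f m)"
  by (simp add: lin_ext_def)

lemma lin_ext_add: "lin_ext scale f (p + q) = lin_ext scale f p + lin_ext scale f q"
  unfolding lin_ext_def by (rule setsum_keys_plus_distrib) (auto simp: scale_left_distrib)

lemma lin_ext_zero: "lin_ext scale f 0 = 0"
  by (simp add: lin_ext_def)

lemma lin_ext_scale: "lin_ext scale f (ma_scale c p) = scale c (lin_ext scale f p)"
  by (induction p rule: pm_induct)
    (auto simp: lin_ext_single lin_ext_add lin_ext_zero ma.scale_right_distrib scale_right_distrib)

lemma lin_ext_minus: "lin_ext scale f (p - q) = lin_ext scale f p - lin_ext scale f q"
  using lin_ext_add[of f "p - q" q] by (simp add: algebra_simps)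

end

lemma (in assoc_algebra) lin_ext_mult:
  assumes "\<And>m n. f (m + n) = f m * f n"
  shows "lin_ext scale f (p * q) = lin_ext scale f p * lin_ext scale f q"
proof (induction p rule: pm_induct)
  case (single m c)
  show ?case
    by (induction q rule: pm_induct)
      (auto simp: lin_ext_single lin_ext_add lin_ext_zero mult_single assms algebra_simps
        scale_mult_left scale_mult_right)
qed (auto simp: lin_ext_single lin_ext_add lin_ext_zero algebra_simps)


section \<open>The Lie algebra \<open>sl\<^sub>4\<close>\<close>

typedef (overloaded) 'k sl4 = "{A :: 'k::field ^ 4 ^ 4. trace A = 0}"
  by (rule exI[of _ 0]) (simp add: trace_def)

setup_lifting type_definition_sl4

instantiation sl4 :: (field) ab_group_add
begin
lift_definition zero_sl4 :: "'a sl4" is 0 by (simp add: trace_def)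
lift_definition plus_sl4 :: "'a sl4 \<Rightarrow> 'a sl4 \<Rightarrow> 'a sl4" is "(+)" by (simp add: trace_add)
lift_definition minus_sl4 :: "'a sl4 \<Rightarrow> 'a sl4 \<Rightarrow> 'a sl4" is "(-)" by (simp add: trace_sub)
lift_definition uminus_sl4 :: "'a sl4 \<Rightarrow> 'a sl4" is uminus by (simp add: trace_def sum_negf)
instance by standard (transfer, simp add: add.assoc add.commute)+
end

definition matrix_scale :: "'k::field \<Rightarrow> 'k ^ 4 ^ 4 \<Rightarrow> 'k ^ 4 ^ 4" where
  "matrix_scale c A = (\<chi> i j. c * A $ i $ j)"

lift_definition sl4_scale :: "'k::field \<Rightarrow> 'k sl4 \<Rightarrow> 'k sl4" is matrix_scale
  by (simp add: matrix_scale_def trace_def sum_distrib_left[symmetric])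

lift_definition sl4_bracket :: "'k::field sl4 \<Rightarrow> 'k sl4 \<Rightarrow> 'k sl4" is "\<lambda>A B. A ** B - B ** A"
proof -
  fix A B :: "'k ^ 4 ^ 4"
  show "trace (A ** B - B ** A) = 0"
    using trace_mul_sym[of A B] by (simp add: trace_sub)
qed

text \<open>In the index type \<open>4\<close> arithmetic is modulo \<open>4\<close>; its elements are \<open>1, 2, 3\<close> and \<open>4 = 0\<close>.\<close>

definition matrix_unit :: "4 \<Rightarrow> 4 \<Rightarrow> 'k::field ^ 4 ^ 4" where
  "matrix_unit i j = (\<chi> a b. if a = i \<and> b = j then 1 else 0)"


section \<open>The universal enveloping algebra \<open>U(sl\<^sub>4)\<close>\<close>

text \<open>The free monoid on \<open>'a\<close>, written additively.\<close>

instantiation list :: (type) monoid_add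
begin
definition zero_list :: "'a list" where "zero_list = []"
definition plus_list :: "'a list \<Rightarrow> 'a list \<Rightarrow> 'a list" where "plus_list = (@)"
instance by standard (auto simp: zero_list_def plus_list_def)
end

text \<open>\<open>'k sl4 list \<Rightarrow>\<^sub>0 'k\<close> is the free algebra on the set \<open>sl\<^sub>4\<close>. Dividing by the two-sided ideal
  generated by the relations below yields the tensor algebra of the vector space \<open>sl\<^sub>4\<close> modulo
  \<open>xy - yx = [x,y]\<close>.\<close>

definition free_gen :: "'k::field sl4 \<Rightarrow> ('k sl4 list \<Rightarrow>\<^sub>0 'k)" where
  "free_gen x = Poly_Mapping.single [x] 1"

inductive_set usl4_ideal :: "('k::field sl4 list \<Rightarrow>\<^sub>0 'k) set" where
  rel_add: "free_gen (x + y) - free_gen x - free_gen y \<in> usl4_ideal"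
| rel_scale: "free_gen (sl4_scale c x) - ma_scale c (free_gen x) \<in> usl4_ideal"
| rel_bracket: "free_gen x * free_gen y - free_gen y * free_gen x - free_gen (sl4_bracket x y) \<in> usl4_ideal"
| add: "p \<in> usl4_ideal \<Longrightarrow> q \<in> usl4_ideal \<Longrightarrow> p + q \<in> usl4_ideal"
| mult_left: "p \<in> usl4_ideal \<Longrightarrow> q * p \<in> usl4_ideal"
| mult_right: "p \<in> usl4_ideal \<Longrightarrow> p * q \<in> usl4_ideal"

lemma usl4_ideal_zero: "0 \<in> usl4_ideal"
  using usl4_ideal.mult_left[OF usl4_ideal.rel_add, of 0] by simp

lemma usl4_ideal_uminus: "p \<in> usl4_ideal \<Longrightarrow> - p \<in> usl4_ideal"
  using usl4_ideal.mult_left[of p "-1"] by simp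

lemma usl4_ideal_diff: "p \<in> usl4_ideal \<Longrightarrow> q \<in> usl4_ideal \<Longrightarrow> p - q \<in> usl4_ideal"
  using usl4_ideal.add[OF _ usl4_ideal_uminus, of p q] by simp

definition word_ext :: "('b \<Rightarrow> 'a::monoid_mult) \<Rightarrow> 'b list \<Rightarrow> 'a" where
  "word_ext f w = prod_list (map f w)"

lemma word_ext_add: "word_ext f (v + w) = word_ext f v * word_ext f w"
  by (simp add: word_ext_def plus_list_def)

lemma word_ext_zero: "word_ext f 0 = 1"
  by (simp add: word_ext_def zero_list_def)

definition lie_map :: "('k::field \<Rightarrow> 'a \<Rightarrow> 'a) \<Rightarrow> ('k sl4 \<Rightarrow> 'a::ring_1) \<Rightarrow> bool" where
  "lie_map s f \<longleftrightarrow> (\<forall>x y. f (x + y) = f x + f y) \<and> (\<forall>c x. f (sl4_scale c x) = s c (f x))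
     \<and> (\<forall>x y. f (sl4_bracket x y) = f x * f y - f y * f x)"

lemma (in assoc_algebra) lin_ext_usl4_ideal:
  assumes f: "lie_map scale f" and "p \<in> usl4_ideal"
  shows "lin_ext scale (word_ext f) p = 0"
proof -
  have gen: "lin_ext scale (word_ext f) (free_gen x) = f x" for x
    by (simp add: free_gen_def lin_ext_single word_ext_def)
  note [simp] = gen lin_ext_minus lin_ext_add lin_ext_scale lin_ext_mult[OF word_ext_add]
  show ?thesis
    using assms(2) by induction (use f in \<open>auto simp: lie_map_def\<close>)
qed

lemma equivp_usl4_ideal: "equivp (\<lambda>p q. p - q \<in> usl4_ideal)"
proof (rule equivpI)
  show "reflp (\<lambda>p q. p - q \<in> usl4_ideal)" by (simp add: reflp_def usl4_ideal_zero)
  show "symp (\<lambda>p q. p - q \<in> usl4_ideal)"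
    unfolding symp_def using usl4_ideal_uminus by fastforce
  show "transp (\<lambda>p q. p - q \<in> usl4_ideal)"
    unfolding transp_def using usl4_ideal.add by fastforce
qed

quotient_type (overloaded) 'k usl4 = "'k::field sl4 list \<Rightarrow>\<^sub>0 'k" / "\<lambda>p q. p - q \<in> usl4_ideal"
  by (rule equivp_usl4_ideal)

instantiation usl4 :: (field) ring_1
begin
lift_definition zero_usl4 :: "'a usl4" is 0 .
lift_definition one_usl4 :: "'a usl4" is 1 .
lift_definition plus_usl4 :: "'a usl4 \<Rightarrow> 'a usl4 \<Rightarrow> 'a usl4" is "(+)"
  by (simp only: add_diff_add usl4_ideal.add)
lift_definition minus_usl4 :: "'a usl4 \<Rightarrow> 'a usl4 \<Rightarrow> 'a usl4" is "(-)"
proof -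
  fix p p' q q' :: "'a sl4 list \<Rightarrow>\<^sub>0 'a"
  assume "p - p' \<in> usl4_ideal" "q - q' \<in> usl4_ideal"
  then have "(p - p') - (q - q') \<in> usl4_ideal" by (rule usl4_ideal_diff)
  then show "(p - q) - (p' - q') \<in> usl4_ideal" by (simp add: algebra_simps)
qed
lift_definition uminus_usl4 :: "'a usl4 \<Rightarrow> 'a usl4" is uminus
  by (drule usl4_ideal_uminus) (simp add: algebra_simps)
lift_definition times_usl4 :: "'a usl4 \<Rightarrow> 'a usl4 \<Rightarrow> 'a usl4" is "(*)"
proof -
  fix p p' q q' :: "'a sl4 list \<Rightarrow>\<^sub>0 'a"
  assume "p - p' \<in> usl4_ideal" "q - q' \<in> usl4_ideal"
  then have "(p - p') * q + p' * (q - q') \<in> usl4_ideal"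
    by (intro usl4_ideal.intros)
  then show "p * q - p' * q' \<in> usl4_ideal" by (simp add: algebra_simps)
qed
instance
proof
  have "lie_map (*) (\<lambda>_ :: 'a sl4. 0 :: 'a)" by (simp add: lie_map_def)
  note zero = assoc_algebra.lin_ext_usl4_ideal[OF assoc_algebra_field this]
  have one: "lin_ext (*) (word_ext (\<lambda>_ :: 'a sl4. 0 :: 'a)) 1 = 1"
    using vector_space.lin_ext_single[OF vector_space_over_itself.vector_space_axioms,
        of "word_ext (\<lambda>_ :: 'a sl4. 0)" 0 1]
    by (simp add: word_ext_zero)
  have "(1 :: 'a sl4 list \<Rightarrow>\<^sub>0 'a) \<notin> usl4_ideal"
    using zero[of 1] one by (metis zero_neq_one)
  then have "0 - (1 :: 'a sl4 list \<Rightarrow>\<^sub>0 'a) \<notin> usl4_ideal"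
    using usl4_ideal_uminus[of "0 - 1"] by auto
  then show "(0 :: 'a usl4) \<noteq> 1" by transfer
qed (transfer; simp add: algebra_simps usl4_ideal_zero)+
end

lift_definition usl4_scale :: "'k::field \<Rightarrow> 'k usl4 \<Rightarrow> 'k usl4" is ma_scale
  unfolding ma_scale_def by (simp only: right_diff_distrib[symmetric] usl4_ideal.mult_left)

interpretation usl4: assoc_algebra "usl4_scale :: 'k::field \<Rightarrow> 'k usl4 \<Rightarrow> 'k usl4"
  by unfold_locales
    (transfer; simp add: usl4_ideal_zero ma.scale_right_distrib ma.scale_left_distrib
      ma.scale_mult_left ma.scale_mult_right)+

lift_definition usl4_gen :: "'k::field sl4 \<Rightarrow> 'k usl4" is free_gen .

lemma lie_map_usl4_gen: "lie_map usl4_scale usl4_gen"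
  unfolding lie_map_def
proof (intro conjI allI)
  fix x y :: "'a sl4" and c
  show "usl4_gen (x + y) = usl4_gen x + usl4_gen y"
    by transfer (use usl4_ideal.rel_add in \<open>auto simp: algebra_simps\<close>)
  show "usl4_gen (sl4_scale c x) = usl4_scale c (usl4_gen x)"
    by transfer (rule usl4_ideal.rel_scale)
  have "- (free_gen x * free_gen y - free_gen y * free_gen x - free_gen (sl4_bracket x y)) \<in> usl4_ideal"
    by (intro usl4_ideal_uminus usl4_ideal.rel_bracket)
  then show "usl4_gen (sl4_bracket x y) = usl4_gen x * usl4_gen y - usl4_gen y * usl4_gen x"
    by transfer (simp add: algebra_simps)
qed

text \<open>The algebra homomorphism out of \<open>U(sl\<^sub>4)\<close> extending a \<open>lie_map\<close>.\<close>

definition usl4_lift :: "('k::field \<Rightarrow> 'a \<Rightarrow> 'a) \<Rightarrow> ('k sl4 \<Rightarrow> 'a::ring_1) \<Rightarrow> 'k usl4 \<Rightarrow> 'a" where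
  "usl4_lift s f u = lin_ext s (word_ext f) (rep_usl4 u)"

lemma (in assoc_algebra)
  assumes f: "lie_map scale f"
  shows usl4_lift_gen: "usl4_lift scale f (usl4_gen x) = f x"
    and usl4_lift_one: "usl4_lift scale f 1 = 1"
    and usl4_lift_add: "usl4_lift scale f (u + v) = usl4_lift scale f u + usl4_lift scale f v"
    and usl4_lift_mult: "usl4_lift scale f (u * v) = usl4_lift scale f u * usl4_lift scale f v"
    and usl4_lift_scale: "usl4_lift scale f (usl4_scale c u) = scale c (usl4_lift scale f u)"
proof -
  let ?L = "lin_ext scale (word_ext f)"
  have eq: "?L p = ?L q" if "p - q \<in> usl4_ideal" for p q
    using lin_ext_usl4_ideal[OF f that] by (simp add: lin_ext_minus)
  have abs: "usl4_lift scale f (abs_usl4 p) = ?L p" for p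
    unfolding usl4_lift_def
    by (rule eq, rule Quotient3_rep_abs[OF Quotient3_usl4]) (simp add: usl4_ideal_zero)
  show "usl4_lift scale f (usl4_gen x) = f x"
    by (simp add: usl4_gen.abs_eq abs free_gen_def lin_ext_single word_ext_def)
  show "usl4_lift scale f 1 = 1"
    using lin_ext_single[of "word_ext f" 0 1]
    by (simp add: one_usl4.abs_eq abs word_ext_zero)
  show "usl4_lift scale f (u + v) = usl4_lift scale f u + usl4_lift scale f v"
    by (induction u, induction v) (simp add: plus_usl4.abs_eq abs lin_ext_add)
  show "usl4_lift scale f (u * v) = usl4_lift scale f u * usl4_lift scale f v"
    by (induction u, induction v) (simp add: times_usl4.abs_eq abs lin_ext_mult[OF word_ext_add])
  show "usl4_lift scale f (usl4_scale c u) = scale c (usl4_lift scale f u)"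
    by (induction u) (simp add: usl4_scale.abs_eq abs lin_ext_scale)
qed


section \<open>Tensor powers of \<open>U(sl\<^sub>4)\<close>\<close>

text \<open>A multiplicative monoid, written additively.\<close>

datatype 'a as_add = As_add (un_as_add: 'a)

instantiation as_add :: (monoid_mult) monoid_add
begin
definition zero_as_add :: "'a as_add" where "zero_as_add = As_add 1"
definition plus_as_add :: "'a as_add \<Rightarrow> 'a as_add \<Rightarrow> 'a as_add" where
  "plus_as_add m n = As_add (un_as_add m * un_as_add n)"
instance by standard (auto simp: zero_as_add_def plus_as_add_def mult.assoc)
end

text \<open>For a finite index type \<open>'n\<close>, \<open>U^'n\<close> is a monoid under componentwise multiplication. The
  tensor power of \<open>U\<close> over \<open>k\<close> with factors indexed by \<open>'n\<close> is the vector space with basis \<open>U^'n\<close>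
  modulo the subspace spanned by the multilinearity relations; the product is
  \<open>(a\<^sub>1 \<otimes> \<dots> \<otimes> a\<^sub>n) (b\<^sub>1 \<otimes> \<dots> \<otimes> b\<^sub>n) = a\<^sub>1 b\<^sub>1 \<otimes> \<dots> \<otimes> a\<^sub>n b\<^sub>n\<close>.\<close>

definition vec_upd :: "'a ^ 'n \<Rightarrow> 'n \<Rightarrow> 'a \<Rightarrow> 'a ^ 'n" where
  "vec_upd v i a = (\<chi> j. if j = i then a else v $ j)"

definition free_tensor :: "'k::field usl4 ^ 'n \<Rightarrow> (('k usl4 ^ 'n) as_add \<Rightarrow>\<^sub>0 'k)" where
  "free_tensor v = Poly_Mapping.single (As_add v) 1"

definition multilinear_rels :: "(('k::field usl4 ^ 'n) as_add \<Rightarrow>\<^sub>0 'k) set" where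
  "multilinear_rels =
     {free_tensor (vec_upd v i (a + b)) - free_tensor (vec_upd v i a) - free_tensor (vec_upd v i b) | v i a b. True}
     \<union> {free_tensor (vec_upd v i (usl4_scale c a)) - ma_scale c (free_tensor (vec_upd v i a)) | v i c a. True}"

definition multilinear_null :: "(('k::field usl4 ^ 'n) as_add \<Rightarrow>\<^sub>0 'k) set" where
  "multilinear_null = ma.span multilinear_rels"

definition multilinear :: "('k::field \<Rightarrow> 'a \<Rightarrow> 'a) \<Rightarrow> ('k usl4 ^ 'n \<Rightarrow> 'a::ab_group_add) \<Rightarrow> bool" where
  "multilinear s f \<longleftrightarrow>
     (\<forall>v i a b. f (vec_upd v i (a + b)) = f (vec_upd v i a) + f (vec_upd v i b)) \<and>
     (\<forall>v i c a. f (vec_upd v i (usl4_scale c a)) = s c (f (vec_upd v i a)))"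

lemma multilinear_null_diff:
  "p \<in> multilinear_null \<Longrightarrow> q \<in> multilinear_null \<Longrightarrow> p - q \<in> multilinear_null"
  and multilinear_null_add:
  "p \<in> multilinear_null \<Longrightarrow> q \<in> multilinear_null \<Longrightarrow> p + q \<in> multilinear_null"
  and multilinear_null_uminus: "p \<in> multilinear_null \<Longrightarrow> - p \<in> multilinear_null"
  and multilinear_null_zero: "0 \<in> multilinear_null"
  and multilinear_null_scale: "p \<in> multilinear_null \<Longrightarrow> ma_scale c p \<in> multilinear_null"
  unfolding multilinear_null_def
  by (rule ma.span_diff ma.span_add ma.span_neg ma.span_zero ma.span_scale; assumption)+

lemma (in vector_space) lin_ext_multilinear_null:
  assumes f: "multilinear scale f" and p: "p \<in> multilinear_null"
  shows "lin_ext scale (\<lambda>m. f (un_as_add m)) p = 0"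
  using p unfolding multilinear_null_def
proof (induction rule: ma.span_induct_alt)
  case base
  show ?case by (rule lin_ext_zero)
next
  case (step c x y)
  have pure: "lin_ext scale (\<lambda>m. f (un_as_add m)) (free_tensor v) = f v" for v
    by (simp add: free_tensor_def lin_ext_single)
  from step(1) have "lin_ext scale (\<lambda>m. f (un_as_add m)) x = 0"
    using f unfolding multilinear_rels_def multilinear_def
    by (auto simp: lin_ext_minus lin_ext_scale pure)
  with step(2) show ?case by (simp add: lin_ext_add lin_ext_scale)
qed

lemma free_tensor_mult: "free_tensor v * free_tensor w = free_tensor (v * w)"
  by (simp add: free_tensor_def mult_single plus_as_add_def)

lemma free_tensor_one: "free_tensor 1 = 1"
  by (simp add: free_tensor_def flip: zero_as_add_def)

lemma single_as_add: "Poly_Mapping.single m c = ma_scale c (free_tensor (un_as_add m))"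
  by (simp add: free_tensor_def)

lemma vec_upd_mult_left: "w * vec_upd v i a = vec_upd (w * v) i (w $ i * a)"
  by (simp add: vec_upd_def vec_eq_iff)

lemma vec_upd_mult_right: "vec_upd v i a * w = vec_upd (v * w) i (a * w $ i)"
  by (simp add: vec_upd_def vec_eq_iff)

lemma multilinear_rels_mult:
  assumes "x \<in> multilinear_rels"
  shows "free_tensor w * x \<in> multilinear_rels" "x * free_tensor w \<in> multilinear_rels"
proof -
  consider (1) v i a b where "x = free_tensor (vec_upd v i (a + b)) - free_tensor (vec_upd v i a) - free_tensor (vec_upd v i b)"
    | (2) v i c a where "x = free_tensor (vec_upd v i (usl4_scale c a)) - ma_scale c (free_tensor (vec_upd v i a))"
    using assms unfolding multilinear_rels_def by blast
  then show "free_tensor w * x \<in> multilinear_rels"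
  proof cases
    case 1
    have "free_tensor w * x = free_tensor (vec_upd (w * v) i (w $ i * a + w $ i * b))
        - free_tensor (vec_upd (w * v) i (w $ i * a)) - free_tensor (vec_upd (w * v) i (w $ i * b))"
      by (simp add: 1 right_diff_distrib free_tensor_mult vec_upd_mult_left distrib_left)
    then show ?thesis unfolding multilinear_rels_def by blast
  next
    case 2
    have "free_tensor w * x = free_tensor (vec_upd (w * v) i (usl4_scale c (w $ i * a)))
        - ma_scale c (free_tensor (vec_upd (w * v) i (w $ i * a)))"
      by (simp add: 2 right_diff_distrib free_tensor_mult vec_upd_mult_left
          ma.scale_mult_right usl4.scale_mult_right)
    then show ?thesis unfolding multilinear_rels_def by blast
  qed
  consider (1) v i a b where "x = free_tensor (vec_upd v i (a + b)) - free_tensor (vec_upd v i a) - free_tensor (vec_upd v i b)"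
    | (2) v i c a where "x = free_tensor (vec_upd v i (usl4_scale c a)) - ma_scale c (free_tensor (vec_upd v i a))"
    using assms unfolding multilinear_rels_def by blast
  then show "x * free_tensor w \<in> multilinear_rels"
  proof cases
    case 1
    have "x * free_tensor w = free_tensor (vec_upd (v * w) i (a * w $ i + b * w $ i))
        - free_tensor (vec_upd (v * w) i (a * w $ i)) - free_tensor (vec_upd (v * w) i (b * w $ i))"
      by (simp add: 1 left_diff_distrib free_tensor_mult vec_upd_mult_right distrib_right)
    then show ?thesis unfolding multilinear_rels_def by blast
  next
    case 2
    have "x * free_tensor w = free_tensor (vec_upd (v * w) i (usl4_scale c (a * w $ i)))
        - ma_scale c (free_tensor (vec_upd (v * w) i (a * w $ i)))"
      by (simp add: 2 left_diff_distrib free_tensor_mult vec_upd_mult_right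
          ma.scale_mult_left usl4.scale_mult_left)
    then show ?thesis unfolding multilinear_rels_def by blast
  qed
qed

lemma multilinear_null_mult_left:
  assumes "p \<in> multilinear_null"
  shows "q * p \<in> multilinear_null"
proof (induction q rule: pm_induct)
  case (single m c)
  have "free_tensor w * p \<in> multilinear_null" for w
    using assms unfolding multilinear_null_def
  proof (induction rule: ma.span_induct_alt)
    case (step d x y)
    then show ?case
      by (simp add: distrib_left ma.scale_mult_right ma.span_add ma.span_scale ma.span_base
          multilinear_rels_mult)
  qed (simp add: ma.span_zero)
  then show ?case
    unfolding single_as_add ma.scale_mult_left by (rule multilinear_null_scale)
qed (simp_all add: multilinear_null_zero distrib_right multilinear_null_add)

lemma multilinear_null_mult_right:
  assumes "p \<in> multilinear_null"
  shows "p * q \<in> multilinear_null"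
proof (induction q rule: pm_induct)
  case (single m c)
  have "p * free_tensor w \<in> multilinear_null" for w
    using assms unfolding multilinear_null_def
  proof (induction rule: ma.span_induct_alt)
    case (step d x y)
    then show ?case
      by (simp add: distrib_right ma.scale_mult_left ma.span_add ma.span_scale ma.span_base
          multilinear_rels_mult)
  qed (simp add: ma.span_zero)
  then show ?case
    unfolding single_as_add ma.scale_mult_right by (rule multilinear_null_scale)
qed (simp_all add: multilinear_null_zero distrib_left multilinear_null_add)

lemma equivp_multilinear_null: "equivp (\<lambda>p q. p - q \<in> multilinear_null)"
proof (rule equivpI)
  show "reflp (\<lambda>p q. p - q \<in> multilinear_null)" by (simp add: reflp_def multilinear_null_zero)
  show "symp (\<lambda>p q. p - q \<in> multilinear_null)"
    unfolding symp_def using multilinear_null_uminus by fastforce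
  show "transp (\<lambda>p q. p - q \<in> multilinear_null)"
    unfolding transp_def using multilinear_null_add by fastforce
qed

quotient_type (overloaded) ('k, 'n) usl4_tensor =
  "('k::field usl4 ^ 'n::finite) as_add \<Rightarrow>\<^sub>0 'k" / "\<lambda>p q. p - q \<in> multilinear_null"
  by (rule equivp_multilinear_null)

lemma counit_lie_map: "lie_map (*) (\<lambda>_ :: 'k::field sl4. 0 :: 'k)"
  by (simp add: lie_map_def)

definition usl4_counit :: "'k::field usl4 \<Rightarrow> 'k" where
  "usl4_counit = usl4_lift (*) (\<lambda>_. 0)"

lemmas usl4_counit_simps =
  assoc_algebra.usl4_lift_gen[OF assoc_algebra_field counit_lie_map, folded usl4_counit_def]
  assoc_algebra.usl4_lift_one[OF assoc_algebra_field counit_lie_map, folded usl4_counit_def]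
  assoc_algebra.usl4_lift_add[OF assoc_algebra_field counit_lie_map, folded usl4_counit_def]
  assoc_algebra.usl4_lift_mult[OF assoc_algebra_field counit_lie_map, folded usl4_counit_def]
  assoc_algebra.usl4_lift_scale[OF assoc_algebra_field counit_lie_map, folded usl4_counit_def]

lemma multilinear_counits:
  "multilinear (*) (\<lambda>v :: 'k::field usl4 ^ 'n. \<Prod>i\<in>UNIV. usl4_counit (v $ i))"
proof -
  have "(\<Prod>j\<in>UNIV. usl4_counit (vec_upd v i a $ j)) = usl4_counit a * (\<Prod>j\<in>UNIV - {i}. usl4_counit (v $ j))"
    for v :: "'k usl4 ^ 'n" and i a
    by (subst prod.remove[of UNIV i]) (auto simp: vec_upd_def intro!: prod.cong)
  then show ?thesis
    by (simp add: multilinear_def usl4_counit_simps algebra_simps)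
qed

instantiation usl4_tensor :: (field, finite) ring_1
begin
lift_definition zero_usl4_tensor :: "('a, 'b) usl4_tensor" is 0 .
lift_definition one_usl4_tensor :: "('a, 'b) usl4_tensor" is 1 .
lift_definition plus_usl4_tensor :: "('a, 'b) usl4_tensor \<Rightarrow> ('a, 'b) usl4_tensor \<Rightarrow> ('a, 'b) usl4_tensor" is "(+)"
  by (simp only: add_diff_add multilinear_null_add)
lift_definition minus_usl4_tensor :: "('a, 'b) usl4_tensor \<Rightarrow> ('a, 'b) usl4_tensor \<Rightarrow> ('a, 'b) usl4_tensor" is "(-)"
proof -
  fix p p' q q' :: "('a usl4 ^ 'b) as_add \<Rightarrow>\<^sub>0 'a"
  assume "p - p' \<in> multilinear_null" "q - q' \<in> multilinear_null"
  then have "(p - p') - (q - q') \<in> multilinear_null" by (rule multilinear_null_diff)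
  then show "(p - q) - (p' - q') \<in> multilinear_null" by (simp add: algebra_simps)
qed
lift_definition uminus_usl4_tensor :: "('a, 'b) usl4_tensor \<Rightarrow> ('a, 'b) usl4_tensor" is uminus
  by (drule multilinear_null_uminus) (simp add: algebra_simps)
lift_definition times_usl4_tensor :: "('a, 'b) usl4_tensor \<Rightarrow> ('a, 'b) usl4_tensor \<Rightarrow> ('a, 'b) usl4_tensor" is "(*)"
proof -
  fix p p' q q' :: "('a usl4 ^ 'b) as_add \<Rightarrow>\<^sub>0 'a"
  assume "p - p' \<in> multilinear_null" "q - q' \<in> multilinear_null"
  then have "(p - p') * q + p' * (q - q') \<in> multilinear_null"
    by (intro multilinear_null_add multilinear_null_mult_left multilinear_null_mult_right)
  then show "p * q - p' * q' \<in> multilinear_null" by (simp add: algebra_simps)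
qed
instance
proof
  let ?f = "\<lambda>v :: 'a usl4 ^ 'b. \<Prod>i\<in>UNIV. usl4_counit (v $ i)"
  note zero = vector_space.lin_ext_multilinear_null[OF vector_space_over_itself.vector_space_axioms
      multilinear_counits]
  have "lin_ext (*) (\<lambda>m. ?f (un_as_add m)) (free_tensor 1) = 1"
    unfolding free_tensor_def
      vector_space.lin_ext_single[OF vector_space_over_itself.vector_space_axioms]
    by (simp add: usl4_counit_simps)
  then have one: "lin_ext (*) (\<lambda>m. ?f (un_as_add m)) 1 = 1"
    by (simp only: free_tensor_one)
  have "(1 :: ('a usl4 ^ 'b) as_add \<Rightarrow>\<^sub>0 'a) \<notin> multilinear_null"
    using zero[of 1] one by (metis zero_neq_one)
  then have "0 - (1 :: ('a usl4 ^ 'b) as_add \<Rightarrow>\<^sub>0 'a) \<notin> multilinear_null"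
    using multilinear_null_uminus[of "0 - 1"] by auto
  then show "(0 :: ('a, 'b) usl4_tensor) \<noteq> 1" by transfer
qed (transfer; simp add: algebra_simps multilinear_null_zero)+
end

lift_definition tensor_scale :: "'k::field \<Rightarrow> ('k, 'n::finite) usl4_tensor \<Rightarrow> ('k, 'n) usl4_tensor" is ma_scale
  by (simp only: ma.scale_right_diff_distrib[symmetric] multilinear_null_scale)

interpretation tensor: assoc_algebra "tensor_scale :: 'k::field \<Rightarrow> ('k, 'n::finite) usl4_tensor \<Rightarrow> _"
  by unfold_locales
    (transfer; simp add: multilinear_null_zero ma.scale_right_distrib ma.scale_left_distrib
      ma.scale_mult_left ma.scale_mult_right)+

text \<open>\<open>tens v\<close> is the pure tensor with factors \<open>v $ i\<close>.\<close>

lift_definition tens :: "'k::field usl4 ^ 'n::finite \<Rightarrow> ('k, 'n) usl4_tensor" is free_tensor .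

lemma multilinear_tens: "multilinear tensor_scale tens"
proof -
  have "tens (vec_upd v i (a + b)) = tens (vec_upd v i a) + tens (vec_upd v i b)"
    for v :: "'a usl4 ^ 'b" and i a b
  proof transfer
    fix v :: "'a usl4 ^ 'b" and i a b
    have "free_tensor (vec_upd v i (a + b)) - free_tensor (vec_upd v i a) - free_tensor (vec_upd v i b) \<in> multilinear_null"
      unfolding multilinear_null_def by (rule ma.span_base, unfold multilinear_rels_def) blast
    then show "free_tensor (vec_upd v i (a + b)) - (free_tensor (vec_upd v i a) + free_tensor (vec_upd v i b)) \<in> multilinear_null"
      by (simp add: algebra_simps)
  qed
  moreover have "tens (vec_upd v i (usl4_scale c a)) = tensor_scale c (tens (vec_upd v i a))"
    for v :: "'a usl4 ^ 'b" and i c a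
  proof transfer
    fix v :: "'a usl4 ^ 'b" and i c a
    show "free_tensor (vec_upd v i (usl4_scale c a)) - ma_scale c (free_tensor (vec_upd v i a)) \<in> multilinear_null"
      unfolding multilinear_null_def by (rule ma.span_base, unfold multilinear_rels_def) blast
  qed
  ultimately show ?thesis by (simp add: multilinear_def)
qed

lemma tens_mult: "tens v * tens w = tens (v * w)"
  by transfer (simp add: free_tensor_mult multilinear_null_zero)

lemma tens_one: "tens 1 = 1"
  by transfer (simp add: free_tensor_one multilinear_null_zero)

text \<open>The linear map out of a tensor power induced by a multilinear map.\<close>

definition tensor_lift :: "('k::field \<Rightarrow> 'a \<Rightarrow> 'a) \<Rightarrow> ('k usl4 ^ 'n::finite \<Rightarrow> 'a::ab_group_add)
    \<Rightarrow> ('k, 'n) usl4_tensor \<Rightarrow> 'a" where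
  "tensor_lift s f t = lin_ext s (\<lambda>m. f (un_as_add m)) (rep_usl4_tensor t)"

lemma (in vector_space)
  assumes f: "multilinear scale f"
  shows tensor_lift_tens: "tensor_lift scale f (tens v) = f v"
    and tensor_lift_add: "tensor_lift scale f (t + u) = tensor_lift scale f t + tensor_lift scale f u"
    and tensor_lift_scale: "tensor_lift scale f (tensor_scale c t) = scale c (tensor_lift scale f t)"
proof -
  let ?L = "lin_ext scale (\<lambda>m. f (un_as_add m))"
  have eq: "?L p = ?L q" if "p - q \<in> multilinear_null" for p q
    using lin_ext_multilinear_null[OF f that] by (simp add: lin_ext_minus)
  have abs: "tensor_lift scale f (abs_usl4_tensor p) = ?L p" for p
    unfolding tensor_lift_def
    by (rule eq, rule Quotient3_rep_abs[OF Quotient3_usl4_tensor]) (simp add: multilinear_null_zero)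
  show "tensor_lift scale f (tens v) = f v"
    by (simp add: tens.abs_eq abs free_tensor_def lin_ext_single)
  show "tensor_lift scale f (t + u) = tensor_lift scale f t + tensor_lift scale f u"
    by (induction t, induction u) (simp add: plus_usl4_tensor.abs_eq abs lin_ext_add)
  show "tensor_lift scale f (tensor_scale c t) = scale c (tensor_lift scale f t)"
    by (induction t) (simp add: tensor_scale.abs_eq abs lin_ext_scale)
qed


lemma tensor_induct [case_names scale add]:
  fixes t :: "('k::field, 'n::finite) usl4_tensor"
  assumes "\<And>c v. P (tensor_scale c (tens v))" and "\<And>t u. P t \<Longrightarrow> P u \<Longrightarrow> P (t + u)"
  shows "P t"
proof -
  have "P (abs_usl4_tensor p)" for p
  proof (induction p rule: pm_induct)
    case zero
    show ?case using assms(1)[of 0 1] by (simp flip: zero_usl4_tensor.abs_eq)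
  next
    case (single m c)
    show ?case using assms(1)[of c "un_as_add m"]
      by (simp add: tens.abs_eq tensor_scale.abs_eq single_as_add[of m c])
  next
    case (add p q)
    then show ?case using assms(2) by (simp flip: plus_usl4_tensor.abs_eq)
  qed
  then show ?thesis by (induction t) auto
qed

definition tensor2 :: "'k::field usl4 \<Rightarrow> 'k usl4 \<Rightarrow> ('k, 2) usl4_tensor" (infixl \<open>\<otimes>\<close> 75) where
  "a \<otimes> b = tens (vector [a, b])"

definition tensor3 :: "'k::field usl4 \<Rightarrow> 'k usl4 \<Rightarrow> 'k usl4 \<Rightarrow> ('k, 3) usl4_tensor" where
  "tensor3 a b c = tens (vector [a, b, c])"

lemma tensor2_eq: "tens v = (v $ 1) \<otimes> (v $ 2)"
  unfolding tensor2_def by (rule arg_cong[of _ _ tens]) (simp add: vec_eq_iff forall_2)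

lemma vec_upd_2:
  fixes a b :: "'a::zero"
  shows "vec_upd (vector [a, b] :: 'a ^ 2) 1 a' = vector [a', b]"
    and "vec_upd (vector [a, b] :: 'a ^ 2) 2 b' = vector [a, b']"
  by (simp_all add: vec_eq_iff forall_2 vec_upd_def)

lemma vec_upd_3:
  fixes a b c :: "'a::zero"
  shows "vec_upd (vector [a, b, c] :: 'a ^ 3) 1 a' = vector [a', b, c]"
    and "vec_upd (vector [a, b, c] :: 'a ^ 3) 2 b' = vector [a, b', c]"
    and "vec_upd (vector [a, b, c] :: 'a ^ 3) 3 c' = vector [a, b, c']"
  by (simp_all add: vec_eq_iff forall_3 vec_upd_def)

lemma tens_upd_add: "tens (vec_upd v i (a + b)) = tens (vec_upd v i a) + tens (vec_upd v i b)"
  and tens_upd_scale: "tens (vec_upd v i (usl4_scale c a)) = tensor_scale c (tens (vec_upd v i a))"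
  using multilinear_tens unfolding multilinear_def by blast+

lemma tensor2_add_left: "(a + a') \<otimes> b = a \<otimes> b + a' \<otimes> b"
  and tensor2_add_right: "a \<otimes> (b + b') = a \<otimes> b + a \<otimes> b'"
  and tensor2_scale_left: "usl4_scale x a \<otimes> b = tensor_scale x (a \<otimes> b)"
  and tensor2_scale_right: "a \<otimes> usl4_scale x b = tensor_scale x (a \<otimes> b)"
  unfolding tensor2_def
  using tens_upd_add[of "vector [a, b] :: _ ^ 2" 1 a a'] tens_upd_add[of "vector [a, b] :: _ ^ 2" 2 b b']
    tens_upd_scale[of "vector [a, b] :: _ ^ 2" 1 x a] tens_upd_scale[of "vector [a, b] :: _ ^ 2" 2 x b]
  by (simp_all add: vec_upd_2)

lemma tensor3_add:
  "tensor3 (a + a') b c = tensor3 a b c + tensor3 a' b c"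
  "tensor3 a (b + b') c = tensor3 a b c + tensor3 a b' c"
  "tensor3 a b (c + c') = tensor3 a b c + tensor3 a b c'"
  unfolding tensor3_def
  using tens_upd_add[of "vector [a, b, c] :: _ ^ 3" 1 a a'] tens_upd_add[of "vector [a, b, c] :: _ ^ 3" 2 b b']
    tens_upd_add[of "vector [a, b, c] :: _ ^ 3" 3 c c']
  by (simp_all add: vec_upd_3)

lemma tensor3_scale:
  "tensor3 (usl4_scale x a) b c = tensor_scale x (tensor3 a b c)"
  "tensor3 a (usl4_scale x b) c = tensor_scale x (tensor3 a b c)"
  "tensor3 a b (usl4_scale x c) = tensor_scale x (tensor3 a b c)"
  unfolding tensor3_def
  using tens_upd_scale[of "vector [a, b, c] :: _ ^ 3" 1 x a] tens_upd_scale[of "vector [a, b, c] :: _ ^ 3" 2 x b]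
    tens_upd_scale[of "vector [a, b, c] :: _ ^ 3" 3 x c]
  by (simp_all add: vec_upd_3)

lemma tensor2_mult: "(a \<otimes> b) * (c \<otimes> d) = (a * c) \<otimes> (b * d)"
  unfolding tensor2_def tens_mult
  by (rule arg_cong[of _ _ tens]) (simp add: vec_eq_iff forall_2)

lemma tensor3_mult: "tensor3 a b c * tensor3 a' b' c' = tensor3 (a * a') (b * b') (c * c')"
  unfolding tensor3_def tens_mult
  by (rule arg_cong[of _ _ tens]) (simp add: vec_eq_iff forall_3)

lemma tensor2_one: "1 \<otimes> 1 = 1"
  unfolding tensor2_def tens_one[symmetric]
  by (rule arg_cong[of _ _ tens]) (simp add: vec_eq_iff forall_2)

lemma tensor3_one: "tensor3 1 1 1 = 1"
  unfolding tensor3_def tens_one[symmetric]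
  by (rule arg_cong[of _ _ tens]) (simp add: vec_eq_iff forall_3)

lemma multilinear_2I:
  assumes "\<And>a a' b. g (a + a') b = g a b + g a' b" "\<And>a b b'. g a (b + b') = g a b + g a b'"
    and "\<And>x a b. g (usl4_scale x a) b = s x (g a b)" "\<And>x a b. g a (usl4_scale x b) = s x (g a b)"
  shows "multilinear s (\<lambda>v :: 'k::field usl4 ^ 2. g (v $ 1) (v $ 2))"
proof -
  have "vec_upd v 1 a $ 1 = a" "vec_upd v 1 a $ 2 = v $ 2"
    "vec_upd v 2 a $ 1 = v $ 1" "vec_upd v 2 a $ 2 = a" for v :: "'k usl4 ^ 2" and a
    by (simp_all add: vec_upd_def)
  then show ?thesis
    by (simp add: multilinear_def forall_2 assms)
qed


section \<open>The Hopf structure maps\<close>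

definition usl4_comult :: "'k::field usl4 \<Rightarrow> ('k, 2) usl4_tensor" where
  "usl4_comult = usl4_lift tensor_scale (\<lambda>x. usl4_gen x \<otimes> 1 + 1 \<otimes> usl4_gen x)"

lemma comult_lie_map: "lie_map tensor_scale (\<lambda>x. usl4_gen x \<otimes> 1 + 1 \<otimes> usl4_gen x)"
proof -
  have diff: "(a - a') \<otimes> b = a \<otimes> b - a' \<otimes> b" "b \<otimes> (a - a') = b \<otimes> a - b \<otimes> a'"
    for a a' b :: "'a usl4"
    using tensor2_add_left[of "a - a'" a' b] tensor2_add_right[of b "a - a'" a']
    by (simp_all add: eq_diff_eq)
  have gen: "usl4_gen (x + y) = usl4_gen x + usl4_gen y"
    "usl4_gen (sl4_scale c x) = usl4_scale c (usl4_gen x)"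
    "usl4_gen (sl4_bracket x y) = usl4_gen x * usl4_gen y - usl4_gen y * usl4_gen x"
    for x y :: "'a sl4" and c
    using lie_map_usl4_gen unfolding lie_map_def by blast+
  show ?thesis
    by (simp add: lie_map_def gen tensor2_add_left tensor2_add_right tensor2_scale_left
        tensor2_scale_right diff tensor2_mult tensor.scale_right_distrib algebra_simps)
qed

lemmas usl4_comult_simps =
  tensor.usl4_lift_gen[OF comult_lie_map, folded usl4_comult_def]
  tensor.usl4_lift_one[OF comult_lie_map, folded usl4_comult_def]
  tensor.usl4_lift_add[OF comult_lie_map, folded usl4_comult_def]
  tensor.usl4_lift_mult[OF comult_lie_map, folded usl4_comult_def]
  tensor.usl4_lift_scale[OF comult_lie_map, folded usl4_comult_def]

definition tensor_append :: "('k::field, 2) usl4_tensor \<Rightarrow> 'k usl4 \<Rightarrow> ('k, 3) usl4_tensor" where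
  "tensor_append t c = tensor_lift tensor_scale (\<lambda>v. tensor3 (v $ 1) (v $ 2) c) t"

definition tensor_prepend :: "'k::field usl4 \<Rightarrow> ('k, 2) usl4_tensor \<Rightarrow> ('k, 3) usl4_tensor" where
  "tensor_prepend a t = tensor_lift tensor_scale (\<lambda>v. tensor3 a (v $ 1) (v $ 2)) t"

definition leg12 :: "('k::field, 2) usl4_tensor \<Rightarrow> ('k, 3) usl4_tensor" where
  "leg12 t = tensor_append t 1"

definition leg23 :: "('k::field, 2) usl4_tensor \<Rightarrow> ('k, 3) usl4_tensor" where
  "leg23 t = tensor_prepend 1 t"

definition tensor_flip :: "('k::field, 2) usl4_tensor \<Rightarrow> ('k, 2) usl4_tensor" where
  "tensor_flip = tensor_lift tensor_scale (\<lambda>v. (v $ 2) \<otimes> (v $ 1))"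

definition comult_id :: "('k::field, 2) usl4_tensor \<Rightarrow> ('k, 3) usl4_tensor" where
  "comult_id = tensor_lift tensor_scale (\<lambda>v. tensor_append (usl4_comult (v $ 1)) (v $ 2))"

definition id_comult :: "('k::field, 2) usl4_tensor \<Rightarrow> ('k, 3) usl4_tensor" where
  "id_comult = tensor_lift tensor_scale (\<lambda>v. tensor_prepend (v $ 1) (usl4_comult (v $ 2)))"

definition counit_id :: "('k::field, 2) usl4_tensor \<Rightarrow> 'k usl4" where
  "counit_id = tensor_lift usl4_scale (\<lambda>v. usl4_scale (usl4_counit (v $ 1)) (v $ 2))"

definition id_counit :: "('k::field, 2) usl4_tensor \<Rightarrow> 'k usl4" where
  "id_counit = tensor_lift usl4_scale (\<lambda>v. usl4_scale (usl4_counit (v $ 2)) (v $ 1))"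

lemma multilinear_append: "multilinear tensor_scale (\<lambda>v :: _ ^ 2. tensor3 (v $ 1) (v $ 2) c)"
  by (rule multilinear_2I[where g = "\<lambda>x y. tensor3 x y c"]) (rule tensor3_add tensor3_scale)+

lemma multilinear_prepend: "multilinear tensor_scale (\<lambda>v :: _ ^ 2. tensor3 a (v $ 1) (v $ 2))"
  by (rule multilinear_2I[where g = "\<lambda>x y. tensor3 a x y"]) (rule tensor3_add tensor3_scale)+

lemma multilinear_flip: "multilinear tensor_scale (\<lambda>v :: _ ^ 2. (v $ 2) \<otimes> (v $ 1))"
  by (rule multilinear_2I[where g = "\<lambda>x y. y \<otimes> x"])
    (rule tensor2_add_left tensor2_add_right tensor2_scale_left tensor2_scale_right)+

lemma tensor_append_simps:
  "tensor_append (a \<otimes> b) c = tensor3 a b c"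
  "tensor_append (t + u) c = tensor_append t c + tensor_append u c"
  "tensor_append (tensor_scale x t) c = tensor_scale x (tensor_append t c)"
  unfolding tensor_append_def
  using tensor.tensor_lift_tens[OF multilinear_append, of c "vector [a, b]"]
  by (simp_all add: tensor2_def tensor.tensor_lift_add[OF multilinear_append]
      tensor.tensor_lift_scale[OF multilinear_append])

lemma tensor_prepend_simps:
  "tensor_prepend a (b \<otimes> c) = tensor3 a b c"
  "tensor_prepend a (t + u) = tensor_prepend a t + tensor_prepend a u"
  "tensor_prepend a (tensor_scale x t) = tensor_scale x (tensor_prepend a t)"
  unfolding tensor_prepend_def
  using tensor.tensor_lift_tens[OF multilinear_prepend, of a "vector [b, c]"]
  by (simp_all add: tensor2_def tensor.tensor_lift_add[OF multilinear_prepend]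
      tensor.tensor_lift_scale[OF multilinear_prepend])

lemma tensor_append_right:
  "tensor_append t (c + c') = tensor_append t c + tensor_append t c'"
  "tensor_append t (usl4_scale x c) = tensor_scale x (tensor_append t c)"
  by (induction t rule: tensor_induct)
    (simp_all add: tensor2_eq tensor_append_simps tensor3_add tensor3_scale
      tensor.scale_right_distrib mult.commute add_ac)

lemma tensor_prepend_left:
  "tensor_prepend (a + a') t = tensor_prepend a t + tensor_prepend a' t"
  "tensor_prepend (usl4_scale x a) t = tensor_scale x (tensor_prepend a t)"
  by (induction t rule: tensor_induct)
    (simp_all add: tensor2_eq tensor_prepend_simps tensor3_add tensor3_scale
      tensor.scale_right_distrib mult.commute add_ac)

lemma multilinear_comult_id:
  "multilinear tensor_scale (\<lambda>v :: _ ^ 2. tensor_append (usl4_comult (v $ 1)) (v $ 2))"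
  by (rule multilinear_2I[where g = "\<lambda>x y. tensor_append (usl4_comult x) y"])
    (simp_all add: usl4_comult_simps tensor_append_simps tensor_append_right)

lemma multilinear_id_comult:
  "multilinear tensor_scale (\<lambda>v :: _ ^ 2. tensor_prepend (v $ 1) (usl4_comult (v $ 2)))"
  by (rule multilinear_2I[where g = "\<lambda>x y. tensor_prepend x (usl4_comult y)"])
    (simp_all add: usl4_comult_simps tensor_prepend_simps tensor_prepend_left)

lemma multilinear_counit_id:
  "multilinear usl4_scale (\<lambda>v :: _ ^ 2. usl4_scale (usl4_counit (v $ 1)) (v $ 2))"
  by (rule multilinear_2I[where g = "\<lambda>x y. usl4_scale (usl4_counit x) y"])
    (simp_all add: usl4_counit_simps usl4.scale_left_distrib usl4.scale_right_distrib mult.commute)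

lemma multilinear_id_counit:
  "multilinear usl4_scale (\<lambda>v :: _ ^ 2. usl4_scale (usl4_counit (v $ 2)) (v $ 1))"
  by (rule multilinear_2I[where g = "\<lambda>x y. usl4_scale (usl4_counit y) x"])
    (simp_all add: usl4_counit_simps usl4.scale_left_distrib usl4.scale_right_distrib mult.commute)

lemma structure_maps_tensor2:
  "tensor_flip (a \<otimes> b) = b \<otimes> a"
  "comult_id (a \<otimes> b) = tensor_append (usl4_comult a) b"
  "id_comult (a \<otimes> b) = tensor_prepend a (usl4_comult b)"
  "counit_id (a \<otimes> b) = usl4_scale (usl4_counit a) b"
  "id_counit (a \<otimes> b) = usl4_scale (usl4_counit b) a"
  unfolding tensor_flip_def comult_id_def id_comult_def counit_id_def id_counit_def
    tensor2_def[of a b]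
  by (simp_all add: tensor.tensor_lift_tens[OF multilinear_flip]
      tensor.tensor_lift_tens[OF multilinear_comult_id]
      tensor.tensor_lift_tens[OF multilinear_id_comult]
      usl4.tensor_lift_tens[OF multilinear_counit_id]
      usl4.tensor_lift_tens[OF multilinear_id_counit])


section \<open>Power series\<close>

text \<open>\<open>'k usl4 fps\<close> is \<open>U(sl\<^sub>4)[[\<zeta>]]\<close>, and \<open>('k, 2) usl4_tensor fps\<close> and \<open>('k, 3) usl4_tensor fps\<close> are
  its \<open>\<zeta>\<close>-adically completed tensor square and cube; \<open>\<zeta>\<close> is \<^term>\<open>fps_X\<close>.\<close>

definition fps_map :: "('a \<Rightarrow> 'b) \<Rightarrow> 'a fps \<Rightarrow> 'b fps" where
  "fps_map f A = Abs_fps (\<lambda>n. f (fps_nth A n))"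

definition fps_tensor :: "'k::field usl4 fps \<Rightarrow> 'k usl4 fps \<Rightarrow> ('k, 2) usl4_tensor fps"
    (infixl \<open>\<otimes>\<^sub>\<zeta>\<close> 75) where
  "A \<otimes>\<^sub>\<zeta> B = Abs_fps (\<lambda>n. \<Sum>i=0..n. fps_nth A i \<otimes> fps_nth B (n - i))"

text \<open>The value \<open>\<Sum>k. a\<^sub>k x\<^sup>k\<close> of a scalar power series at a series \<open>x\<close> without constant term.\<close>

definition fps_subst :: "('k \<Rightarrow> 'a \<Rightarrow> 'a) \<Rightarrow> 'k fps \<Rightarrow> 'a::ring_1 fps \<Rightarrow> 'a fps" where
  "fps_subst s a x = Abs_fps (\<lambda>n. \<Sum>k=0..n. s (fps_nth a k) (fps_nth (x ^ k) n))"

definition fps_Exp :: "('k::field_char_0 \<Rightarrow> 'a \<Rightarrow> 'a) \<Rightarrow> 'a::ring_1 fps \<Rightarrow> 'a fps" where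
  "fps_Exp s x = fps_subst s (fps_exp 1) x"

definition fps_Ln :: "('k::field_char_0 \<Rightarrow> 'a \<Rightarrow> 'a) \<Rightarrow> 'a::ring_1 fps \<Rightarrow> 'a fps" where
  "fps_Ln s y = fps_subst s (fps_ln 1) (y - 1)"

text \<open>\<open>y\<^sup>(\<^sup>D\<^sup>)\<close> for \<open>y\<close> with constant term \<open>1\<close> commuting with \<open>D\<close>.\<close>

definition tensor_powr :: "('k::field_char_0, 2) usl4_tensor fps \<Rightarrow> ('k, 2) usl4_tensor fps
    \<Rightarrow> ('k, 2) usl4_tensor fps" where
  "tensor_powr y D = fps_Exp tensor_scale (D * fps_Ln tensor_scale y)"

definition is_inverse :: "'a::monoid_mult \<Rightarrow> 'a \<Rightarrow> bool" where
  "is_inverse x y \<longleftrightarrow> x * y = 1 \<and> y * x = 1"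

definition ring_inverse :: "'a::monoid_mult \<Rightarrow> 'a" where
  "ring_inverse x = (THE y. is_inverse x y)"

lemma ring_inverse_eq:
  assumes "is_inverse x y"
  shows "ring_inverse x = y"
  unfolding ring_inverse_def
proof (rule the_equality)
  show "z = y" if "is_inverse x z" for z
    using assms that unfolding is_inverse_def by (metis mult.assoc mult_1_left mult_1_right)
qed (rule assms)


section \<open>Twists of \<open>U(sl\<^sub>4)[[\<zeta>]]\<close>\<close>

definition usl4_twist :: "('k::field, 2) usl4_tensor fps \<Rightarrow> bool" where
  "usl4_twist F \<longleftrightarrow>
     (\<exists>G. is_inverse F G) \<and>
     fps_map leg12 F * fps_map comult_id F
       = fps_map leg23 F * fps_map id_comult F \<and>
     fps_map counit_id F = 1 \<and> fps_map id_counit F = 1"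

definition universal_R :: "('k::field, 2) usl4_tensor fps \<Rightarrow> ('k, 2) usl4_tensor fps" where
  "universal_R F = fps_map tensor_flip F * ring_inverse F"

definition wedge :: "'k::field usl4 \<Rightarrow> 'k usl4 \<Rightarrow> ('k, 2) usl4_tensor" (infixl \<open>\<^bold>\<and>\<close> 75) where
  "a \<^bold>\<and> b = a \<otimes> b - b \<otimes> a"


section \<open>The parabolic twist\<close>

definition E\<^sub>U :: "4 \<Rightarrow> 4 \<Rightarrow> 'k::field usl4" where
  "E\<^sub>U i j = usl4_gen (Abs_sl4 (matrix_unit i j))"

definition D_matrix :: "nat \<Rightarrow> 'k::field_char_0 ^ 4 ^ 4" where
  "D_matrix p = matrix_scale ((4 - of_nat p) / 4) (\<Sum>i=1..p. matrix_unit (of_nat i) (of_nat i))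
     - matrix_scale (of_nat p / 4) (\<Sum>i=p+1..4. matrix_unit (of_nat i) (of_nat i))"

definition D\<^sub>U :: "nat \<Rightarrow> 'k::field_char_0 usl4" where
  "D\<^sub>U p = usl4_gen (Abs_sl4 (D_matrix p))"

lemma Rep_E: "i \<noteq> j \<Longrightarrow> Rep_sl4 (Abs_sl4 (matrix_unit i j)) = matrix_unit i j"
  by (rule Abs_sl4_inverse) (auto simp: trace_def matrix_unit_def intro!: sum.neutral)

lemma Rep_D:
  assumes "p \<in> {1, 2, 3}"
  shows "Rep_sl4 (Abs_sl4 (D_matrix p)) = D_matrix p"
proof (rule Abs_sl4_inverse)
  have ivl: "{Suc 0..2} = {1, 2::nat}" "{Suc 0..3} = {1, 2, 3::nat}"
    "{2..4} = {2, 3, 4::nat}" "{3..4} = {3, 4::nat}" "{Suc 2..4} = {3, 4::nat}" "{Suc 3..4} = {4::nat}"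
    "{Suc (Suc 0)..4} = {2, 3, 4::nat}"
    by auto
  show "D_matrix p \<in> {A. trace A = 0}"
    using assms
    by (auto simp: trace_def sum_4 D_matrix_def matrix_scale_def matrix_unit_def ivl)
qed

definition twist_p :: "('k::field_char_0, 2) usl4_tensor fps" where
  "twist_p =
    (let \<zeta> = fps_X :: 'k usl4 fps;
         \<zeta>\<zeta> = fps_X :: ('k, 2) usl4_tensor fps;
         e = (\<lambda>i j. fps_const (E\<^sub>U i j) :: 'k usl4 fps);
         d = (\<lambda>p. fps_const (D\<^sub>U p) :: 'k usl4 fps);
         \<sigma> = fps_Ln usl4_scale (1 - \<zeta> * e 1 2);
         exp_neg_\<sigma> = fps_Exp usl4_scale (- \<sigma>);
         expT = fps_Exp tensor_scale
     in tensor_powr (1 \<otimes>\<^sub>\<zeta> 1 - \<zeta>\<zeta> * (1 \<otimes>\<^sub>\<zeta> e 2 3) + \<zeta>\<zeta>^2 * (d 3 \<otimes>\<^sub>\<zeta> (e 1 3 * exp_neg_\<sigma>))) (d 3 \<otimes>\<^sub>\<zeta> 1)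
      * tensor_powr (1 \<otimes>\<^sub>\<zeta> 1 - \<zeta>\<zeta> * (1 \<otimes>\<^sub>\<zeta> e 3 4)) (d 3 \<otimes>\<^sub>\<zeta> 1)
      * expT (- (\<zeta>\<zeta>^2 * ((e 4 3 * (d 2 + d 3)) \<otimes>\<^sub>\<zeta> (e 1 4 * exp_neg_\<sigma>))))
      * expT (\<zeta>\<zeta> * (e 4 3 \<otimes>\<^sub>\<zeta> (e 2 4 - \<zeta> * e 3 4 * e 1 3 * exp_neg_\<sigma>)))
      * expT (\<zeta>\<zeta> * (e 4 3 \<otimes>\<^sub>\<zeta> (e 1 3 * exp_neg_\<sigma>)))
      * tensor_powr (1 \<otimes>\<^sub>\<zeta> 1 - \<zeta>\<zeta> * (1 \<otimes>\<^sub>\<zeta> e 2 3) + \<zeta>\<zeta>^2 * (d 2 \<otimes>\<^sub>\<zeta> (e 1 3 * exp_neg_\<sigma>))) ((d 2 - d 3) \<otimes>\<^sub>\<zeta> 1)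
      * expT (\<zeta>\<zeta> * (e 3 2 \<otimes>\<^sub>\<zeta> (e 1 3 * exp_neg_\<sigma>)) + \<zeta>\<zeta> * (e 4 2 \<otimes>\<^sub>\<zeta> (e 1 4 * exp_neg_\<sigma>)))
      * expT (d 1 \<otimes>\<^sub>\<zeta> \<sigma>))"

definition r_p :: "('k::field_char_0, 2) usl4_tensor" where
  "r_p = D\<^sub>U 1 \<^bold>\<and> E\<^sub>U 1 2 + E\<^sub>U 1 4 \<^bold>\<and> E\<^sub>U 4 2 + E\<^sub>U 1 3 \<^bold>\<and> E\<^sub>U 3 2 + D\<^sub>U 2 \<^bold>\<and> E\<^sub>U 2 3
       + E\<^sub>U 2 4 \<^bold>\<and> E\<^sub>U 4 3 + D\<^sub>U 3 \<^bold>\<and> E\<^sub>U 3 4 + E\<^sub>U 1 3 \<^bold>\<and> E\<^sub>U 4 3"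

end

theory Submission
  imports Defs
begin

text \<open>Write \<open>F = G J\<close>, where \<open>J\<close> is the product of the last two factors of the twist \<open>F\<close> and \<open>G\<close> that of the
  first six. With \<open>q = \<zeta> E\<^sub>1\<^sub>3 e\<^sup>-\<^sup>\<sigma>\<close>, \<open>u = \<zeta> E\<^sub>1\<^sub>4 e\<^sup>-\<^sup>\<sigma>\<close>, \<open>s = \<zeta> u\<close> and \<open>w = \<zeta> E\<^sub>2\<^sub>4 - \<zeta> E\<^sub>3\<^sub>4 q\<close>, the factor
  \<open>J = exp(E\<^sub>3\<^sub>2 \<otimes> q + E\<^sub>4\<^sub>2 \<otimes> u) exp(D\<^sub>1 \<otimes> \<sigma>)\<close> is an extended Jordanian twist.

  Conjugation by \<open>J\<close> makes \<open>e\<^sup>\<sigma>\<close> group-like and \<open>q\<close>, \<open>u\<close> primitive for the coproduct \<open>\<Delta>\<^sub>J = J \<Delta> J\<^sup>-\<^sup>1\<close>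
  (\<open>JT_x\<close>, \<open>JT_q\<close>); both sides of the Drinfeld equation of \<open>J\<close> then become products of the same
  exponentials, which only have to be reordered (\<open>JT_cocycle\<close>). The elements \<open>E\<^sub>3\<^sub>4\<close>, \<open>E\<^sub>4\<^sub>3\<close>, \<open>D\<^sub>2\<close>, \<open>D\<^sub>3\<close>
  stay primitive, and \<open>E\<^sub>2\<^sub>3\<close> acquires a correction (\<open>JT_23\<close>). Moving \<open>J\<close> to the right reduces the Drinfeld
  equation of \<open>F\<close> to \<open>G\<^sub>1\<^sub>2 (\<Delta> \<otimes> id)(G) = G\<^sub>2\<^sub>3 (id \<otimes> \<Delta>\<^sub>J)(G)\<close>.

  In its first factor \<open>G\<close> involves only \<open>D = D\<^sub>3\<close>, \<open>C = D\<^sub>2\<close> and \<open>f = E\<^sub>4\<^sub>3\<close>, where \<open>f D = (D + 1) f\<close> and \<open>C\<close>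
  commutes with \<open>D\<close> and \<open>f\<close>. In its second factor it involves only \<open>a = 1 - \<zeta> E\<^sub>2\<^sub>3\<close>, \<open>e = \<zeta> E\<^sub>3\<^sub>4\<close>, \<open>q\<close>, \<open>s\<close>,
  \<open>w\<close>, which satisfy quadratic relations (\<open>quad_rels\<close>). Moving all powers of \<open>f\<close> to the right gives
  \<open>G = \<Sum>m. V\<^sub>m(D, C) f\<^sup>m\<close> (\<open>T_eq\<close>), and the \<open>V\<^sub>m\<close> satisfy one recursion for \<open>C \<mapsto> C + 1\<close> and one for
  \<open>D \<mapsto> D + 1\<close> (\<open>V_Suc_C\<close>, \<open>V_Suc_D\<close>). Expanding both sides of the equation for \<open>G\<close> in powers of the first
  \<open>f\<close> yields two families of coefficients which obey these same recursions, with the quadratic generators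
  replaced by their images under \<open>\<Delta>\<^sub>J\<close> (\<open>LL_Suc_C\<close>, \<open>LL_Suc_D\<close>). The recursions together with one
  initial value determine such a family (\<open>family_zero\<close>), so the two agree.

  The recursions are proved with natural numbers \<open>i\<close>, \<open>c\<close>, \<open>c \<ge> i + m\<close>, in the places of \<open>D\<close> and \<open>C\<close>,
  where the powers \<open>exp(D ln y)\<close> are powers \<open>y\<^sup>i\<close> in the ring. Every coefficient of a power of \<open>\<zeta>\<close> is
  polynomial in \<open>D\<close> and \<open>C\<close>, so an identity that holds for all these numbers holds for any two commuting
  elements which commute with the generators (\<open>polyfam_unique\<close>).\<close>

unbundle no vec_syntax
unbundle fps_syntax

section \<open>Exponentials and logarithms of power series over an algebra\<close>

definition graded :: "(nat \<Rightarrow> 'a::zero fps) \<Rightarrow> bool" where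
  "graded X \<longleftrightarrow> (\<forall>m n. n < m \<longrightarrow> X m $ n = 0)"

text \<open>The \<open>\<zeta>\<close>-adically convergent sum of a family with \<open>graded X\<close>: the terms beyond
  \<open>m = n\<close> do not contribute to the coefficient at \<open>n\<close>.\<close>

definition graded_sum :: "(nat \<Rightarrow> 'a::comm_monoid_add fps) \<Rightarrow> 'a fps" where
  "graded_sum X = Abs_fps (\<lambda>n. \<Sum>m\<le>n. X m $ n)"

lemma gradedD: "graded X \<Longrightarrow> n < m \<Longrightarrow> X m $ n = 0"
  by (simp add: graded_def)

lemma graded_sum_nth: "graded_sum X $ n = (\<Sum>m\<le>n. X m $ n)"
  by (simp add: graded_sum_def)

lemma graded_sum_nth_le:
  assumes "graded X" "n \<le> N"
  shows "graded_sum X $ n = (\<Sum>m\<le>N. X m $ n)"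
  unfolding graded_sum_nth
  by (rule sum.mono_neutral_left) (use assms in \<open>auto simp: graded_def\<close>)

lemma graded_mult_left: "graded X \<Longrightarrow> graded (\<lambda>m. (y :: 'a::ring_1 fps) * X m)"
  unfolding graded_def fps_mult_nth by (auto intro!: sum.neutral)

lemma graded_mult_right: "graded X \<Longrightarrow> graded (\<lambda>m. X m * (y :: 'a::ring_1 fps))"
  unfolding graded_def fps_mult_nth by (auto intro!: sum.neutral)

lemma nth_mult_low:
  fixes x y :: "'a::ring_1 fps"
  assumes "\<And>j. j < p \<Longrightarrow> x $ j = 0" "\<And>j. j < q \<Longrightarrow> y $ j = 0" "n < p + q"
  shows "(x * y) $ n = 0"
  unfolding fps_mult_nth
proof (rule sum.neutral, safe)
  fix i assume "i \<in> {0..n}"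
  then have "i < p \<or> n - i < q" using assms(3) by auto
  then show "x $ i * y $ (n - i) = 0" using assms(1,2) by auto
qed

lemma graded_prod:
  fixes X Y :: "nat \<Rightarrow> 'a::ring_1 fps"
  assumes "graded X" "graded Y" "n < k + l"
  shows "(X k * Y l) $ n = 0"
  by (rule nth_mult_low[of k _ l]) (use assms in \<open>auto dest: gradedD simp: not_le[symmetric]\<close>)

lemma graded_power:
  fixes x :: "'a::ring_1 fps"
  assumes "x $ 0 = 0"
  shows "graded (\<lambda>k. x ^ k)"
  unfolding graded_def
proof (intro allI)
  show "n < m \<longrightarrow> x ^ m $ n = 0" for m n
  proof (induction m arbitrary: n)
    case (Suc m)
    have "(x * x ^ m) $ n = 0" if "n < Suc m"
      by (rule nth_mult_low[of 1 _ m]) (use assms Suc that in auto)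
    then show ?case by simp
  qed simp
qed

lemma graded_sum_cong: "(\<And>m. X m = Y m) \<Longrightarrow> graded_sum X = graded_sum Y"
  by (simp add: graded_sum_def)

lemma graded_sum_add: "graded_sum (\<lambda>m. X m + Y m) = graded_sum X + graded_sum Y"
  by (simp add: fps_eq_iff graded_sum_nth sum.distrib)

lemma graded_sum_single: "(\<And>m. m \<noteq> 0 \<Longrightarrow> X m = 0) \<Longrightarrow> graded_sum X = X 0"
proof -
  assume "\<And>m. m \<noteq> 0 \<Longrightarrow> X m = 0"
  then have "(\<Sum>m\<le>n. X m $ n) = X 0 $ n" for n
    by (subst sum.remove[of _ 0]) auto
  then show ?thesis by (simp add: fps_eq_iff graded_sum_nth)
qed

lemma mult_graded_sum:
  fixes X :: "nat \<Rightarrow> 'a::ring_1 fps"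
  assumes "graded X"
  shows "y * graded_sum X = graded_sum (\<lambda>m. y * X m)"
proof (rule fps_ext)
  fix n
  have "(y * graded_sum X) $ n = (\<Sum>i=0..n. y $ i * (\<Sum>m\<le>n. X m $ (n - i)))"
    unfolding fps_mult_nth by (intro sum.cong refl) (simp add: graded_sum_nth_le[OF assms, of _ n])
  also have "\<dots> = (\<Sum>m\<le>n. \<Sum>i=0..n. y $ i * X m $ (n - i))"
    by (simp add: sum_distrib_left, rule sum.swap)
  finally show "(y * graded_sum X) $ n = graded_sum (\<lambda>m. y * X m) $ n"
    by (simp add: graded_sum_nth fps_mult_nth)
qed

lemma graded_sum_mult:
  fixes X :: "nat \<Rightarrow> 'a::ring_1 fps"
  assumes "graded X"
  shows "graded_sum X * y = graded_sum (\<lambda>m. X m * y)"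
proof (rule fps_ext)
  fix n
  have "(graded_sum X * y) $ n = (\<Sum>i=0..n. (\<Sum>m\<le>n. X m $ i) * y $ (n - i))"
    unfolding fps_mult_nth by (intro sum.cong refl) (simp add: graded_sum_nth_le[OF assms, of _ n])
  also have "\<dots> = (\<Sum>m\<le>n. \<Sum>i=0..n. X m $ i * y $ (n - i))"
    by (simp add: sum_distrib_right, rule sum.swap)
  finally show "(graded_sum X * y) $ n = graded_sum (\<lambda>m. X m * y) $ n"
    by (simp add: graded_sum_nth fps_mult_nth)
qed

lemma graded_sum_diagonal:
  fixes Y :: "nat \<Rightarrow> nat \<Rightarrow> 'a::ring_1 fps"
  assumes "\<And>k l n. n < k + l \<Longrightarrow> Y k l $ n = 0"
  shows "graded_sum (\<lambda>k. graded_sum (Y k)) = graded_sum (\<lambda>m. \<Sum>k\<le>m. Y k (m - k))"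
proof (rule fps_ext)
  fix n
  have "(\<Sum>m\<le>n. \<Sum>k\<le>m. Y k (m - k) $ n) = (\<Sum>(k, l) | k + l \<le> n. Y k l $ n)"
    by (rule sum.triangle_reindex_eq[symmetric])
  also have "\<dots> = (\<Sum>(k, l)\<in>{..n} \<times> {..n}. Y k l $ n)"
    by (rule sum.mono_neutral_left) (auto intro!: assms)
  also have "\<dots> = (\<Sum>k\<le>n. \<Sum>l\<le>n. Y k l $ n)"
    by (simp add: sum.cartesian_product)
  finally show "graded_sum (\<lambda>k. graded_sum (Y k)) $ n = graded_sum (\<lambda>m. \<Sum>k\<le>m. Y k (m - k)) $ n"
    by (simp add: graded_sum_nth fps_sum_nth)
qed

lemma graded_sum_times:
  fixes X Y :: "nat \<Rightarrow> 'a::ring_1 fps"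
  assumes "graded X" "graded Y"
  shows "graded_sum X * graded_sum Y = graded_sum (\<lambda>m. \<Sum>k\<le>m. X k * Y (m - k))"
proof -
  have "graded_sum X * graded_sum Y = graded_sum (\<lambda>k. graded_sum (\<lambda>l. X k * Y l))"
    by (subst graded_sum_mult[OF assms(1)]) (simp add: mult_graded_sum[OF assms(2)])
  also have "\<dots> = graded_sum (\<lambda>m. \<Sum>k\<le>m. X k * Y (m - k))"
    by (rule graded_sum_diagonal) (rule graded_prod[OF assms])
  finally show ?thesis .
qed

lemma graded_sum_shift:
  assumes "graded X" "X 0 = 0"
  shows "graded_sum X = graded_sum (\<lambda>m. X (Suc m))"
proof (rule fps_ext)
  fix n
  have "graded_sum X $ n = (\<Sum>m\<le>Suc n. X m $ n)"
    by (rule graded_sum_nth_le[OF assms(1)]) simp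
  then show "graded_sum X $ n = graded_sum (\<lambda>m. X (Suc m)) $ n"
    by (subst (asm) sum.atMost_Suc_shift) (simp add: assms(2) graded_sum_nth)
qed

lemma graded_Suc: "graded X \<Longrightarrow> graded (\<lambda>m. X (Suc m))"
  by (auto simp: graded_def)

lemma graded_mult:
  fixes X Y :: "nat \<Rightarrow> 'a::ring_1 fps"
  assumes "\<And>m n. n < m \<Longrightarrow> X m $ n = 0"
  shows "graded (\<lambda>m. X m * Y m)"
proof -
  have "(X m * Y m) $ n = 0" if "n < m" for m n
    by (rule nth_mult_low[of m _ 0]) (use assms that in auto)
  then show ?thesis by (simp add: graded_def)
qed

lemma graded_sum_diff: "graded_sum (\<lambda>m. X m - Y m) = graded_sum X - graded_sum (Y :: nat \<Rightarrow> 'a::ab_group_add fps)"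
  by (simp add: fps_eq_iff graded_sum_nth sum_subtractf)

lemma fps_X_cancel: "fps_X * (x :: 'a::ring_1 fps) = 0 \<Longrightarrow> x = 0"
proof (rule fps_ext)
  fix n assume "fps_X * x = 0"
  then have "(fps_X * x) $ Suc n = 0" by simp
  then show "x $ n = 0 $ n" by simp
qed

lemma of_nat_left_comm: "x * (of_nat n * y) = of_nat n * (x * (y :: 'a::ring_1))"
  by (metis mult.assoc mult_of_nat_commute)

text \<open>Pascal's rule \<open>S\<^sub>m\<^sub>+\<^sub>1 = x S\<^sub>m + S\<^sub>m y\<close> for
  \<open>S\<^sub>m = \<Sum>k. binom(m, k) x\<^sup>k y\<^sup>m\<^sup>-\<^sup>k\<close> needs no commutation of \<open>x\<close> and \<open>y\<close>.\<close>

lemma binomial_ordered: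
  fixes x y :: "'a::ring_1"
  assumes "S 0 = 1" "\<And>m. S (Suc m) = x * S m + S m * y"
  shows "S m = (\<Sum>k\<le>m. of_nat (m choose k) * (x ^ k * y ^ (m - k)))"
proof (induction m)
  case (Suc m)
  let ?t = "\<lambda>k. x ^ k * y ^ (Suc m - k)"
  have "S (Suc m) = (\<Sum>k\<le>m. of_nat (m choose k) * ?t (Suc k)) + (\<Sum>k\<le>m. of_nat (m choose k) * ?t k)"
    unfolding assms(2) Suc sum_distrib_left sum_distrib_right
  proof (intro arg_cong2[where f = "(+)"] sum.cong refl)
    fix k assume k: "k \<in> {..m}"
    show "x * (of_nat (m choose k) * (x ^ k * y ^ (m - k))) = of_nat (m choose k) * ?t (Suc k)"
      by simp
        (metis mult.assoc mult_of_nat_commute)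
    show "of_nat (m choose k) * (x ^ k * y ^ (m - k)) * y = of_nat (m choose k) * ?t k"
      using k by (simp add: Suc_diff_le power_Suc2 mult.assoc del: power_Suc)
  qed
  also have "(\<Sum>k\<le>m. of_nat (m choose k) * ?t k) = ?t 0 + (\<Sum>k\<le>m. of_nat (m choose Suc k) * ?t (Suc k))"
  proof -
    have "(\<Sum>k\<le>m. of_nat (m choose k) * ?t k) = (\<Sum>k\<le>Suc m. of_nat (m choose k) * ?t k)"
      by (simp add: binomial_eq_0)
    also have "\<dots> = ?t 0 + (\<Sum>k\<le>m. of_nat (m choose Suc k) * ?t (Suc k))"
      by (subst sum.atMost_Suc_shift) simp
    finally show ?thesis .
  qed
  finally show ?case
    by (subst sum.atMost_Suc_shift) (simp add: distrib_right sum.distrib algebra_simps)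
qed (simp add: assms)

locale char0_algebra = assoc_algebra scale
  for scale :: "'k::field_char_0 \<Rightarrow> 'a::ring_1 \<Rightarrow> 'a"
begin

definition sc :: "'k \<Rightarrow> 'a fps" where
  "sc c = fps_const (scale c 1)"

lemma sc_nth: "(sc c * x) $ n = scale c (x $ n)"
  by (simp add: sc_def scale_mult_left)

lemma sc_comm: "x * sc c = sc c * x"
  by (simp add: fps_eq_iff sc_def scale_mult_left scale_mult_right)

lemma sc_left_comm: "x * (sc c * y) = sc c * (x * y)"
  by (metis mult.assoc sc_comm)

lemma sc_add: "sc (c + d) = sc c + sc d"
  by (simp add: sc_def scale_left_distrib)

lemma sc_mult: "sc (c * d) = sc c * sc d"
  by (simp add: sc_def scale_mult_left)

lemma sc_0 [simp]: "sc 0 = 0" and sc_1 [simp]: "sc 1 = 1"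
  by (simp_all add: sc_def)

lemma sc_minus: "sc (- c) = - sc c"
  using sc_add[of c "-c"] by (simp add: eq_neg_iff_add_eq_0 add.commute)

lemma sc_of_nat: "sc (of_nat n) = of_nat n"
  by (induction n) (simp_all add: sc_add)

lemma sc_cancel: "c \<noteq> 0 \<Longrightarrow> sc c * x = 0 \<Longrightarrow> x = 0"
  by (simp add: fps_eq_iff sc_nth)

abbreviation "Sub \<equiv> fps_subst scale"
abbreviation "Exp \<equiv> fps_Exp scale"
abbreviation "Lnf \<equiv> fps_Ln scale"

lemma graded_subst: "x $ 0 = 0 \<Longrightarrow> graded (\<lambda>k. sc (c k) * x ^ k)"
  by (simp add: graded_def sc_nth gradedD[OF graded_power])

lemma subst_eq: "Sub a x = graded_sum (\<lambda>k. sc (a $ k) * x ^ k)"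
  by (simp add: fps_eq_iff fps_subst_def graded_sum_nth sc_nth atLeast0AtMost)

lemma subst_mult:
  assumes "x $ 0 = 0"
  shows "Sub (a * b) x = Sub a x * Sub b x"
proof -
  have "(\<Sum>k\<le>m. sc (a $ k) * x ^ k * (sc (b $ (m - k)) * x ^ (m - k))) = sc ((a * b) $ m) * x ^ m" for m
  proof -
    have "sc (a $ k) * x ^ k * (sc (b $ (m - k)) * x ^ (m - k)) = sc (a $ k * b $ (m - k)) * x ^ m"
      if "k \<le> m" for k
      using that by (simp add: sc_left_comm[of "x ^ k"] sc_mult mult.assoc flip: power_add)
    moreover have "(\<Sum>k\<in>A. sc (f k)) = sc (\<Sum>k\<in>A. f k)" for A :: "nat set" and f
      by (induction A rule: infinite_finite_induct) (simp_all add: sc_add)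
    ultimately show ?thesis
      by (simp add: fps_mult_nth atLeast0AtMost flip: sum_distrib_right)
  qed
  then show ?thesis
    unfolding subst_eq by (subst graded_sum_times) (simp_all add: graded_subst assms)
qed

lemma subst_add: "Sub (a + b) x = Sub a x + Sub b x"
  by (simp add: subst_eq sc_add distrib_right graded_sum_add)

lemma subst_1: "Sub 1 x = 1"
  unfolding subst_eq by (subst graded_sum_single) auto

lemma subst_X: "x $ 0 = 0 \<Longrightarrow> Sub fps_X x = x"
proof (rule fps_ext)
  fix n assume "x $ 0 = 0"
  then show "Sub fps_X x $ n = x $ n"
    by (cases n) (auto simp: fps_subst_def fps_X_def if_distrib[of "\<lambda>c. scale c _"] cong: if_cong)
qed

lemma subst_power: "x $ 0 = 0 \<Longrightarrow> Sub (a ^ n) x = Sub a x ^ n"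
  by (induction n) (simp_all add: subst_1 subst_mult)

lemma subst_nth_0: "Sub a x $ 0 = scale (a $ 0) 1"
  by (simp add: fps_subst_def)

text \<open>This carries \<open>exp (ln y) = y\<close> over from scalar power series to series over a noncommutative algebra.\<close>

lemma subst_compose:
  assumes "x $ 0 = 0" "b $ 0 = 0"
  shows "Sub (a oo b) x = Sub a (Sub b x)"
proof (rule fps_ext)
  fix n
  have b: "Sub b x $ 0 = 0" by (simp add: subst_nth_0 assms)
  have "Sub a (Sub b x) $ n = (\<Sum>i=0..n. scale (a $ i) (Sub (b ^ i) x $ n))"
    by (simp add: fps_subst_def[of _ a] subst_power assms)
  also have "\<dots> = (\<Sum>i=0..n. \<Sum>k=0..n. scale (a $ i * (b ^ i) $ k) (x ^ k $ n))"
    by (simp add: fps_subst_def scale_sum_right)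
  also have "\<dots> = (\<Sum>k=0..n. \<Sum>i=0..n. scale (a $ i * (b ^ i) $ k) (x ^ k $ n))"
    by (rule sum.swap)
  also have "\<dots> = (\<Sum>k=0..n. scale ((a oo b) $ k) (x ^ k $ n))"
  proof (rule sum.cong[OF refl])
    fix k assume "k \<in> {0..n}"
    then have "(\<Sum>i=0..n. a $ i * (b ^ i) $ k) = (\<Sum>i=0..k. a $ i * (b ^ i) $ k)"
      by (intro sum.mono_neutral_right) (auto simp: gradedD[OF graded_power[OF assms(2)]])
    then show "(\<Sum>i=0..n. scale (a $ i * (b ^ i) $ k) (x ^ k $ n)) = scale ((a oo b) $ k) (x ^ k $ n)"
      by (simp add: fps_compose_nth flip: scale_sum_left)
  qed
  finally show "Sub (a oo b) x $ n = Sub a (Sub b x) $ n"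
    by (simp add: fps_subst_def)
qed

lemma Exp_eq: "Exp x = graded_sum (\<lambda>k. sc (1 / fact k) * x ^ k)"
  by (simp add: fps_Exp_def subst_eq)

lemma Exp_0 [simp]: "Exp 0 = 1"
  unfolding Exp_eq by (subst graded_sum_single) (auto simp: power_0_left)

lemma Exp_nth_0: "Exp x $ 0 = 1"
  by (simp add: fps_Exp_def subst_nth_0)

lemma Ln_1 [simp]: "Lnf 1 = 0"
  by (simp add: fps_eq_iff fps_Ln_def fps_subst_def power_0_left fps_ln_nth
      if_distrib[of "\<lambda>x. x $ _"] cong: if_cong)

lemma Ln_nth_0: "Lnf y $ 0 = 0"
  by (simp add: fps_Ln_def subst_nth_0)

text \<open>No relation between \<open>x\<close> and \<open>y\<close> is imposed: any \<open>S\<close> with \<open>S\<^sub>m\<^sub>+\<^sub>1 = x S\<^sub>m + S\<^sub>m y\<close> is the ordered binomial sum.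
  Guessing \<open>S\<close> in closed form merges two exponentials that do not commute (\<open>normal_order_step\<close>).\<close>

lemma Exp_mult_Exp:
  assumes "x $ 0 = 0" "y $ 0 = 0" "S 0 = 1" "\<And>m. S (Suc m) = x * S m + S m * y"
  shows "Exp x * Exp y = graded_sum (\<lambda>m. sc (1 / fact m) * S m)"
proof -
  have S: "S m = (\<Sum>k\<le>m. of_nat (m choose k) * (x ^ k * y ^ (m - k)))" for m
    by (rule binomial_ordered) (rule assms(3,4))+
  have "sc (1 / fact m) * S m = (\<Sum>k\<le>m. sc (1 / fact k) * x ^ k * (sc (1 / fact (m - k)) * y ^ (m - k)))" for m
    unfolding S sum_distrib_left
  proof (rule sum.cong[OF refl])
    fix k assume "k \<in> {..m}"
    then have "(1 / fact m :: 'k) * of_nat (m choose k) = 1 / fact k * (1 / fact (m - k))"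
      by (simp add: binomial_fact)
    then show "sc (1 / fact m) * (of_nat (m choose k) * (x ^ k * y ^ (m - k)))
      = sc (1 / fact k) * x ^ k * (sc (1 / fact (m - k)) * y ^ (m - k))"
      by (metis (no_types, lifting) mult.assoc sc_left_comm sc_mult sc_of_nat)
  qed
  then show ?thesis
    unfolding Exp_eq by (subst graded_sum_times) (simp_all add: graded_subst assms)
qed

lemma Exp_add:
  assumes "x $ 0 = 0" "y $ 0 = 0" "x * y = y * x"
  shows "Exp (x + y) = Exp x * Exp y"
proof -
  have "(x + y) ^ m * y = y * (x + y) ^ m" for m
    by (rule power_commuting_commutes) (use assms in \<open>simp add: algebra_simps\<close>)
  then have "Exp x * Exp y = graded_sum (\<lambda>m. sc (1 / fact m) * (x + y) ^ m)"
    by (intro Exp_mult_Exp) (simp_all add: assms distrib_right)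
  then show ?thesis by (simp add: Exp_eq)
qed

lemma Exp_uminus:
  assumes "x $ 0 = 0"
  shows "Exp x * Exp (- x) = 1" "Exp (- x) * Exp x = 1"
  using Exp_add[of x "- x"] Exp_add[of "- x" x] assms by simp_all

lemma Exp_of_nat: "x $ 0 = 0 \<Longrightarrow> Exp (of_nat n * x) = Exp x ^ n"
proof (induction n)
  case (Suc n)
  have "Exp (of_nat (Suc n) * x) = Exp (x + of_nat n * x)" by (simp add: algebra_simps)
  also have "\<dots> = Exp x * Exp (of_nat n * x)"
  proof (rule Exp_add)
    show "x * (of_nat n * x) = of_nat n * x * x"
      by (metis mult.assoc mult_of_nat_commute)
  qed (use Suc in simp_all)
  finally show ?case using Suc by simp
qed simp

lemma Exp_Ln:
  assumes "y $ 0 = 1"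
  shows "Exp (Lnf y) = y"
proof -
  have x: "(y - 1) $ 0 = 0" by (simp add: assms)
  have "(fps_exp 1 - 1) oo fps_ln 1 = (fps_X :: 'k fps)"
    unfolding fps_ln_fps_exp_inv[OF one_neq_zero] by (rule fps_inv_right) auto
  then have "fps_exp 1 oo fps_ln 1 = (1 + fps_X :: 'k fps)"
    by (simp add: fps_compose_sub_distrib algebra_simps)
  with x show ?thesis
    unfolding fps_Exp_def fps_Ln_def
    by (subst subst_compose[symmetric]) (simp_all del: fps_sub_nth add: subst_add subst_1 subst_X)
qed

lemma Exp_of_nat_Ln: "y $ 0 = 1 \<Longrightarrow> Exp (of_nat n * Lnf y) = y ^ n"
  by (simp add: Exp_of_nat Ln_nth_0 Exp_Ln)

lemma fps_right_cancel:
  assumes "y $ 0 = 1" "x * y = (0 :: 'a fps)"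
  shows "x = 0"
proof -
  have "x * (Exp (Lnf y) * Exp (- Lnf y)) = 0"
    by (subst Exp_Ln[OF assms(1)]) (simp add: assms(2) flip: mult.assoc)
  then show ?thesis by (simp add: Exp_uminus Ln_nth_0)
qed

section \<open>Intertwining relations\<close>

definition intertw :: "'a fps \<Rightarrow> 'a fps \<Rightarrow> 'a fps \<Rightarrow> bool" where
  "intertw y x x' \<longleftrightarrow> y * x = x' * y"

lemma intertw_add: "intertw y x x' \<Longrightarrow> intertw y u u' \<Longrightarrow> intertw y (x + u) (x' + u')"
  and intertw_diff: "intertw y x x' \<Longrightarrow> intertw y u u' \<Longrightarrow> intertw y (x - u) (x' - u')"
  and intertw_minus: "intertw y x x' \<Longrightarrow> intertw y (- x) (- x')"
  by (simp_all add: intertw_def algebra_simps)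

lemma intertw_mult: "intertw y x x' \<Longrightarrow> intertw y u u' \<Longrightarrow> intertw y (x * u) (x' * u')"
  unfolding intertw_def by (metis mult.assoc)

lemma intertw_1: "intertw y 1 1"
  and intertw_of_nat: "intertw y (of_nat n) (of_nat n)" and intertw_sc: "intertw y (sc c) (sc c)"
  and intertw_X: "intertw y fps_X fps_X"
  by (simp_all add: intertw_def mult_of_nat_commute sc_comm fps_mult_fps_X_commute)

lemma intertw_power: "intertw y x x' \<Longrightarrow> intertw y (x ^ n) (x' ^ n)"
  by (induction n) (auto intro: intertw_mult intertw_1)

lemma intertw_graded_sum:
  assumes "graded X" "graded X'" "\<And>m. intertw y (X m) (X' m)"
  shows "intertw y (graded_sum X) (graded_sum X')"
  using assms by (simp add: intertw_def mult_graded_sum graded_sum_mult)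

lemma intertw_subst:
  assumes "x $ 0 = 0" "x' $ 0 = 0" "intertw y x x'"
  shows "intertw y (Sub a x) (Sub a x')"
  unfolding subst_eq
  by (intro intertw_graded_sum graded_subst assms intertw_mult intertw_sc intertw_power)

lemma intertw_Exp: "x $ 0 = 0 \<Longrightarrow> x' $ 0 = 0 \<Longrightarrow> intertw y x x' \<Longrightarrow> intertw y (Exp x) (Exp x')"
  unfolding fps_Exp_def by (rule intertw_subst)

lemma intertw_Ln: "x $ 0 = 1 \<Longrightarrow> x' $ 0 = 1 \<Longrightarrow> intertw y x x' \<Longrightarrow> intertw y (Lnf x) (Lnf x')"
  unfolding fps_Ln_def by (rule intertw_subst) (auto intro: intertw_diff intertw_1)

end

section \<open>Polynomial identities in two commuting elements\<close>

context char0_algebra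
begin

text \<open>There is a polynomial \<open>p\<close> with coefficients that commute with \<open>D\<close> and \<open>C\<close> such that \<open>\<phi> i c = p(i, c)\<close>
  and \<open>r = p(D, C)\<close>.\<close>

inductive polyev :: "'a \<Rightarrow> 'a \<Rightarrow> (nat \<Rightarrow> nat \<Rightarrow> 'a) \<Rightarrow> 'a \<Rightarrow> bool" for D C where
  polyev_const: "s * D = D * s \<Longrightarrow> s * C = C * s \<Longrightarrow> polyev D C (\<lambda>_ _. s) s"
| polyev_D: "polyev D C \<phi> r \<Longrightarrow> polyev D C (\<lambda>i c. of_nat i * \<phi> i c) (D * r)"
| polyev_C: "polyev D C \<phi> r \<Longrightarrow> polyev D C (\<lambda>i c. of_nat c * \<phi> i c) (C * r)"
| polyev_add: "polyev D C \<phi> r \<Longrightarrow> polyev D C \<psi> t \<Longrightarrow> polyev D C (\<lambda>i c. \<phi> i c + \<psi> i c) (r + t)"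

lemma polyev_cong: "polyev D C \<phi> r \<Longrightarrow> (\<And>i c. \<phi> i c = \<psi> i c) \<Longrightarrow> r = t \<Longrightarrow> polyev D C \<psi> t"
proof -
  assume "polyev D C \<phi> r" "\<And>i c. \<phi> i c = \<psi> i c" "r = t"
  moreover from this have "\<phi> = \<psi>" by blast
  ultimately show ?thesis by simp
qed

lemma polyev_const_mult:
  assumes "s * D = D * s" "s * C = C * s" "polyev D C \<psi> t"
  shows "polyev D C (\<lambda>i c. s * \<psi> i c) (s * t)"
  using assms(3)
proof induction
  case (polyev_const s')
  show ?case
    by (rule polyev.polyev_const) (use assms polyev_const in \<open>metis mult.assoc\<close>)+
next
  case (polyev_D \<psi> t)
  show ?case
    by (rule polyev_cong[OF polyev.polyev_D[OF polyev_D.IH]])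
      (use assms in \<open>simp_all add: of_nat_left_comm, metis mult.assoc\<close>)
next
  case (polyev_C \<psi> t)
  show ?case
    by (rule polyev_cong[OF polyev.polyev_C[OF polyev_C.IH]])
      (use assms in \<open>simp_all add: of_nat_left_comm, metis mult.assoc\<close>)
next
  case (polyev_add \<phi> r \<psi> t)
  show ?case
    by (rule polyev_cong[OF polyev.polyev_add[OF polyev_add.IH]]) (simp_all add: distrib_left)
qed

lemma polyev_mult:
  assumes "polyev D C \<phi> r" "polyev D C \<psi> t"
  shows "polyev D C (\<lambda>i c. \<phi> i c * \<psi> i c) (r * t)"
  using assms(1)
proof induction
  case (polyev_const s)
  then show ?case using assms(2) by (rule polyev_const_mult)
next
  case (polyev_D \<psi> t)
  show ?case
    by (rule polyev_cong[OF polyev.polyev_D[OF polyev_D.IH]]) (simp_all add: mult.assoc)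
next
  case (polyev_C \<psi> t)
  show ?case
    by (rule polyev_cong[OF polyev.polyev_C[OF polyev_C.IH]]) (simp_all add: mult.assoc)
next
  case (polyev_add \<phi> r \<psi> t)
  show ?case
    by (rule polyev_cong[OF polyev.polyev_add[OF polyev_add.IH]]) (simp_all add: distrib_right)
qed

lemma polyev_scale:
  assumes "polyev D C \<phi> r"
  shows "polyev D C (\<lambda>i c. scale a (\<phi> i c)) (scale a r)"
proof -
  have "polyev D C (\<lambda>i c. scale a 1 * \<phi> i c) (scale a 1 * r)"
    by (rule polyev_const_mult[OF _ _ assms]) (simp_all add: scale_mult_left scale_mult_right)
  then show ?thesis by (simp add: scale_mult_left)
qed

lemma polyev_sum:
  "(\<And>j. j \<in> A \<Longrightarrow> polyev D C (\<lambda>i c. \<phi> j i c) (r j)) \<Longrightarrow>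
    polyev D C (\<lambda>i c. \<Sum>j\<in>A. \<phi> j i c) (\<Sum>j\<in>A. r j)"
proof (induction A rule: infinite_finite_induct)
  case (insert j A)
  then show ?case by (simp add: polyev_add)
qed (simp_all add: polyev_const)

lemma of_nat_cancel:
  fixes x :: 'a
  assumes "of_nat n * x = 0" "n \<noteq> 0"
  shows "x = 0"
proof -
  have "of_nat n * x = scale (of_nat n) x"
    by (induction n) (simp_all add: distrib_right scale_left_distrib)
  with assms show ?thesis by simp
qed

text \<open>A polynomial vanishing at all large \<open>i\<close> is zero, by induction on its degree: the combination \<open>2\<^sup>N p(i) - p(2i)\<close> removes the leading term of \<open>p\<close> and multiplies the
  others by nonzero integers.\<close>

lemma polynomial_coeffs_zero:
  assumes "\<And>i. i \<ge> lo \<Longrightarrow> (\<Sum>\<alpha><N. of_nat (i ^ \<alpha>) * s \<alpha>) = (0 :: 'a)" "\<alpha> < N"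
  shows "s \<alpha> = 0"
  using assms
proof (induction N arbitrary: s \<alpha>)
  case (Suc N)
  let ?p = "\<lambda>i. \<Sum>\<alpha><Suc N. of_nat (i ^ \<alpha>) * s \<alpha>"
  have low: "s \<beta> = 0" if "\<beta> < N" for \<beta>
  proof -
    have "(\<Sum>\<alpha><N. of_nat (i ^ \<alpha>) * (of_nat (2 ^ N - 2 ^ \<alpha>) * s \<alpha>)) = 0" if "i \<ge> lo" for i
    proof -
      have "of_nat (2 ^ N) * (of_nat (i ^ \<alpha>) * s \<alpha>) - of_nat ((2 * i) ^ \<alpha>) * s \<alpha>
          = of_nat (i ^ \<alpha>) * (of_nat (2 ^ N - 2 ^ \<alpha>) * s \<alpha>)" if "\<alpha> \<le> N" for \<alpha>
      proof -
        have "(2::nat) ^ \<alpha> \<le> 2 ^ N" using that by simp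
        then have "of_nat (i ^ \<alpha>) * (of_nat (2 ^ N - 2 ^ \<alpha>) * s \<alpha>)
            = of_nat (i ^ \<alpha> * 2 ^ N) * s \<alpha> - of_nat (i ^ \<alpha> * 2 ^ \<alpha>) * s \<alpha>"
          by (simp only: of_nat_diff of_nat_mult left_diff_distrib right_diff_distrib mult.assoc)
        moreover have "(2 * i) ^ \<alpha> = i ^ \<alpha> * 2 ^ \<alpha>"
          by (simp add: power_mult_distrib mult.commute)
        moreover have "of_nat (2 ^ N) * (of_nat (i ^ \<alpha>) * s \<alpha>) = of_nat (i ^ \<alpha> * 2 ^ N) * s \<alpha>"
          by (simp only: of_nat_mult mult.commute[of "i ^ \<alpha>"] mult.assoc)
        ultimately show ?thesis by (simp only:)
      qed
      then have "(\<Sum>\<alpha><Suc N. of_nat (i ^ \<alpha>) * (of_nat (2 ^ N - 2 ^ \<alpha>) * s \<alpha>)) = of_nat (2 ^ N) * ?p i - ?p (2 * i)"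
        unfolding sum_distrib_left sum_subtractf[symmetric] by (intro sum.cong refl) simp_all
      then have "(\<Sum>\<alpha><N. of_nat (i ^ \<alpha>) * (of_nat (2 ^ N - 2 ^ \<alpha>) * s \<alpha>)) = of_nat (2 ^ N) * ?p i - ?p (2 * i)"
        unfolding sum.lessThan_Suc[of "\<lambda>\<alpha>. of_nat (i ^ \<alpha>) * (of_nat (2 ^ N - 2 ^ \<alpha>) * s \<alpha>)"]
        by simp
      also have "\<dots> = 0"
        using Suc.prems(1)[of i] Suc.prems(1)[of "2 * i"] that by simp
      finally show ?thesis .
    qed
    from Suc.IH[OF this that] have "of_nat (2 ^ N - 2 ^ \<beta>) * s \<beta> = 0" .
    moreover have "(2::nat) ^ N - 2 ^ \<beta> \<noteq> 0"
      using that by simp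
    ultimately show ?thesis by (rule of_nat_cancel)
  qed
  have "of_nat (Suc lo ^ N) * s N = 0"
    using Suc.prems(1)[of "Suc lo"] low by simp
  then have "s N = 0"
    by (rule of_nat_cancel) simp
  with low Suc.prems(2) show ?case by (cases "\<alpha> = N") auto
qed simp

lemma polyev_normal_form:
  assumes "polyev D C \<phi> r" and DC: "D * C = C * D"
  shows "\<exists>N s. \<forall>A\<ge>N. \<forall>B\<ge>N. (\<forall>i c. \<phi> i c = (\<Sum>\<alpha><A. of_nat (i ^ \<alpha>) * (\<Sum>\<beta><B. of_nat (c ^ \<beta>) * s \<alpha> \<beta>)))
     \<and> r = (\<Sum>\<alpha><A. \<Sum>\<beta><B. D ^ \<alpha> * (C ^ \<beta> * s \<alpha> \<beta>))"
  using assms(1)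
proof induction
  case (polyev_const x)
  let ?s = "\<lambda>\<alpha> \<beta>. if \<alpha> = 0 \<and> \<beta> = 0 then x else 0 :: 'a"
  have one: "(\<Sum>j<B. f j) = f 0" if "B \<ge> 1" "\<And>j. j \<noteq> 0 \<Longrightarrow> f j = 0" for B and f :: "nat \<Rightarrow> 'a"
    using that by (subst sum.remove[of _ 0]) auto
  show ?case
    by (rule exI[of _ 1], rule exI[of _ ?s]) (auto simp: one)
next
  case (polyev_D \<phi> r)
  then obtain N s where IH: "\<And>A B. A \<ge> N \<Longrightarrow> B \<ge> N \<Longrightarrow>
      (\<forall>i c. \<phi> i c = (\<Sum>\<alpha><A. of_nat (i ^ \<alpha>) * (\<Sum>\<beta><B. of_nat (c ^ \<beta>) * s \<alpha> \<beta>)))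
     \<and> r = (\<Sum>\<alpha><A. \<Sum>\<beta><B. D ^ \<alpha> * (C ^ \<beta> * s \<alpha> \<beta>))" by blast
  let ?s = "\<lambda>\<alpha> \<beta>. case \<alpha> of 0 \<Rightarrow> 0 | Suc \<alpha>' \<Rightarrow> s \<alpha>' \<beta>"
  have "(\<forall>i c. of_nat i * \<phi> i c = (\<Sum>\<alpha><A. of_nat (i ^ \<alpha>) * (\<Sum>\<beta><B. of_nat (c ^ \<beta>) * ?s \<alpha> \<beta>)))
     \<and> D * r = (\<Sum>\<alpha><A. \<Sum>\<beta><B. D ^ \<alpha> * (C ^ \<beta> * ?s \<alpha> \<beta>))" if AB: "A \<ge> Suc N" "B \<ge> Suc N" for A B
  proof -
    obtain A' where A: "A = Suc A'" "A' \<ge> N" using AB(1) by (cases A) auto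
    from AB have "B \<ge> N" by simp
    note I = IH[OF A(2) this]
    show ?thesis
      unfolding A sum.lessThan_Suc_shift
      by (subst I[THEN conjunct1, rule_format], subst I[THEN conjunct2])
        (simp add: sum_distrib_left mult.assoc)
  qed
  note main = this
  show ?case
    by (rule exI[of _ "Suc N"], rule exI[of _ ?s], intro allI impI) (rule main; assumption)
next
  case (polyev_C \<phi> r)
  then obtain N s where IH: "\<And>A B. A \<ge> N \<Longrightarrow> B \<ge> N \<Longrightarrow>
      (\<forall>i c. \<phi> i c = (\<Sum>\<alpha><A. of_nat (i ^ \<alpha>) * (\<Sum>\<beta><B. of_nat (c ^ \<beta>) * s \<alpha> \<beta>)))
     \<and> r = (\<Sum>\<alpha><A. \<Sum>\<beta><B. D ^ \<alpha> * (C ^ \<beta> * s \<alpha> \<beta>))" by blast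
  let ?s = "\<lambda>\<alpha> \<beta>. case \<beta> of 0 \<Rightarrow> 0 | Suc \<beta>' \<Rightarrow> s \<alpha> \<beta>'"
  have CD: "C * (D ^ \<alpha> * x) = D ^ \<alpha> * (C * x)" for \<alpha> x
    by (metis DC mult.assoc power_commuting_commutes)
  have "(\<forall>i c. of_nat c * \<phi> i c = (\<Sum>\<alpha><A. of_nat (i ^ \<alpha>) * (\<Sum>\<beta><B. of_nat (c ^ \<beta>) * ?s \<alpha> \<beta>)))
     \<and> C * r = (\<Sum>\<alpha><A. \<Sum>\<beta><B. D ^ \<alpha> * (C ^ \<beta> * ?s \<alpha> \<beta>))" if AB: "A \<ge> Suc N" "B \<ge> Suc N" for A B
  proof -
    obtain B' where B: "B = Suc B'" "B' \<ge> N" using AB(2) by (cases B) auto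
    from AB have "A \<ge> N" by simp
    note I = IH[OF this B(2)]
    have "of_nat c * \<phi> i c = (\<Sum>\<alpha><A. of_nat (i ^ \<alpha>) * (\<Sum>\<beta><B'. of_nat (c ^ Suc \<beta>) * s \<alpha> \<beta>))" for i c
      unfolding I[THEN conjunct1, rule_format] sum_distrib_left[of "of_nat c" _ "{..<A}"]
    proof (rule sum.cong[OF refl])
      fix \<alpha>
      show "of_nat c * (of_nat (i ^ \<alpha>) * (\<Sum>\<beta><B'. of_nat (c ^ \<beta>) * s \<alpha> \<beta>))
          = of_nat (i ^ \<alpha>) * (\<Sum>\<beta><B'. of_nat (c ^ Suc \<beta>) * s \<alpha> \<beta>)"
        by (subst of_nat_left_comm) (simp add: sum_distrib_left mult.assoc)
    qed
    moreover have "C * r = (\<Sum>\<alpha><A. \<Sum>\<beta><B'. D ^ \<alpha> * (C ^ Suc \<beta> * s \<alpha> \<beta>))"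
      unfolding I[THEN conjunct2] by (simp add: sum_distrib_left mult.assoc CD)
    ultimately show ?thesis
      unfolding B sum.lessThan_Suc_shift by simp
  qed
  note main = this
  show ?case
    by (rule exI[of _ "Suc N"], rule exI[of _ ?s], intro allI impI) (rule main; assumption)
next
  case (polyev_add \<phi> r \<psi> t)
  from polyev_add.IH(1) obtain N s where IH: "\<And>A B. A \<ge> N \<Longrightarrow> B \<ge> N \<Longrightarrow>
      (\<forall>i c. \<phi> i c = (\<Sum>\<alpha><A. of_nat (i ^ \<alpha>) * (\<Sum>\<beta><B. of_nat (c ^ \<beta>) * s \<alpha> \<beta>)))
     \<and> r = (\<Sum>\<alpha><A. \<Sum>\<beta><B. D ^ \<alpha> * (C ^ \<beta> * s \<alpha> \<beta>))" by blast
  from polyev_add.IH(2) obtain N' s' where IH': "\<And>A B. A \<ge> N' \<Longrightarrow> B \<ge> N' \<Longrightarrow>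
      (\<forall>i c. \<psi> i c = (\<Sum>\<alpha><A. of_nat (i ^ \<alpha>) * (\<Sum>\<beta><B. of_nat (c ^ \<beta>) * s' \<alpha> \<beta>)))
     \<and> t = (\<Sum>\<alpha><A. \<Sum>\<beta><B. D ^ \<alpha> * (C ^ \<beta> * s' \<alpha> \<beta>))" by blast
  have "(\<forall>i c. \<phi> i c + \<psi> i c = (\<Sum>\<alpha><A. of_nat (i ^ \<alpha>) * (\<Sum>\<beta><B. of_nat (c ^ \<beta>) * (s \<alpha> \<beta> + s' \<alpha> \<beta>))))
     \<and> r + t = (\<Sum>\<alpha><A. \<Sum>\<beta><B. D ^ \<alpha> * (C ^ \<beta> * (s \<alpha> \<beta> + s' \<alpha> \<beta>)))"
    if AB: "A \<ge> max N N'" "B \<ge> max N N'" for A B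
  proof -
    have "A \<ge> N" "B \<ge> N" "A \<ge> N'" "B \<ge> N'" using AB by simp_all
    note I = IH[OF this(1,2)] and I' = IH'[OF this(3,4)]
    show ?thesis
      unfolding I[THEN conjunct1, rule_format] I'[THEN conjunct1, rule_format] I[THEN conjunct2] I'[THEN conjunct2]
      by (simp only: distrib_left sum.distrib simp_thms)
  qed
  note main = this
  show ?case
    by (rule exI[of _ "max N N'"], rule exI[of _ "\<lambda>\<alpha> \<beta>. s \<alpha> \<beta> + s' \<alpha> \<beta>"], intro allI impI) (rule main; assumption)
qed

lemma polyev_unique_zero:
  assumes "polyev D C \<phi> r" "D * C = C * D" "\<And>i c. c \<ge> i + m \<Longrightarrow> \<phi> i c = 0"
  shows "r = 0"
proof -
  obtain N s where N: "\<phi> i c = (\<Sum>\<alpha><N. of_nat (i ^ \<alpha>) * (\<Sum>\<beta><N. of_nat (c ^ \<beta>) * s \<alpha> \<beta>))"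
    "r = (\<Sum>\<alpha><N. \<Sum>\<beta><N. D ^ \<alpha> * (C ^ \<beta> * s \<alpha> \<beta>))" for i c
    using polyev_normal_form[OF assms(1,2)] by blast
  have "(\<Sum>\<beta><N. of_nat (c ^ \<beta>) * (\<Sum>\<alpha><N. of_nat (i ^ \<alpha>) * s \<alpha> \<beta>)) = \<phi> i c" for i c
  proof -
    have "(\<Sum>\<beta><N. of_nat (c ^ \<beta>) * (\<Sum>\<alpha><N. of_nat (i ^ \<alpha>) * s \<alpha> \<beta>))
      = (\<Sum>\<beta><N. \<Sum>\<alpha><N. of_nat (i ^ \<alpha>) * (of_nat (c ^ \<beta>) * s \<alpha> \<beta>))"
      unfolding sum_distrib_left by (intro sum.cong refl of_nat_left_comm)
    also have "\<dots> = \<phi> i c"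
      unfolding N(1) sum_distrib_left by (rule sum.swap)
    finally show ?thesis .
  qed
  then have "(\<Sum>\<beta><N. of_nat (c ^ \<beta>) * (\<Sum>\<alpha><N. of_nat (i ^ \<alpha>) * s \<alpha> \<beta>)) = 0" if "c \<ge> i + m" for i c
    using assms(3)[OF that] by (simp only:)
  then have col: "(\<Sum>\<alpha><N. of_nat (i ^ \<alpha>) * s \<alpha> \<beta>) = 0" if "\<beta> < N" for i \<beta>
    by (rule polynomial_coeffs_zero[where lo = "i + m" and N = N and s = "\<lambda>\<beta>. \<Sum>\<alpha><N. of_nat (i ^ \<alpha>) * s \<alpha> \<beta>", OF _ that])
  have "s \<alpha> \<beta> = 0" if "\<alpha> < N" "\<beta> < N" for \<alpha> \<beta>
    by (rule polynomial_coeffs_zero[where lo = 0 and N = N and s = "\<lambda>\<alpha>. s \<alpha> \<beta>", OF _ that(1)])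
      (rule col[OF that(2)])
  then show ?thesis unfolding N(2) by (intro sum.neutral ballI) simp
qed

text \<open>The coefficientwise form of \<open>polyev\<close> for power series. It speaks of values only, never of the
  polynomials themselves, and is therefore preserved by all ring operations and by \<open>Exp\<close> and \<open>Lnf\<close>; any
  identity between expressions built from these can be checked at natural numbers and transferred to \<open>D\<close>, \<open>C\<close>.\<close>

definition polyfam :: "'a \<Rightarrow> 'a \<Rightarrow> (nat \<Rightarrow> nat \<Rightarrow> 'a fps) \<Rightarrow> 'a fps \<Rightarrow> bool" where
  "polyfam D C \<Phi> r \<longleftrightarrow> (\<forall>n. polyev D C (\<lambda>i c. \<Phi> i c $ n) (r $ n))"

text \<open>The range \<open>c \<ge> i + m\<close> suffices because it is Zariski dense: for fixed \<open>i\<close> it contains all large \<open>c\<close>.\<close>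

lemma polyfam_unique:
  assumes "polyfam D C \<Phi> r" "polyfam D C \<Psi> t" "D * C = C * D"
    and "\<And>i c. c \<ge> i + m \<Longrightarrow> \<Phi> i c = \<Psi> i c"
  shows "r = t"
proof (rule fps_ext)
  fix n
  have "polyev D C (\<lambda>i c. \<Phi> i c $ n + scale (-1) (\<Psi> i c $ n)) (r $ n + scale (-1) (t $ n))"
    using assms(1,2) unfolding polyfam_def by (intro polyev_add polyev_scale) auto
  from polyev_unique_zero[OF this assms(3), of m] assms(4) show "r $ n = t $ n" by simp
qed

lemma polyfam_const:
  assumes "x * fps_const D = fps_const D * x" "x * fps_const C = fps_const C * x"
  shows "polyfam D C (\<lambda>_ _. x) x"
proof -
  have "x $ n * D = D * x $ n" "x $ n * C = C * x $ n" for n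
    using assms[THEN arg_cong[of _ _ "\<lambda>x. x $ n"]] by simp_all
  then show ?thesis by (auto simp: polyfam_def intro: polyev_const)
qed

lemma polyfam_of_nat: "polyfam D C (\<lambda>_ _. of_nat n) (of_nat n)"
  and polyfam_1: "polyfam D C (\<lambda>_ _. 1) 1" and polyfam_0: "polyfam D C (\<lambda>_ _. 0) 0"
  and polyfam_X: "polyfam D C (\<lambda>_ _. fps_X) fps_X" and polyfam_sc: "polyfam D C (\<lambda>_ _. sc a) (sc a)"
  and polyfam_numeral: "polyfam D C (\<lambda>_ _. numeral v) (numeral v)"
  using mult_of_nat_commute[of "numeral v"]
  by (auto intro!: polyfam_const simp: mult_of_nat_commute fps_mult_fps_X_commute sc_comm)

lemma of_nat_fps_nth: "of_nat k $ n = (if n = 0 then of_nat k else 0 :: 'a)"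
  by (simp flip: fps_of_nat)

lemma polyfam_D: "polyfam D C (\<lambda>i _. of_nat i) (fps_const D)"
  and polyfam_C: "polyfam D C (\<lambda>_ c. of_nat c) (fps_const C)"
proof -
  have 1: "polyev D C (\<lambda>_ _. 1) 1" and 0: "polyev D C (\<lambda>_ _. 0) 0"
    by (auto intro: polyev_const)
  show "polyfam D C (\<lambda>i _. of_nat i) (fps_const D)" "polyfam D C (\<lambda>_ c. of_nat c) (fps_const C)"
    using polyev_D[OF 1] polyev_C[OF 1] 0 by (auto simp: polyfam_def of_nat_fps_nth)
qed

lemma polyfam_add: "polyfam D C \<Phi> r \<Longrightarrow> polyfam D C \<Psi> t \<Longrightarrow> polyfam D C (\<lambda>i c. \<Phi> i c + \<Psi> i c) (r + t)"
  by (simp add: polyfam_def polyev_add)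

lemma polyfam_mult: "polyfam D C \<Phi> r \<Longrightarrow> polyfam D C \<Psi> t \<Longrightarrow> polyfam D C (\<lambda>i c. \<Phi> i c * \<Psi> i c) (r * t)"
  unfolding polyfam_def fps_mult_nth by (intro allI polyev_sum polyev_mult) auto

lemma polyfam_minus: "polyfam D C \<Phi> r \<Longrightarrow> polyfam D C (\<lambda>i c. - \<Phi> i c) (- r)"
  using polyfam_mult[OF polyfam_sc[of D C "- 1"], of \<Phi> r] by (simp add: sc_minus)

lemma polyfam_diff: "polyfam D C \<Phi> r \<Longrightarrow> polyfam D C \<Psi> t \<Longrightarrow> polyfam D C (\<lambda>i c. \<Phi> i c - \<Psi> i c) (r - t)"
  using polyfam_add[OF _ polyfam_minus, of D C \<Phi> r \<Psi> t] by simp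

lemma polyfam_sum: "(\<And>j. j \<in> A \<Longrightarrow> polyfam D C (\<lambda>i c. \<Phi> j i c) (r j)) \<Longrightarrow>
    polyfam D C (\<lambda>i c. \<Sum>j\<in>A. \<Phi> j i c) (\<Sum>j\<in>A. r j)"
  by (simp add: polyfam_def fps_sum_nth polyev_sum)

lemma polyfam_power: "polyfam D C \<Phi> r \<Longrightarrow> polyfam D C (\<lambda>i c. \<Phi> i c ^ k) (r ^ k)"
  by (induction k) (auto intro: polyfam_1 polyfam_mult)

lemma polyfam_graded_sum:
  assumes "\<And>m. polyfam D C (\<lambda>i c. \<Phi> i c m) (r m)"
  shows "polyfam D C (\<lambda>i c. graded_sum (\<Phi> i c)) (graded_sum r)"
  using assms by (simp add: polyfam_def graded_sum_nth polyev_sum)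

lemma polyfam_subst: "polyfam D C \<Phi> r \<Longrightarrow> polyfam D C (\<lambda>i c. Sub a (\<Phi> i c)) (Sub a r)"
  unfolding subst_eq by (intro polyfam_graded_sum polyfam_mult polyfam_sc polyfam_power)

lemma polyfam_Exp: "polyfam D C \<Phi> r \<Longrightarrow> polyfam D C (\<lambda>i c. Exp (\<Phi> i c)) (Exp r)"
  unfolding fps_Exp_def by (rule polyfam_subst)

lemma polyfam_Ln: "polyfam D C \<Phi> r \<Longrightarrow> polyfam D C (\<lambda>i c. Lnf (\<Phi> i c)) (Lnf r)"
  unfolding fps_Ln_def by (intro polyfam_subst polyfam_diff polyfam_1)

end

section \<open>The quadratic algebra of the second tensor factor\<close>

definition central :: "'a::ring_1 \<Rightarrow> bool" where
  "central x \<longleftrightarrow> (\<forall>y. y * x = x * y)"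

lemma central_comm: "central x \<Longrightarrow> y * x = x * y"
  and central_left_comm: "central x \<Longrightarrow> y * (x * t) = x * (y * t)"
  unfolding central_def by (metis mult.assoc)+

lemma central_of_nat [simp]: "central (of_nat n)"
  and central_1 [simp]: "central 1"
  by (simp_all add: central_def mult_of_nat_commute)

lemma central_numeral [simp]: "central (numeral v)"
  using central_of_nat[of "numeral v"] by simp

lemma central_fps_X [simp]: "central (fps_X :: 'a::ring_1 fps)"
  by (simp add: central_def fps_mult_fps_X_commute)

lemma central_add [simp]: "central x \<Longrightarrow> central y \<Longrightarrow> central (x + y)"
  and central_diff [simp]: "central x \<Longrightarrow> central y \<Longrightarrow> central (x - y)"
  by (simp_all add: central_def algebra_simps)

lemma central_mult [simp]: "central x \<Longrightarrow> central y \<Longrightarrow> central (x * y)"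
  unfolding central_def by (metis mult.assoc)

text \<open>The relations between \<open>a = 1 - \<zeta> E\<^sub>2\<^sub>3\<close>, \<open>e = \<zeta> E\<^sub>3\<^sub>4\<close>, \<open>q = \<zeta> E\<^sub>1\<^sub>3 e\<^sup>-\<^sup>\<sigma>\<close>, \<open>s = \<zeta>\<^sup>2 E\<^sub>1\<^sub>4 e\<^sup>-\<^sup>\<sigma>\<close> and
  \<open>w = \<zeta> E\<^sub>2\<^sub>4 - e q\<close>. Being relations only, they persist under any algebra homomorphism, in
  particular under the twisted coproduct, so that what is proved from them applies to each tensor
  factor and to the coproducts alike.\<close>

definition quad_rels :: "'a::ring_1 fps \<Rightarrow> 'a fps \<Rightarrow> 'a fps \<Rightarrow> 'a fps \<Rightarrow> 'a fps \<Rightarrow> bool" where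
  "quad_rels a e q s w \<longleftrightarrow>
     a * q = q * a + fps_X * (q * q) \<and> a * s = s * a + fps_X * (s * q) \<and>
     a * w = w * a + fps_X * (w * q) \<and> a * e = e * a - fps_X * (w + e * q) \<and>
     q * e = e * q + s \<and> s * e = e * s \<and> w * e = e * w - e * s \<and>
     q * w = w * q \<and> s * w = w * s + s * s \<and> q * s = s * q \<and>
     a $ 0 = 1 \<and> e $ 0 = 0 \<and> q $ 0 = 0 \<and> s $ 0 = 0 \<and> w $ 0 = 0"

locale quad_alg = char0_algebra scale
  for scale :: "'k::field_char_0 \<Rightarrow> 'a::ring_1 \<Rightarrow> 'a" +
  fixes a e q s w :: "'a fps"
  assumes rels: "quad_rels a e q s w"
begin

abbreviation "z \<equiv> (fps_X :: 'a fps)"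

lemma rewr:
  "a * q = q * a + z * (q * q)" "a * s = s * a + z * (s * q)"
  "a * w = w * a + z * (w * q)" "a * e = e * a - z * (w + e * q)"
  "q * e = e * q + s" "s * e = e * s" "w * e = e * w - e * s"
  "q * w = w * q" "s * w = w * s + s * s" "q * s = s * q"
  using rels unfolding quad_rels_def by blast+

lemma rewr': 
  "a * (q * t) = q * (a * t) + z * (q * (q * t))" "a * (s * t) = s * (a * t) + z * (s * (q * t))"
  "a * (w * t) = w * (a * t) + z * (w * (q * t))"
  "a * (e * t) = e * (a * t) - z * (w * t) - z * (e * (q * t))"
  "q * (e * t) = e * (q * t) + s * t" "s * (e * t) = e * (s * t)" "w * (e * t) = e * (w * t) - e * (s * t)"
  "q * (w * t) = w * (q * t)" "s * (w * t) = w * (s * t) + s * (s * t)" "q * (s * t) = s * (q * t)"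
  unfolding mult.assoc[symmetric] rewr by (simp_all only: ring_distribs mult.assoc diff_diff_eq)

lemma nth_0 [simp]: "a $ 0 = 1" "e $ 0 = 0" "q $ 0 = 0" "s $ 0 = 0" "w $ 0 = 0"
  using rels unfolding quad_rels_def by blast+

text \<open>The normally ordered twist is composed of powers of \<open>A D\<close>, \<open>A C\<close>, \<open>b\<close> and of \<open>P (C + D + 1)\<close>.\<close>

definition A :: "'a fps \<Rightarrow> 'a fps" where "A x = a + x * (z * q)"
definition P :: "'a fps \<Rightarrow> 'a fps" where "P x = w + q - x * s"
definition b :: "'a fps" where "b = 1 - e"

lemma gens_central:
  assumes "central x"
  shows "a * x = x * a" "e * x = x * e" "q * x = x * q" "s * x = x * s" "w * x = x * w"
    "a * (x * t) = x * (a * t)" "e * (x * t) = x * (e * t)" "q * (x * t) = x * (q * t)"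
    "s * (x * t) = x * (s * t)" "w * (x * t) = x * (w * t)"
    "x * z = z * x" "x * (z * t) = z * (x * t)"
  by (rule central_comm[OF assms] central_left_comm[OF assms] central_comm[OF central_fps_X] central_left_comm[OF central_fps_X])+

lemma normal_order_simps: "(x - y) * (t :: 'a fps) = x * t - y * t" "t * (x - y) = t * x - t * y"
    "(x + y) * t = x * t + y * t" "t * (x + y) = t * x + t * y" "x * y * t = x * (y * t)"
  by (simp_all add: algebra_simps)

lemmas normal_order = rewr rewr' gens_central(1-10)[OF central_fps_X] normal_order_simps

lemma A_shift:
  assumes "central x"
  shows "A x * q = q * A (x + 1)" "A x * s = s * A (x + 1)" "A x * w = w * A (x + 1)"
  by (simp_all add: A_def normal_order gens_central[OF assms])

lemma A_swap:
  assumes x: "central x" and y: "central y"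
  shows "A x * A (y + 1) = A y * A (x + 1)"
  by (simp add: A_def normal_order gens_central[OF x] gens_central[OF y] central_comm[OF x, of y] central_left_comm[OF x, of y])

text \<open>The series \<open>A x\<close> do not commute with each other; \<open>A_swap\<close> shifts both arguments when two of them
  change places, and the product telescopes.\<close>

lemma A_power_Suc:
  assumes c: "central c"
  shows "A (c + 1) ^ Suc n = A c ^ n * A (c + of_nat n + 1)"
proof (induction n)
  case (Suc n)
  have "A (c + 1) ^ Suc (Suc n) = A c ^ n * (A (c + of_nat n + 1) * A (c + 1))"
    by (subst power_Suc2, subst Suc) (simp add: mult.assoc)
  also have "A (c + of_nat n + 1) * A (c + 1) = A c * A (c + of_nat n + 1 + 1)"
    by (rule A_swap) (simp_all add: c)
  finally show ?case by (simp add: power_Suc2 mult.assoc add_ac del: power_Suc)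
qed simp

lemma A_power_s:
  assumes "central c"
  shows "A c ^ n * s = s * A (c + 1) ^ n"
proof (induction n)
  case (Suc n)
  have "A c ^ Suc n * s = A c * s * A (c + 1) ^ n"
    using Suc by (simp add: mult.assoc)
  then show ?case by (simp add: A_shift(2)[OF assms] mult.assoc)
qed simp

lemma P_Suc: "central x \<Longrightarrow> P (x + 1) = P x - s"
  by (simp add: P_def algebra_simps)

lemma s_P: "central x \<Longrightarrow> s * P x = P x * s + s * s"
  by (simp add: P_def normal_order gens_central)

lemma P_power_shift:
  assumes x: "central x"
  shows "P (x + 1) ^ Suc m = P x ^ Suc m - of_nat (Suc m) * (P x ^ m * s)"
proof (induction m)
  case 0
  show ?case by (simp add: P_Suc x)
next
  case (Suc m)
  have "P (x + 1) ^ Suc (Suc m) = (P x ^ Suc m - of_nat (Suc m) * (P x ^ m * s)) * (P x - s)"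
    by (subst power_Suc2, subst Suc) (simp add: P_Suc x)
  also have "\<dots> = P x ^ Suc m * P x - P x ^ Suc m * s - of_nat (Suc m) * (P x ^ m * (s * P x)) + of_nat (Suc m) * (P x ^ m * (s * s))"
    by (simp only: left_diff_distrib right_diff_distrib mult.assoc) simp
  also have "s * P x = P x * s + s * s" by (rule s_P[OF x])
  also have "P x ^ m * (P x * s + s * s) = P x ^ Suc m * s + P x ^ m * (s * s)"
    by (simp only: distrib_left power_Suc2 mult.assoc)
  finally show ?case
    by (simp add: power_Suc2 algebra_simps del: power_Suc)
qed

lemma A_power_e:
  assumes c: "central c"
  shows "A c ^ Suc n * e = (e * A c - of_nat (Suc n) * (z * (e * q + w - c * s))) * A c ^ n"
proof (induction n)
  case 0
  show ?case by (simp add: A_def normal_order gens_central[OF c])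
next
  case (Suc n)
  define N :: "'a fps" where "N = of_nat (Suc n)"
  have N: "central N" by (simp add: N_def)
  have "A c ^ Suc (Suc n) * e = A c * ((e * A c - N * (z * (e * q + w - c * s))) * A c ^ n)"
    using Suc by (simp add: N_def mult.assoc)
  also have "\<dots> = A c * (e * A c - N * (z * (e * q + w - c * s))) * A c ^ n"
    by (simp add: mult.assoc)
  also have "A c * (e * A c - N * (z * (e * q + w - c * s))) = (e * A c - (N + 1) * (z * (e * q + w - c * s))) * A c"
    by (simp add: A_def normal_order gens_central[OF c] gens_central[OF N] central_comm[OF c, of N] central_left_comm[OF c, of N])
  finally show ?case by (simp add: N_def mult.assoc add_ac)
qed

text \<open>\<open>K i\<close> is the factor by which \<open>A(i)\<^sup>i b\<^sup>i\<close> changes under \<open>i \<mapsto> i + 1\<close>: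
  \<open>A(i + 1)\<^sup>i\<^sup>+\<^sup>1 b\<^sup>i\<^sup>+\<^sup>1 = A(i)\<^sup>i b\<^sup>i K(i)\<close>.\<close>

definition K :: "'a fps \<Rightarrow> 'a fps" where
  "K i = A (2 * i + 1) * b + i * (z * (w + e * q - (2 * i + 1) * s))"

lemma A_b_power:
  assumes x: "central x"
  shows "A x * b ^ Suc n = b ^ n * (A x * b + of_nat n * (z * (w + e * q - x * s)))"
proof (induction n)
  case (Suc n)
  define u where "u = z * (w + e * q - x * s)"
  have ub: "u * b = b * u"
    by (simp add: u_def b_def normal_order gens_central[OF x])
  have Ab: "A x * b = b * A x + u"
    by (simp add: u_def A_def b_def normal_order gens_central[OF x])
  have "A x * b ^ Suc (Suc n) = A x * b ^ Suc n * b"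
    by (simp only: power_Suc2[of b "Suc n"] mult.assoc)
  also have "\<dots> = b ^ n * ((A x * b + of_nat n * u) * b)"
    by (simp only: Suc u_def mult.assoc)
  also have "(A x * b + of_nat n * u) * b = b * (A x * b + of_nat (Suc n) * u)"
  proof -
    have "A x * b * b = (b * A x + u) * b" by (simp only: Ab)
    also have "\<dots> = b * (A x * b) + b * u" by (simp only: distrib_right mult.assoc ub)
    finally show ?thesis
      by (simp only: distrib_left distrib_right mult.assoc ub of_nat_left_comm[of b] add_ac of_nat_Suc mult_1_left)
  qed
  finally show ?case by (simp add: u_def power_commutes flip: mult.assoc)
qed simp

lemma K_P_base:
  assumes i: "central i" and c: "central c"
  shows "K i = A c - e * A i + (c - i) * (z * (w - c * s)) + z * ((2 * i - c + 1) * P (c + i + 1))"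
  by (simp add: K_def A_def P_def b_def normal_order gens_central[OF c] gens_central[OF i]
      central_comm[OF c, of i] central_left_comm[OF c, of i] mult_2)

lemma K_P_step:
  assumes i: "central i" and c: "central c" and j: "central j"
  shows "(A c - e * A j + (c - j) * (z * (w - c * s)) + z * ((i + j - c + 1) * P (c + i + 1))) * P (c + i + 2)
    = P (c + i + 1) * (A c - e * A (j + 1) + (c - (j + 1)) * (z * (w - c * s)) + z * ((i + (j + 1) - c + 1) * P (c + i + 1)))"
  by (simp add: A_def P_def normal_order gens_central[OF c] gens_central[OF i] gens_central[OF j]
      central_comm[OF c, of i] central_left_comm[OF c, of i] central_comm[OF c, of j] central_left_comm[OF c, of j]
      central_comm[OF i, of j] central_left_comm[OF i, of j] mult_2 mult_2_right)

text \<open>Moving \<open>K i\<close> to the right through the powers of \<open>P\<close> replaces \<open>j\<close> by \<open>j + 1\<close> in the bracket of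
  \<open>K_P_step\<close> each time, starting from \<open>j = i\<close>.\<close>

lemma K_P_power:
  assumes i: "central i" and c: "central c"
  shows "K i * P (c + i + 2) ^ m = P (c + i + 1) ^ m *
    (A c - e * A (i + of_nat m) + (c - (i + of_nat m)) * (z * (w - c * s)) + z * ((i + (i + of_nat m) - c + 1) * P (c + i + 1)))"
proof (induction m)
  case 0
  show ?case by (simp add: K_P_base[OF i c] mult_2)
next
  case (Suc m)
  let ?R = "\<lambda>j. A c - e * A j + (c - j) * (z * (w - c * s)) + z * ((i + j - c + 1) * P (c + i + 1))"
  have "K i * P (c + i + 2) ^ Suc m = P (c + i + 1) ^ m * ?R (i + of_nat m) * P (c + i + 2)"
    by (subst power_Suc2) (simp add: Suc flip: mult.assoc)
  also have "\<dots> = P (c + i + 1) ^ m * (P (c + i + 1) * ?R (i + of_nat m + 1))"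
    by (subst K_P_step[OF i c, symmetric]) (simp_all add: i mult.assoc)
  also have "\<dots> = P (c + i + 1) ^ Suc m * ?R (i + of_nat (Suc m))"
    by (simp add: power_Suc2 mult.assoc add_ac del: power_Suc)
  finally show ?case .
qed

text \<open>\<open>Vn m i c / m!\<close> is the coefficient of \<open>f\<^sup>m\<close> in the normally ordered \<open>G\<close> at \<open>D = i\<close>, \<open>C = c\<close>. The last
  exponent is a truncated difference, hence the hypotheses \<open>c \<ge> i + m\<close> below.\<close>

definition Vn :: "nat \<Rightarrow> nat \<Rightarrow> nat \<Rightarrow> 'a fps" where
  "Vn m i c = A (of_nat i) ^ i * b ^ i * P (of_nat c + of_nat i + 1) ^ m * A (of_nat c) ^ (c - i - m)"

lemma Vn_Suc_c:
  assumes "c \<ge> i + m"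
  shows "Vn m i (Suc c) = Vn m i c * A (2 * of_nat c - of_nat i - of_nat m + 1) - of_nat m * (Vn (m - 1) i c * s)"
proof -
  obtain n where c: "c = i + m + n" using assms nat_le_iff_add by blast
  have x: "2 * of_nat c - of_nat i - of_nat m + 1 = of_nat c + of_nat n + (1 :: 'a fps)"
    by (simp add: c mult_2)
  have AS: "A (of_nat (Suc c)) ^ Suc n = A (of_nat c) ^ n * A (of_nat c + of_nat n + 1)"
    using A_power_Suc[of "of_nat c" n] by (simp add: add_ac)
  have exps: "c - i - m = n" "Suc c - i - m = Suc n" by (simp_all add: c)
  show ?thesis
  proof (cases m)
    case 0
    then show ?thesis
      unfolding Vn_def x exps AS by (simp add: mult.assoc)
  next
    case (Suc l)
    let ?T = "A (of_nat i) ^ i * b ^ i" and ?P = "P (of_nat c + of_nat i + 1)"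
    have "P (of_nat (Suc c) + of_nat i + 1) ^ m = ?P ^ m - of_nat m * (?P ^ l * s)"
      using P_power_shift[of "of_nat c + of_nat i + 1" l] by (simp add: Suc add_ac)
    then have "Vn m i (Suc c) = ?T * ?P ^ m * A (of_nat (Suc c)) ^ Suc n - of_nat m * (?T * ?P ^ l * (s * A (of_nat (Suc c)) ^ Suc n))"
      unfolding Vn_def exps by (simp add: left_diff_distrib right_diff_distrib mult.assoc of_nat_left_comm del: power_Suc of_nat_Suc)
    also have "s * A (of_nat (Suc c)) ^ Suc n = A (of_nat c) ^ Suc n * s"
      using A_power_s[of "of_nat c" "Suc n"] by (simp add: add_ac del: power_Suc)
    finally have "Vn m i (Suc c) = ?T * ?P ^ m * (A (of_nat c) ^ n * A (of_nat c + of_nat n + 1))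
      - of_nat m * (?T * ?P ^ l * (A (of_nat c) ^ Suc n * s))"
      unfolding AS .
    moreover have "Vn (m - 1) i c = ?T * ?P ^ l * A (of_nat c) ^ Suc n"
      by (simp add: Vn_def Suc c del: power_Suc)
    moreover have "Vn m i c = ?T * ?P ^ m * A (of_nat c) ^ n"
      by (simp only: Vn_def exps)
    ultimately show ?thesis
      unfolding x by (simp only: mult.assoc)
  qed
qed

lemma Vn_Suc_i:
  assumes "c \<ge> i + m + 1"
  shows "Vn m (Suc i) c = Vn m i c * (1 - e) + z * ((2 * of_nat i - of_nat c + of_nat m + 1) * Vn (Suc m) i c)"
proof -
  obtain n where c: "c = i + m + Suc n" using assms nat_le_iff_add[of "i + m + 1" c] by auto
  let ?i = "of_nat i :: 'a fps" and ?c = "of_nat c :: 'a fps" and ?j = "of_nat i + of_nat m :: 'a fps"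
  let ?T = "A ?i ^ i * b ^ i" and ?P = "P (?c + ?i + 1)" and ?N = "of_nat (Suc n) :: 'a fps"
  have exps: "c - i - m = Suc n" "c - Suc i - m = n" "c - i - Suc m = n" by (simp_all add: c)
  have N: "?N = ?c - ?j" by (simp add: c)
  have "A (of_nat (Suc i)) ^ Suc i * b ^ Suc i = A ?i ^ i * (A (2 * ?i + 1) * b ^ Suc i)"
    using A_power_Suc[of ?i i] by (simp add: mult.assoc mult_2 add_ac del: power_Suc)
  also have "\<dots> = ?T * K ?i"
    by (subst A_b_power) (simp_all add: K_def mult.assoc)
  finally have "A (of_nat (Suc i)) ^ Suc i * b ^ Suc i = ?T * K ?i" .
  moreover have "of_nat c + of_nat (Suc i) + 1 = ?c + ?i + 2" by simp
  ultimately have "Vn m (Suc i) c = ?T * (K ?i * P (?c + ?i + 2) ^ m) * A ?c ^ n"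
    unfolding Vn_def exps by (simp only: mult.assoc)
  also have "K ?i * P (?c + ?i + 2) ^ m = ?P ^ m *
      (A ?c - e * A ?j + (?c - ?j) * (z * (w - ?c * s)) + z * ((?i + ?j - ?c + 1) * ?P))"
    by (rule K_P_power) simp_all
  finally have *: "Vn m (Suc i) c = ?T * ?P ^ m * ((A ?c - e * A ?j + ?N * (z * (w - ?c * s))) * A ?c ^ n)
      + ?T * ?P ^ m * (z * ((?i + ?j - ?c + 1) * (?P * A ?c ^ n)))"
    unfolding N by (simp add: distrib_left distrib_right mult.assoc)
  have "A ?c ^ Suc n * (1 - e) = A ?c * A ?c ^ n - A ?c ^ Suc n * e"
    by (simp add: right_diff_distrib)
  also have "\<dots> = (A ?c - (e * A ?c - ?N * (z * (e * q + w - ?c * s)))) * A ?c ^ n"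
    by (subst A_power_e) (simp_all add: left_diff_distrib)
  also have "A ?c - (e * A ?c - ?N * (z * (e * q + w - ?c * s))) = A ?c - e * A ?j + ?N * (z * (w - ?c * s))"
  proof -
    have j: "?c - ?N = ?j" using N by simp
    have key: "A x - (e * A x - y * (z * (e * q + w - x * s))) = A x - e * A (x - y) + y * (z * (w - x * s))"
      if x: "central x" and y: "central y" for x y
      by (simp add: A_def normal_order gens_central[OF x] gens_central[OF y] central_comm[OF x, of y] central_left_comm[OF x, of y])
    show ?thesis
      by (rule key[OF central_of_nat central_of_nat, of c "Suc n", unfolded j])
  qed
  finally have "Vn m i c * (1 - e) = ?T * ?P ^ m * ((A ?c - e * A ?j + ?N * (z * (w - ?c * s))) * A ?c ^ n)"
    unfolding Vn_def exps by (simp add: mult.assoc)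
  moreover have "z * ((2 * ?i - ?c + of_nat m + 1) * Vn (Suc m) i c) = ?T * ?P ^ m * (z * ((?i + ?j - ?c + 1) * (?P * A ?c ^ n)))"
  proof -
    have x: "2 * ?i - ?c + of_nat m + 1 = ?i + ?j - ?c + 1" by (simp add: mult_2)
    have "z * (y * (u * t)) = u * (z * (y * t))" if "central y" for y u t
      by (simp only: central_left_comm[OF central_fps_X, of u] central_left_comm[OF that, of u])
    from this[of "?i + ?j - ?c + 1" "?T * ?P ^ m" "?P * A ?c ^ n"] show ?thesis
      unfolding x Vn_def exps by (simp add: mult.assoc power_Suc2 del: power_Suc)
  qed
  ultimately show ?thesis by (simp only: *)
qed

end

context quad_alg
begin

section \<open>The coefficients of the twist as polynomial families\<close>

text \<open>Commutation with the generators: the condition on an element of another tensor factor.\<close>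

definition cg :: "'a fps \<Rightarrow> bool" where
  "cg x \<longleftrightarrow> x * a = a * x \<and> x * e = e * x \<and> x * q = q * x \<and> x * s = s * x \<and> x * w = w * x"

definition V :: "nat \<Rightarrow> 'a fps \<Rightarrow> 'a fps \<Rightarrow> 'a fps" where
  "V m D C = sc (1 / fact m) * (Exp (D * Lnf (A D)) * Exp (D * Lnf b) * P (C + D + 1) ^ m
     * Exp ((C - D - of_nat m) * Lnf (A C)))"

lemma A_nth_0 [simp]: "A x $ 0 = 1" and b_nth_0 [simp]: "b $ 0 = 1" and P_nth_0 [simp]: "P x $ 0 = 0"
  by (simp_all add: A_def b_def P_def)

lemma V_of_nat:
  assumes "c \<ge> i + m"
  shows "V m (of_nat i) (of_nat c) = sc (1 / fact m) * Vn m i c"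
proof -
  have "of_nat c - of_nat i - of_nat m = (of_nat (c - i - m) :: 'a fps)"
    using assms by (simp add: of_nat_diff)
  then show ?thesis
    by (simp only: V_def Vn_def Exp_of_nat_Ln A_nth_0 b_nth_0)
qed

lemma V_low: "n < m \<Longrightarrow> V m D C $ n = 0"
proof -
  assume n: "n < m"
  have "(Exp (D * Lnf (A D)) * Exp (D * Lnf b) * P (C + D + 1) ^ m) $ j = 0" if "j < m" for j
    by (rule nth_mult_low[of 0 _ m]) (use that in \<open>auto simp: gradedD[OF graded_power[OF P_nth_0]]\<close>)
  then have "(Exp (D * Lnf (A D)) * Exp (D * Lnf b) * P (C + D + 1) ^ m
     * Exp ((C - D - of_nat m) * Lnf (A C))) $ n = 0"
    by (rule nth_mult_low[of m _ 0]) (use n in simp_all)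
  then show ?thesis by (simp add: V_def sc_nth)
qed

lemma polyfam_gens:
  assumes "cg (fps_const D)" "cg (fps_const C)"
  shows "polyfam D C (\<lambda>_ _. a) a" "polyfam D C (\<lambda>_ _. e) e" "polyfam D C (\<lambda>_ _. q) q"
    "polyfam D C (\<lambda>_ _. s) s" "polyfam D C (\<lambda>_ _. w) w"
  using assms by (auto intro!: polyfam_const simp: cg_def)

lemmas polyfam_intros = polyfam_add polyfam_diff polyfam_minus polyfam_mult polyfam_power polyfam_Exp polyfam_Ln
  polyfam_1 polyfam_0 polyfam_X polyfam_sc polyfam_of_nat polyfam_numeral

lemma polyfam_A:
  assumes "cg (fps_const D)" "cg (fps_const C)" "polyfam D C \<Phi> x"
  shows "polyfam D C (\<lambda>i c. A (\<Phi> i c)) (A x)"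
  unfolding A_def by (intro polyfam_intros polyfam_gens assms)

lemma polyfam_V:
  assumes "cg (fps_const D)" "cg (fps_const C)" "polyfam D C \<Phi> x" "polyfam D C \<Psi> y"
  shows "polyfam D C (\<lambda>i c. V m (\<Phi> i c) (\<Psi> i c)) (V m x y)"
  unfolding V_def P_def b_def by (intro polyfam_intros polyfam_A polyfam_gens assms)

lemma V_Suc_C:
  assumes DC: "D * C = C * D" and cg: "cg (fps_const D)" "cg (fps_const C)"
  shows "V m (fps_const D) (fps_const C + 1) = V m (fps_const D) (fps_const C) * A (2 * fps_const C - fps_const D - of_nat m + 1)
     - (case m of 0 \<Rightarrow> 0 | Suc l \<Rightarrow> V l (fps_const D) (fps_const C) * s)"
proof (rule polyfam_unique[OF _ _ DC, where m = m])
  show "polyfam D C (\<lambda>i c. V m (of_nat i) (of_nat c + 1)) (V m (fps_const D) (fps_const C + 1))"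
    by (intro polyfam_intros polyfam_V polyfam_D polyfam_C cg)
  have "polyfam D C (\<lambda>i c. case m of 0 \<Rightarrow> 0 | Suc l \<Rightarrow> V l (of_nat i) (of_nat c) * s)
    (case m of 0 \<Rightarrow> 0 | Suc l \<Rightarrow> V l (fps_const D) (fps_const C) * s)"
    by (cases m) (auto intro!: polyfam_intros polyfam_V polyfam_D polyfam_C cg polyfam_gens)
  then show "polyfam D C (\<lambda>i c. V m (of_nat i) (of_nat c) * A (2 * of_nat c - of_nat i - of_nat m + 1)
        - (case m of 0 \<Rightarrow> 0 | Suc l \<Rightarrow> V l (of_nat i) (of_nat c) * s))
     (V m (fps_const D) (fps_const C) * A (2 * fps_const C - fps_const D - of_nat m + 1)
     - (case m of 0 \<Rightarrow> 0 | Suc l \<Rightarrow> V l (fps_const D) (fps_const C) * s))"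
    by (intro polyfam_intros polyfam_V polyfam_D polyfam_C polyfam_A cg)
  fix i c :: nat assume c: "c \<ge> i + m"
  have "V m (of_nat i) (of_nat (Suc c)) = sc (1 / fact m) * Vn m i (Suc c)"
    by (rule V_of_nat) (use c in simp)
  also have "\<dots> = sc (1 / fact m) * Vn m i c * A (2 * of_nat c - of_nat i - of_nat m + 1)
      - sc (1 / fact m) * (of_nat m * (Vn (m - 1) i c * s))"
    by (subst Vn_Suc_c[OF c]) (simp add: right_diff_distrib mult.assoc)
  also have "sc (1 / fact m) * (of_nat m * (Vn (m - 1) i c * s)) = (case m of 0 \<Rightarrow> 0 | Suc l \<Rightarrow> V l (of_nat i) (of_nat c) * s)"
  proof (cases m)
    case (Suc l)
    have "sc (1 / fact m) * of_nat m = sc (1 / fact m * of_nat m)"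
      by (simp only: sc_mult sc_of_nat)
    also have "1 / fact m * of_nat m = (1 / fact l :: 'k)"
      by (simp add: Suc field_simps del: of_nat_Suc)
    finally show ?thesis
      using c V_of_nat[of i l c] by (simp add: Suc flip: mult.assoc)
  qed simp
  finally show "V m (of_nat i) (of_nat c + 1) = V m (of_nat i) (of_nat c) * A (2 * of_nat c - of_nat i - of_nat m + 1)
        - (case m of 0 \<Rightarrow> 0 | Suc l \<Rightarrow> V l (of_nat i) (of_nat c) * s)"
    by (simp add: V_of_nat[OF c] add.commute[of "of_nat c"])
qed

lemma V_Suc_D:
  assumes DC: "D * C = C * D" and cg: "cg (fps_const D)" "cg (fps_const C)"
  shows "V m (fps_const D + 1) (fps_const C) = V m (fps_const D) (fps_const C) * (1 - e)
     + z * (of_nat (Suc m) * ((2 * fps_const D - fps_const C + of_nat m + 1) * V (Suc m) (fps_const D) (fps_const C)))"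
proof (rule polyfam_unique[OF _ _ DC, where m = "Suc m"])
  show "polyfam D C (\<lambda>i c. V m (of_nat i + 1) (of_nat c)) (V m (fps_const D + 1) (fps_const C))"
    by (intro polyfam_intros polyfam_V polyfam_D polyfam_C cg)
  show "polyfam D C (\<lambda>i c. V m (of_nat i) (of_nat c) * (1 - e)
     + z * (of_nat (Suc m) * ((2 * of_nat i - of_nat c + of_nat m + 1) * V (Suc m) (of_nat i) (of_nat c))))
   (V m (fps_const D) (fps_const C) * (1 - e)
     + z * (of_nat (Suc m) * ((2 * fps_const D - fps_const C + of_nat m + 1) * V (Suc m) (fps_const D) (fps_const C))))"
    by (intro polyfam_intros polyfam_V polyfam_D polyfam_C polyfam_gens cg)
  fix i c :: nat assume c: "c \<ge> i + Suc m"
  let ?x = "2 * of_nat i - of_nat c + of_nat m + 1 :: 'a fps"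
  have "V m (of_nat (Suc i)) (of_nat c) = sc (1 / fact m) * Vn m (Suc i) c"
    by (rule V_of_nat) (use c in simp)
  also have "\<dots> = sc (1 / fact m) * Vn m i c * (1 - e) + z * (?x * (sc (1 / fact m) * Vn (Suc m) i c))"
    using c by (subst Vn_Suc_i) (simp_all add: distrib_left mult.assoc sc_left_comm[of "_ :: 'a fps"])
  also have "sc (1 / fact m) * Vn (Suc m) i c = of_nat (Suc m) * V (Suc m) (of_nat i) (of_nat c)"
  proof -
    have "of_nat (Suc m) * sc (1 / fact (Suc m)) = sc (of_nat (Suc m) * (1 / fact (Suc m)))"
      by (simp only: sc_mult sc_of_nat)
    also have "of_nat (Suc m) * (1 / fact (Suc m)) = (1 / fact m :: 'k)"
      by (simp add: field_simps del: of_nat_Suc)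
    finally show ?thesis
      using c V_of_nat[of i "Suc m" c] by (simp del: of_nat_Suc fact_Suc flip: mult.assoc)
  qed
  also have "?x * (of_nat (Suc m) * V (Suc m) (of_nat i) (of_nat c)) = of_nat (Suc m) * (?x * V (Suc m) (of_nat i) (of_nat c))"
    by (rule of_nat_left_comm)
  finally show "V m (of_nat i + 1) (of_nat c) = V m (of_nat i) (of_nat c) * (1 - e)
     + z * (of_nat (Suc m) * (?x * V (Suc m) (of_nat i) (of_nat c)))"
    using c by (simp add: V_of_nat add.commute[of "of_nat i" 1])
qed

text \<open>Induction on \<open>i + m\<close>. Once the values with smaller \<open>i + m\<close> vanish, \<open>R1\<close> multiplies \<open>L m i c\<close> by the
  invertible series \<open>A(\<dots>)\<close> when \<open>c\<close> is raised by \<open>1\<close>, so a zero at a single \<open>c\<close> spreads to all admissible \<open>c\<close>.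
  Such a zero comes from \<open>R2\<close>: for \<open>L m (i + 1)\<close> take \<open>c = 2 i + m + 1\<close>, where the factor
  \<open>2 i - c + m + 1\<close> vanishes; for \<open>L (N + 1) 0\<close> take \<open>c = N + 2\<close>, where it is \<open>-1\<close> and the left side
  \<open>L N 1 c\<close> is already known to be zero.\<close>

lemma family_zero:
  assumes R1: "\<And>m i c. c \<ge> i + m \<Longrightarrow> L m i (Suc c) = L m i c * A (2 * of_nat c - of_nat i - of_nat m + 1)
      - (case m of 0 \<Rightarrow> 0 | Suc l \<Rightarrow> L l i c * s)"
    and R2: "\<And>m i c. c \<ge> i + m + 1 \<Longrightarrow> L m (Suc i) c = L m i c * (1 - e)
      + z * (of_nat (Suc m) * ((2 * of_nat i - of_nat c + of_nat m + 1) * L (Suc m) i c))"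
    and zero: "L 0 0 0 = 0"
    and c: "c \<ge> i + m"
  shows "L m i c = 0"
proof -
  have spread: "L m i c = 0"
    if L0: "L m i d = 0" and d: "d \<ge> i + m" and low: "\<And>l c. m = Suc l \<Longrightarrow> c \<ge> i + m \<Longrightarrow> L l i c = 0"
      and c: "c \<ge> i + m" for m i c d
  proof -
    have next_c: "L m i (Suc c) = L m i c * A (2 * of_nat c - of_nat i - of_nat m + 1)" if "c \<ge> i + m" for c
      using R1[OF that] low[OF _ that] by (auto split: nat.splits)
    show ?thesis
    proof (cases "c \<ge> d")
      case True
      then show ?thesis
      proof (induction c rule: dec_induct)
        case (step c)
        then show ?case using next_c[of c] d by simp
      qed (rule L0)
    next
      case False
      then have "c \<le> d" by simp
      then show ?thesis
        using c
      proof (induction rule: inc_induct)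
        case (step n)
        then show ?case using fps_right_cancel[OF A_nth_0, of "L m i n"] next_c[of n] by simp
      qed (rule L0)
    qed
  qed
  have "\<forall>m i c. i + m = N \<longrightarrow> c \<ge> N \<longrightarrow> L m i c = 0" for N
  proof (induction N)
    case 0
    show ?case using spread[OF zero] by simp
  next
    case (Suc N)
    have R2': "L m (Suc i) c = z * (of_nat (Suc m) * ((2 * of_nat i - of_nat c + of_nat m + 1) * L (Suc m) i c))"
      if "i + m = N" "c \<ge> Suc N" for m i c
      using R2[of i m c] Suc that by simp
    have pos: "L m (Suc i) c = 0" if N: "i + m = N" and c: "c \<ge> Suc N" for m i c
    proof (rule spread[of m "Suc i" "2 * i + m + 1"])
      have "2 * of_nat i - of_nat (2 * i + m + 1) + of_nat m + 1 = (0 :: 'a fps)" by simp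
      then show "L m (Suc i) (2 * i + m + 1) = 0"
        using R2'[of i m "2 * i + m + 1"] N by (simp del: of_nat_add of_nat_mult)
      show "L l (Suc i) c = 0" if "m = Suc l" "c \<ge> Suc i + m" for l c
        using Suc N that by auto
    qed (use N c in auto)
    have z: "L (Suc N) 0 c = 0" if c: "c \<ge> Suc N" for c
    proof (rule spread[of "Suc N" 0 "N + 2"])
      have "z * (of_nat (Suc N) * ((2 * of_nat 0 - of_nat (N + 2) + of_nat N + 1) * L (Suc N) 0 (N + 2))) = 0"
        using R2'[of 0 N "N + 2"] pos[of 0 N "N + 2"] by simp
      moreover have "2 * of_nat 0 - of_nat (N + 2) + of_nat N + 1 = (- 1 :: 'a fps)" by simp
      ultimately have "z * (of_nat (Suc N) * L (Suc N) 0 (N + 2)) = 0"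
        by (simp del: of_nat_add of_nat_Suc)
      then have "of_nat (Suc N) * L (Suc N) 0 (N + 2) = 0"
        by (rule fps_X_cancel)
      then have "sc (of_nat (Suc N)) * L (Suc N) 0 (N + 2) = 0"
        by (simp only: sc_of_nat)
      then show "L (Suc N) 0 (N + 2) = 0"
        by (rule sc_cancel[rotated]) (simp del: of_nat_Suc)
      show "L l 0 c = 0" if "Suc N = Suc l" "c \<ge> 0 + Suc N" for l c
        using Suc that by auto
    qed (use c in auto)
    show ?case
    proof (intro allI impI)
      fix m i c assume "i + m = Suc N" "c \<ge> Suc N"
      then show "L m i c = 0" using pos[of "i - 1" m c] z[of c] by (cases i) auto
    qed
  qed
  then show ?thesis using c by blast
qed

section \<open>The twist as a normally ordered series\<close>

definition T :: "'a fps \<Rightarrow> 'a fps \<Rightarrow> 'a fps \<Rightarrow> 'a fps" where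
  "T D C f = Exp (D * Lnf (A D)) * Exp (D * Lnf b) * Exp (- (f * (C + D) * s)) * Exp (f * w) * Exp (f * q)
     * Exp ((C - D) * Lnf (A C))"

lemma cg_add: "cg x \<Longrightarrow> cg y \<Longrightarrow> cg (x + y)" and cg_1: "cg 1" and cg_of_nat: "cg (of_nat n)"
  unfolding cg_def by (simp_all add: algebra_simps mult_of_nat_commute)

lemma s_P_shift:
  assumes "cg x"
  shows "s * P (x + 1) = P x * s"
  using assms by (simp add: P_def cg_def algebra_simps rewr)

lemma comm_P: "cg x \<Longrightarrow> x * P x = P x * x"
  unfolding P_def cg_def by (simp add: algebra_simps) (metis mult.assoc)

text \<open>In the notation of \<open>Exp_mult_Exp\<close> with \<open>x = - f (C + D) s\<close> and \<open>y = f (w + q)\<close>, this is the recursion for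
  \<open>S\<^sub>m = P(\<kappa>)\<^sup>m f\<^sup>m\<close>, where \<open>\<kappa> = C + D + 1\<close>: moving \<open>f\<close> through \<open>P(\<kappa>)\<close> raises \<open>\<kappa>\<close> by \<open>1\<close>, and moving \<open>s\<close> lowers it again.\<close>

lemma normal_order_step:
  assumes f: "cg f" "f * \<kappa> = (\<kappa> + 1) * f" and \<kappa>: "cg \<kappa>"
  shows "- (f * (\<kappa> - 1) * s) * (P \<kappa> ^ m * f ^ m) + P \<kappa> ^ m * f ^ m * (f * (w + q)) = P \<kappa> ^ Suc m * f ^ Suc m"
proof -
  have fk: "f * (\<kappa> - 1) = \<kappa> * f" using f(2) by (simp add: algebra_simps)
  have fP: "f * P \<kappa> ^ m = P (\<kappa> + 1) ^ m * f" for m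
  proof -
    have "intertw f (P \<kappa>) (P (\<kappa> + 1))"
      unfolding P_def using f by (intro intertw_add intertw_diff intertw_mult) (auto simp: intertw_def cg_def)
    then show ?thesis using intertw_power unfolding intertw_def by blast
  qed
  have sP: "s * P (\<kappa> + 1) ^ m = P \<kappa> ^ m * s" for m
  proof -
    have "intertw s (P (\<kappa> + 1)) (P \<kappa>)" using s_P_shift[OF \<kappa>] by (simp add: intertw_def)
    then show ?thesis using intertw_power unfolding intertw_def by blast
  qed
  have kP: "\<kappa> * P \<kappa> ^ m = P \<kappa> ^ m * \<kappa>" for m
  proof -
    have "intertw \<kappa> (P \<kappa>) (P \<kappa>)" using comm_P[OF \<kappa>] by (simp add: intertw_def)
    then show ?thesis using intertw_power unfolding intertw_def by blast
  qed
  have ff: "f ^ m * f = f * f ^ m" by (simp add: power_commutes)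
  have fs: "f * s = s * f" and fp: "f ^ Suc m * (w + q) = (w + q) * f ^ Suc m"
    using f(1) power_commuting_commutes[of f "w + q" "Suc m"]
    by (simp_all add: cg_def distrib_left distrib_right del: power_Suc)
  have "f * (\<kappa> - 1) * s * (P \<kappa> ^ m * f ^ m) = \<kappa> * s * (f * P \<kappa> ^ m) * f ^ m"
    unfolding fk by (simp only: mult.assoc) (simp only: fs flip: mult.assoc)
  also have "\<dots> = \<kappa> * (s * P (\<kappa> + 1) ^ m) * f ^ Suc m"
    by (simp only: fP mult.assoc power_Suc)
  also have "\<dots> = \<kappa> * P \<kappa> ^ m * s * f ^ Suc m"
    by (simp only: sP mult.assoc)
  also have "\<dots> = P \<kappa> ^ m * (\<kappa> * s) * f ^ Suc m"
    by (simp only: kP mult.assoc)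
  finally have 1: "f * (\<kappa> - 1) * s * (P \<kappa> ^ m * f ^ m) = P \<kappa> ^ m * (\<kappa> * s) * f ^ Suc m" .
  have "P \<kappa> ^ m * f ^ m * (f * (w + q)) = P \<kappa> ^ m * (f ^ Suc m * (w + q))"
    by (simp only: mult.assoc power_Suc2)
  also have "\<dots> = P \<kappa> ^ m * (w + q) * f ^ Suc m"
    by (simp only: fp mult.assoc)
  finally have 2: "P \<kappa> ^ m * f ^ m * (f * (w + q)) = P \<kappa> ^ m * (w + q) * f ^ Suc m" .
  have "P \<kappa> ^ Suc m * f ^ Suc m = P \<kappa> ^ m * P \<kappa> * f ^ Suc m"
    by (simp only: power_Suc2)
  also have "P \<kappa> ^ m * P \<kappa> = P \<kappa> ^ m * (w + q) - P \<kappa> ^ m * (\<kappa> * s)"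
    by (simp only: P_def right_diff_distrib)
  finally show ?thesis
    by (simp only: 1 2 mult_minus_left left_diff_distrib) simp
qed

lemma T_eq:
  assumes f: "cg f" "f * D = (D + 1) * f" "f * C = C * f" and DC: "cg D" "cg C" "D * C = C * D"
  shows "T D C f = graded_sum (\<lambda>m. V m D C * f ^ m)"
proof -
  let ?\<kappa> = "C + D + 1" and ?Y = "f * (w + q)"
  let ?E1 = "Exp (D * Lnf (A D)) * Exp (D * Lnf b)" and ?E3 = "\<lambda>m. Exp ((C - D - of_nat m) * Lnf (A C))"
  have \<kappa>: "cg ?\<kappa>" by (intro cg_add cg_1 DC)
  have f\<kappa>: "f * ?\<kappa> = (?\<kappa> + 1) * f" using f by (simp add: algebra_simps mult_2)
  have "Exp (f * w) * Exp (f * q) = Exp ?Y"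
    unfolding distrib_left
    by (rule Exp_add[symmetric]) (use f(1) rewr(8) in \<open>simp_all add: cg_def mult.assoc, metis mult.assoc\<close>)
  then have "T D C f = ?E1 * (Exp (- (f * (C + D) * s)) * Exp ?Y) * ?E3 0"
    unfolding T_def by (simp flip: mult.assoc) (simp add: mult.assoc)
  also have "Exp (- (f * (C + D) * s)) * Exp ?Y = graded_sum (\<lambda>m. sc (1 / fact m) * (P ?\<kappa> ^ m * f ^ m))"
  proof (rule Exp_mult_Exp)
    show "P ?\<kappa> ^ Suc m * f ^ Suc m = - (f * (C + D) * s) * (P ?\<kappa> ^ m * f ^ m) + P ?\<kappa> ^ m * f ^ m * ?Y" for m
      using normal_order_step[OF f(1) f\<kappa> \<kappa>, of m] by simp
  qed auto
  finally have T: "T D C f = ?E1 * graded_sum (\<lambda>m. sc (1 / fact m) * (P ?\<kappa> ^ m * f ^ m)) * ?E3 0" .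
  have "(P ?\<kappa> ^ m * f ^ m) $ n = 0" if "n < m" for m n
    by (rule nth_mult_low[of m _ 0]) (use that in \<open>auto simp: gradedD[OF graded_power[OF P_nth_0]]\<close>)
  then have G: "graded (\<lambda>m. sc (1 / fact m) * (P ?\<kappa> ^ m * f ^ m))"
    by (simp add: graded_def sc_nth)
  have E: "f ^ m * ?E3 0 = ?E3 m * f ^ m" for m
  proof -
    have "f ^ m * (C - D) = (C - D - of_nat m) * f ^ m"
    proof (induction m)
      case (Suc m)
      have "f ^ Suc m * (C - D) = f * ((C - D - of_nat m) * f ^ m)" by (simp add: Suc mult.assoc)
      also have "\<dots> = (f * (C - D - of_nat m)) * f ^ m" by (simp only: mult.assoc)
      also have "f * (C - D - of_nat m) = (C - D - of_nat (Suc m)) * f"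
        using f(2,3) by (simp add: algebra_simps mult_of_nat_commute)
      finally show ?case by (simp add: mult.assoc)
    qed simp
    moreover have "f * A C = A C * f"
      using f(1,3) unfolding A_def by (simp add: cg_def algebra_simps) (metis fps_mult_fps_X_commute mult.assoc)
    then have "intertw (f ^ m) (A C) (A C)"
      by (simp add: intertw_def power_commuting_commutes)
    ultimately have "intertw (f ^ m) (Exp ((C - D) * Lnf (A C))) (?E3 m)"
      by (intro intertw_Exp intertw_mult intertw_Ln) (simp_all add: Ln_nth_0, simp add: intertw_def)
    then show ?thesis by (simp add: intertw_def)
  qed
  show ?thesis
    unfolding T mult_graded_sum[OF G] graded_sum_mult[OF graded_mult_left[OF G]]
  proof (rule graded_sum_cong)
    fix m
    have "?E1 * (sc (1 / fact m) * (P ?\<kappa> ^ m * f ^ m)) * ?E3 0 = sc (1 / fact m) * (?E1 * P ?\<kappa> ^ m) * (f ^ m * ?E3 0)"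
      by (subst sc_left_comm) (simp only: mult.assoc)
    then show "?E1 * (sc (1 / fact m) * (P ?\<kappa> ^ m * f ^ m)) * ?E3 0 = V m D C * f ^ m"
      by (simp only: E V_def mult.assoc)
  qed
qed

end

context quad_alg
begin

lemma intertw_V:
  assumes "cg y" "intertw y x x'" "intertw y u u'"
  shows "intertw y (V m x u) (V m x' u')"
proof -
  have "intertw y a a" "intertw y e e" "intertw y q q" "intertw y s s" "intertw y w w"
    using assms(1) by (auto simp: cg_def intertw_def)
  then show ?thesis
    unfolding V_def A_def P_def b_def
    by (intro intertw_mult intertw_add intertw_diff intertw_power intertw_Exp intertw_Ln
        intertw_1 intertw_X intertw_sc intertw_of_nat assms(2,3)) (simp_all add: Ln_nth_0)
qed

end

section \<open>The Drinfeld equation in the quadratic algebras\<close>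

text \<open>The situation in the tensor cube: \<open>D1\<close>, \<open>C1\<close>, \<open>f1\<close> are \<open>D\<^sub>3\<close>, \<open>D\<^sub>2\<close>, \<open>E\<^sub>4\<^sub>3\<close> in the first tensor factor and
  \<open>D2\<close>, \<open>C2\<close>, \<open>f2\<close> those in the second; the index \<open>2\<close> or \<open>3\<close> of the quadratic generators is the factor
  in which they live, and \<open>ah, \<dots>, wh\<close> are their images under \<open>id \<otimes> \<Delta>\<^sub>J\<close>.\<close>

locale twist_data = M2: quad_alg scale a2 e2 q2 s2 w2 + M3: quad_alg scale a3 e3 q3 s3 w3
  + MH: quad_alg scale ah eh qh sh wh
  for scale :: "'k::field_char_0 \<Rightarrow> 'a::ring_1 \<Rightarrow> 'a"
    and a2 e2 q2 s2 w2 a3 e3 q3 s3 w3 ah eh qh sh wh :: "'a fps" +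
  fixes C1 D1 C2 D2 :: 'a and f1 f2 :: "'a fps"
  assumes hat: "ah = a2 + a3 - 1 + (2 * fps_const C2 - fps_const D2) * (fps_X * q3) - f2 * s3"
      "eh = e2 + e3" "qh = q2 + q3" "sh = s2 + s3"
    and slot1: "C1 * D1 = D1 * C1" "f1 * fps_const D1 = (fps_const D1 + 1) * f1" "f1 * fps_const C1 = fps_const C1 * f1"
    and slot2: "C2 * D2 = D2 * C2" "f2 * fps_const D2 = (fps_const D2 + 1) * f2" "f2 * fps_const C2 = fps_const C2 * f2"
    and slots12: "C1 * C2 = C2 * C1" "C1 * D2 = D2 * C1" "D1 * C2 = C2 * D1" "D1 * D2 = D2 * D1"
      "f1 * fps_const C2 = fps_const C2 * f1" "f1 * fps_const D2 = fps_const D2 * f1" "f1 * f2 = f2 * f1"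
      "f2 * fps_const C1 = fps_const C1 * f2" "f2 * fps_const D1 = fps_const D1 * f2"
    and cg2: "M2.cg (fps_const C1)" "M2.cg (fps_const D1)" "M2.cg f1"
    and cg3: "M3.cg (fps_const C1)" "M3.cg (fps_const D1)" "M3.cg f1" "M3.cg (fps_const C2)" "M3.cg (fps_const D2)" "M3.cg f2"
      "M3.cg a2" "M3.cg e2" "M3.cg q2" "M3.cg s2"
    and cgH: "MH.cg (fps_const C1)" "MH.cg (fps_const D1)" "MH.cg f1"
    and weights: "fps_const D2 * e2 = e2 * (fps_const D2 + 1)" "fps_const C2 * e2 = e2 * fps_const C2"
      "e2 * f2 = f2 * e2 + fps_X * (2 * fps_const D2 - fps_const C2)"
      "fps_const C2 * (a2 - 1) = (a2 - 1) * (fps_const C2 + 1)" "fps_const D2 * a2 = a2 * fps_const D2" "f2 * a2 = a2 * f2"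
      "fps_const C2 * q2 = q2 * (fps_const C2 + 1)" "fps_const D2 * q2 = q2 * fps_const D2" "f2 * q2 = q2 * f2"
      "fps_const C2 * s2 = s2 * (fps_const C2 + 1)" "fps_const D2 * s2 = s2 * (fps_const D2 + 1)"
      "s2 * f2 = f2 * s2 + fps_X * q2"
begin

abbreviation "z \<equiv> (fps_X :: 'a fps)"
abbreviation "cC1 \<equiv> fps_const C1"
abbreviation "cD1 \<equiv> fps_const D1"
abbreviation "cC2 \<equiv> fps_const C2"
abbreviation "cD2 \<equiv> fps_const D2"

declare fps_const_add [simp del] fps_const_sub [simp del] fps_const_mult [simp del] fps_const_neg [simp del]

text \<open>\<open>GG l D C\<close> is the coefficient of \<open>f1\<^sup>l\<close> in \<open>(\<Delta> \<otimes> id)(G)\<close> when \<open>D\<close>, \<open>C\<close> stand in the first tensor factor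
  (\<open>twist_total\<close>): the binomials come from \<open>(f1 + f2)\<^sup>N\<close>.\<close>

definition gt :: "nat \<Rightarrow> 'a fps \<Rightarrow> 'a fps \<Rightarrow> nat \<Rightarrow> 'a fps" where
  "gt l D C N = of_nat (N choose l) * (M3.V N (cD2 + D) (cC2 + C) * f2 ^ (N - l))"

definition GG :: "nat \<Rightarrow> 'a fps \<Rightarrow> 'a fps \<Rightarrow> 'a fps" where
  "GG l D C = graded_sum (gt l D C)"

lemma of_nat_mult_low: "x $ n = 0 \<Longrightarrow> (of_nat k * (x :: 'a fps)) $ n = 0"
  by (simp flip: M2.sc_of_nat add: M2.sc_nth)

lemma V_f_low: "n < N \<Longrightarrow> (M3.V N D C * y) $ n = 0"
  by (rule nth_mult_low[of N _ 0]) (simp_all add: M3.V_low)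

lemma graded_gt: "graded (gt l D C)"
  by (simp add: graded_def gt_def of_nat_mult_low V_f_low)

lemma gt_low: "N < l \<Longrightarrow> gt l D C N = 0"
  by (simp add: gt_def binomial_eq_0)

lemma choose_mult: "(N choose l) * (N - l) = Suc l * (N choose Suc l)"
  by (metis binomial_absorb_comp binomial_absorption mult.commute)

lemma f2_power:
  "f2 ^ p * cD2 = (cD2 + of_nat p) * f2 ^ p" "f2 ^ p * cC2 = cC2 * f2 ^ p"
proof -
  show "f2 ^ p * cD2 = (cD2 + of_nat p) * f2 ^ p"
  proof (induction p)
    case (Suc p)
    have "f2 ^ Suc p * cD2 = f2 * (cD2 + of_nat p) * f2 ^ p" by (simp add: Suc mult.assoc)
    also have "f2 * (cD2 + of_nat p) = (cD2 + of_nat (Suc p)) * f2"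
      by (simp add: distrib_left distrib_right slot2 mult_of_nat_commute)
    finally show ?case by (simp add: mult.assoc)
  qed simp
  show "f2 ^ p * cC2 = cC2 * f2 ^ p"
    by (rule power_commuting_commutes[OF slot2(3)])
qed

lemma e2_f2_power: "e2 * f2 ^ p = f2 ^ p * e2 + z * (of_nat p * ((2 * cD2 - cC2 + of_nat p - 1) * f2 ^ (p - 1)))"
proof (induction p)
  case (Suc p)
  show ?case
  proof (cases p)
    case 0
    then show ?thesis using weights(3) by simp
  next
    case (Suc r)
    define k where "k = (of_nat p :: 'a fps)"
    have k: "central k" by (simp add: k_def)
    have p1: "p - 1 = r" by (simp add: Suc)
    have fz: "f2 * (z * t) = z * (f2 * t)" and fk: "f2 * (k * t) = k * (f2 * t)" "cD2 * (k * t) = k * (cD2 * t)" "cC2 * (k * t) = k * (cC2 * t)" for t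
      by (simp_all add: central_left_comm[OF central_fps_X, of f2] central_left_comm[OF k])
    have fD: "f2 * (cD2 * t) = cD2 * (f2 * t) + f2 * t" and fC: "f2 * (cC2 * t) = cC2 * (f2 * t)" for t
      using slot2(2,3) by (simp_all add: distrib_right flip: mult.assoc)
    have "e2 * f2 ^ Suc p = f2 * (e2 * f2 ^ p) + z * (2 * cD2 - cC2) * f2 ^ p"
      using weights(3) by (simp add: distrib_right flip: mult.assoc)
    also have "\<dots> = f2 ^ Suc p * e2 + z * (k * (f2 * ((2 * cD2 - cC2 + k - 1) * f2 ^ r)) + (2 * cD2 - cC2) * f2 ^ p)"
      unfolding Suc.IH[folded k_def] p1 by (simp only: distrib_left mult.assoc fz fk(1) power_Suc add.assoc)
    also have "f2 * ((2 * cD2 - cC2 + k - 1) * f2 ^ r) = (2 * cD2 - cC2 + k + 1) * f2 ^ p"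
      by (simp add: Suc mult_2 distrib_left distrib_right left_diff_distrib right_diff_distrib mult.assoc fD fC fk(1))
    also have "k * ((2 * cD2 - cC2 + k + 1) * f2 ^ p) + (2 * cD2 - cC2) * f2 ^ p = (k + 1) * ((2 * cD2 - cC2 + (k + 1) - 1) * f2 ^ p)"
      by (simp add: mult_2 distrib_left distrib_right left_diff_distrib right_diff_distrib mult.assoc)
    finally show ?thesis by (simp add: k_def add.commute)
  qed
qed simp

lemma s2_f2_power: "s2 * f2 ^ p = f2 ^ p * s2 + z * (of_nat p * (f2 ^ (p - 1) * q2))"
proof (induction p)
  case (Suc p)
  have "s2 * f2 ^ Suc p = f2 * (s2 * f2 ^ p) + z * (q2 * f2 ^ p)"
    using weights(12) by (simp add: distrib_right mult.assoc flip: mult.assoc[of s2])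
  also have "q2 * f2 ^ p = f2 ^ p * q2"
    using power_commuting_commutes[OF weights(9), of p] by simp
  also have "f2 * (s2 * f2 ^ p) = f2 ^ Suc p * s2 + z * (of_nat p * (f2 ^ p * q2))"
    unfolding Suc.IH
    by (cases p) (simp_all add: distrib_left mult.assoc central_left_comm[OF central_fps_X, of f2] of_nat_left_comm[of f2] del: of_nat_Suc)
  finally show ?case by (simp add: distrib_left distrib_right add_ac)
qed simp

lemma V3_comm: "cD2 * M3.V N (cD2 + of_nat i) (cC2 + of_nat c) = M3.V N (cD2 + of_nat i) (cC2 + of_nat c) * cD2"
  "cC2 * M3.V N (cD2 + of_nat i) (cC2 + of_nat c) = M3.V N (cD2 + of_nat i) (cC2 + of_nat c) * cC2"
proof -
  have gen: "x * M3.V N (cD2 + of_nat i) (cC2 + of_nat c) = M3.V N (cD2 + of_nat i) (cC2 + of_nat c) * x"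
    if "M3.cg x" "x * cD2 = cD2 * x" "x * cC2 = cC2 * x" for x
  proof -
    have "M2.intertw x (M3.V N (cD2 + of_nat i) (cC2 + of_nat c)) (M3.V N (cD2 + of_nat i) (cC2 + of_nat c))"
      by (intro M3.intertw_V that M2.intertw_add M2.intertw_of_nat)
        (simp_all add: M2.intertw_def that)
    then show ?thesis by (simp add: M2.intertw_def)
  qed
  show "cD2 * M3.V N (cD2 + of_nat i) (cC2 + of_nat c) = M3.V N (cD2 + of_nat i) (cC2 + of_nat c) * cD2"
    by (rule gen) (use cg3 slot2(1) in \<open>simp_all add: fps_const_mult\<close>)
  show "cC2 * M3.V N (cD2 + of_nat i) (cC2 + of_nat c) = M3.V N (cD2 + of_nat i) (cC2 + of_nat c) * cC2"
    by (rule gen) (use cg3 slot2(1) in \<open>simp_all add: fps_const_mult\<close>)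
qed

text \<open>In slot \<open>2\<close> the elements \<open>a2 - 1\<close> and \<open>q2\<close> have weight \<open>1\<close> for \<open>C2\<close> and commute with \<open>D2\<close>, \<open>f2\<close>; passing
  them through \<open>GG\<close> therefore lowers the second argument.\<close>

lemma GG_weight_C:
  "(a2 - 1) * GG l (of_nat i) (of_nat (Suc c)) = GG l (of_nat i) (of_nat c) * (a2 - 1)"
  "q2 * GG l (of_nat i) (of_nat (Suc c)) = GG l (of_nat i) (of_nat c) * q2"
proof -
  have *: "x * GG l (of_nat i) (of_nat (Suc c)) = GG l (of_nat i) (of_nat c) * x"
    if x: "cC2 * x = x * (cC2 + 1)" "cD2 * x = x * cD2" "f2 * x = x * f2" "M3.cg x" for x
  proof -
    have "M2.intertw x (gt l (of_nat i) (of_nat (Suc c)) N) (gt l (of_nat i) (of_nat c) N)" for N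
      unfolding gt_def using x
      by (intro M2.intertw_mult M2.intertw_of_nat M3.intertw_V M2.intertw_power)
        (auto simp: M2.intertw_def distrib_left distrib_right mult_of_nat_commute)
    then show ?thesis
      unfolding GG_def using M2.intertw_graded_sum[OF graded_gt graded_gt] by (simp add: M2.intertw_def)
  qed
  show "(a2 - 1) * GG l (of_nat i) (of_nat (Suc c)) = GG l (of_nat i) (of_nat c) * (a2 - 1)"
    by (rule *) (use weights cg3 in \<open>auto simp: M3.cg_def algebra_simps\<close>)
  show "q2 * GG l (of_nat i) (of_nat (Suc c)) = GG l (of_nat i) (of_nat c) * q2"
    by (rule *) (use weights cg3 in auto)
qed

text \<open>\<open>s2\<close> has weight \<open>1\<close> for both \<open>C2\<close> and \<open>D2\<close>, and the bracket \<open>[s2, f2] = \<zeta> q2\<close> produces the term in \<open>GG (l + 1)\<close>.\<close>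

lemma GG_weight_CD:
  "s2 * GG l (of_nat (Suc i)) (of_nat (Suc c)) = GG l (of_nat i) (of_nat c) * s2
    + z * (of_nat (Suc l) * (GG (Suc l) (of_nat i) (of_nat c) * q2))"
proof -
  have "s2 * gt l (of_nat (Suc i)) (of_nat (Suc c)) N = gt l (of_nat i) (of_nat c) N * s2
    + z * of_nat (Suc l) * (gt (Suc l) (of_nat i) (of_nat c) N * q2)" for N
  proof -
    let ?V = "M3.V N (cD2 + of_nat i) (cC2 + of_nat c)"
    have "M2.intertw s2 (M3.V N (cD2 + of_nat (Suc i)) (cC2 + of_nat (Suc c))) ?V"
      using weights cg3 by (intro M3.intertw_V)
        (auto simp: M2.intertw_def distrib_left distrib_right mult_of_nat_commute)
    then have V: "s2 * M3.V N (cD2 + of_nat (Suc i)) (cC2 + of_nat (Suc c)) = ?V * s2"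
      by (simp add: M2.intertw_def)
    have "s2 * gt l (of_nat (Suc i)) (of_nat (Suc c)) N = of_nat (N choose l) * (?V * (s2 * f2 ^ (N - l)))"
      unfolding gt_def of_nat_left_comm[of s2] using V by (simp flip: mult.assoc)
    also have "\<dots> = gt l (of_nat i) (of_nat c) N * s2 + z * (of_nat (N choose l) * (of_nat (N - l) * (?V * (f2 ^ (N - l - 1) * q2))))"
      unfolding s2_f2_power gt_def distrib_left
      by (simp only: mult.assoc central_left_comm[OF central_fps_X, of ?V] central_left_comm[OF central_fps_X, of "of_nat _"] of_nat_left_comm[of ?V])
    also have "of_nat (N choose l) * (of_nat (N - l) * (?V * (f2 ^ (N - l - 1) * q2))) = of_nat (Suc l) * (gt (Suc l) (of_nat i) (of_nat c) N * q2)"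
      unfolding gt_def by (simp only: mult.assoc[symmetric] of_nat_mult[symmetric] choose_mult) (simp del: of_nat_Suc add: diff_diff_eq)
    finally show ?thesis by (simp only: mult.assoc)
  qed
  then have "s2 * GG l (of_nat (Suc i)) (of_nat (Suc c)) = graded_sum (\<lambda>N. gt l (of_nat i) (of_nat c) N * s2
    + z * of_nat (Suc l) * (gt (Suc l) (of_nat i) (of_nat c) N * q2))"
    unfolding GG_def by (simp only: mult_graded_sum[OF graded_gt])
  also have "\<dots> = GG l (of_nat i) (of_nat c) * s2 + z * of_nat (Suc l) * (GG (Suc l) (of_nat i) (of_nat c) * q2)"
    unfolding GG_def graded_sum_add graded_sum_mult[OF graded_gt] mult_graded_sum[OF graded_mult_right[OF graded_gt]] ..
  finally show ?thesis by (simp only: mult.assoc)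
qed

lemma const_plus: "fps_const (x + of_nat i) = fps_const x + (of_nat i :: 'a fps)"
  by (simp only: fps_of_nat fps_const_add[symmetric])

lemma cg_sum: "M3.cg (fps_const (D2 + of_nat i))" "M3.cg (fps_const (C2 + of_nat c))"
  using M3.cg_add[OF cg3(5) M3.cg_of_nat[of i]] M3.cg_add[OF cg3(4) M3.cg_of_nat[of c]]
  by (simp_all only: const_plus)

lemma shifted_comm: "(D2 + of_nat i) * (C2 + of_nat c) = (C2 + of_nat c) * (D2 + of_nat i)"
  using slot2(1) mult_of_nat_commute[of i C2] mult_of_nat_commute[of c D2] mult_of_nat_commute[of i "of_nat c :: 'a"]
  by (simp add: distrib_left distrib_right)

text \<open>The recursion \<open>V_Suc_C\<close> in the third factor. Its lower-order terms are shifted by one in \<open>N\<close>; Pascal's rule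
  splits them into a part with \<open>f2 s3\<close> and a part belonging to \<open>l - 1\<close>.\<close>

lemma GG_Suc_C:
  "GG l (of_nat i) (of_nat (Suc c)) = GG l (of_nat i) (of_nat c) *
      (a3 + (2 * of_nat c - of_nat i - of_nat l + 1 + (2 * cC2 - cD2)) * (z * q3) - f2 * s3)
    - (case l of 0 \<Rightarrow> 0 | Suc k \<Rightarrow> GG k (of_nat i) (of_nat c) * s3)"
proof -
  let ?y = "2 * of_nat c - of_nat i - of_nat l + 1 :: 'a fps"
  let ?g = "\<lambda>l. gt l (of_nat i) (of_nat c)"
  let ?X = "\<lambda>N. case N of 0 \<Rightarrow> 0 | Suc M \<Rightarrow>
      of_nat (N choose l) * (M3.V M (cD2 + of_nat i) (cC2 + of_nat c) * s3 * f2 ^ (N - l))"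
  have f2p: "f2 ^ p * x = x * f2 ^ p" if "f2 * x = x * f2" for x p
    by (rule power_commuting_commutes[OF that])
  have s3: "f2 ^ p * s3 = s3 * f2 ^ p" and q3: "f2 ^ p * q3 = q3 * f2 ^ p" and a3: "f2 ^ p * a3 = a3 * f2 ^ p" for p
    using cg3(6) by (simp_all only: M3.cg_def f2p)
  have term_N: "gt l (of_nat i) (of_nat (Suc c)) N = ?g l N * (a3 + (?y + (2 * cC2 - cD2)) * (z * q3)) - ?X N" for N
  proof -
    let ?V = "M3.V N (cD2 + of_nat i) (cC2 + of_nat c)"
    have V: "M3.V N (cD2 + of_nat i) (cC2 + of_nat (Suc c)) =
        ?V * M3.A (2 * (cC2 + of_nat c) - (cD2 + of_nat i) - of_nat N + 1)
        - (case N of 0 \<Rightarrow> 0 | Suc M \<Rightarrow> M3.V M (cD2 + of_nat i) (cC2 + of_nat c) * s3)"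
      using M3.V_Suc_C[OF shifted_comm[of i c] cg_sum(1)[of i] cg_sum(2)[of c], of N] by (simp only: const_plus of_nat_Suc add_ac)
    have A: "M3.A (2 * (cC2 + of_nat c) - (cD2 + of_nat i) - of_nat N + 1) * f2 ^ (N - l)
        = f2 ^ (N - l) * (a3 + (?y + (2 * cC2 - cD2)) * (z * q3))" if "l \<le> N"
    proof -
      have "f2 ^ (N - l) * (?y + (2 * cC2 - cD2)) = (2 * (cC2 + of_nat c) - (cD2 + of_nat i) - of_nat N + 1) * f2 ^ (N - l)"
        using that f2_power[of "N - l"] mult_of_nat_commute[of c "f2 ^ (N - l)"] mult_of_nat_commute[of i "f2 ^ (N - l)"]
          mult_of_nat_commute[of l "f2 ^ (N - l)"] mult_of_nat_commute[of N "f2 ^ (N - l)"]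
        by (simp add: of_nat_diff mult_2 distrib_left distrib_right left_diff_distrib right_diff_distrib)
      then have "f2 ^ (N - l) * ((?y + (2 * cC2 - cD2)) * (z * q3))
          = (2 * (cC2 + of_nat c) - (cD2 + of_nat i) - of_nat N + 1) * (f2 ^ (N - l) * (z * q3))"
        by (simp only: mult.assoc[symmetric])
      also have "f2 ^ (N - l) * (z * q3) = z * (f2 ^ (N - l) * q3)"
        by (rule central_left_comm[OF central_fps_X])
      finally have "f2 ^ (N - l) * ((?y + (2 * cC2 - cD2)) * (z * q3))
          = (2 * (cC2 + of_nat c) - (cD2 + of_nat i) - of_nat N + 1) * (z * (f2 ^ (N - l) * q3))" .
      then show ?thesis
        unfolding M3.A_def by (simp only: distrib_left distrib_right a3 q3 mult.assoc)
    qed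
    show ?thesis
    proof (cases "l \<le> N")
      case True
      let ?C = "case N of 0 \<Rightarrow> 0 | Suc M \<Rightarrow> M3.V M (cD2 + of_nat i) (cC2 + of_nat c) * s3"
      have "gt l (of_nat i) (of_nat (Suc c)) N = of_nat (N choose l) * (?V * (M3.A (2 * (cC2 + of_nat c) - (cD2 + of_nat i) - of_nat N + 1) * f2 ^ (N - l)))
          - of_nat (N choose l) * (?C * f2 ^ (N - l))"
        unfolding gt_def V by (simp only: left_diff_distrib[of _ ?C] right_diff_distrib[of _ _ "?C * _"] mult.assoc)
      moreover have "of_nat (N choose l) * (?C * f2 ^ (N - l)) = ?X N"
        by (cases N) simp_all
      ultimately show ?thesis
        by (simp only: A[OF True] gt_def mult.assoc)
    next
      case False
      then show ?thesis by (simp add: gt_low binomial_eq_0 split: nat.splits)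
    qed
  qed
  have X_low: "?X N $ n = 0" if "n < N" for N n
  proof (cases N)
    case (Suc M)
    have "(M3.V M (cD2 + of_nat i) (cC2 + of_nat c) * s3) $ j = 0" if "j < N" for j
      by (rule nth_mult_low[of M _ 1]) (use that Suc in \<open>simp_all add: M3.V_low\<close>)
    then have "(M3.V M (cD2 + of_nat i) (cC2 + of_nat c) * s3 * f2 ^ (N - l)) $ n = 0"
      by (rule nth_mult_low[of N _ 0]) (use that in simp_all)
    then show ?thesis by (simp add: Suc of_nat_mult_low)
  qed simp
  have X_Suc: "?X (Suc N) = (case l of 0 \<Rightarrow> 0 | Suc k \<Rightarrow> ?g k N * s3) + ?g l N * (f2 * s3)" for N
  proof -
    let ?V = "M3.V N (cD2 + of_nat i) (cC2 + of_nat c)"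
    have shift: "of_nat (N choose l) * (?V * s3 * f2 ^ (Suc N - l)) = ?g l N * (f2 * s3)"
    proof (cases "l \<le> N")
      case True
      then have "s3 * f2 ^ (Suc N - l) = f2 ^ (N - l) * (f2 * s3)"
        using s3[of "Suc N - l"] by (simp add: Suc_diff_le power_Suc2 mult.assoc del: power_Suc)
      then show ?thesis by (simp add: gt_def mult.assoc)
    qed (simp add: gt_low binomial_eq_0)
    show ?thesis
    proof (cases l)
      case 0
      then show ?thesis using shift by simp
    next
      case (Suc k)
      have "of_nat (Suc N choose l) * (?V * s3 * f2 ^ (Suc N - l)) =
          of_nat (N choose k) * (?V * s3 * f2 ^ (N - k)) + of_nat (N choose l) * (?V * s3 * f2 ^ (Suc N - l))"
        by (simp add: Suc distrib_right)
      then show ?thesis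
        using shift by (simp add: Suc gt_def s3 mult.assoc)
    qed
  qed
  have "GG l (of_nat i) (of_nat (Suc c)) = GG l (of_nat i) (of_nat c) * (a3 + (?y + (2 * cC2 - cD2)) * (z * q3)) - graded_sum ?X"
    unfolding GG_def term_N by (simp add: graded_sum_diff graded_sum_mult[OF graded_gt])
  also have "graded_sum ?X = graded_sum (\<lambda>N. ?X (Suc N))"
    by (rule graded_sum_shift) (use X_low in \<open>auto simp: graded_def\<close>)
  also have "\<dots> = (case l of 0 \<Rightarrow> 0 | Suc k \<Rightarrow> GG k (of_nat i) (of_nat c) * s3) + GG l (of_nat i) (of_nat c) * (f2 * s3)"
    unfolding X_Suc graded_sum_add GG_def graded_sum_mult[OF graded_gt]
    by (cases l) (simp_all add: graded_sum_def fps_zero_def)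
  finally show ?thesis by (simp add: right_diff_distrib)
qed

text \<open>The recursion \<open>V_Suc_D\<close> contributes the sum of \<open>?X (N + 1)\<close>, and the bracket \<open>[e2, f2\<^sup>p]\<close> the sum of \<open>?X N\<close>.
  The two telescope, which leaves a multiple of \<open>GG (l + 1)\<close>.\<close>

lemma GG_Suc_D:
  "(1 - e2) * GG l (of_nat (Suc i)) (of_nat c) = GG l (of_nat i) (of_nat c) * (1 - eh)
    + z * (of_nat (Suc l) * ((2 * of_nat i - of_nat c + of_nat l + 1) * GG (Suc l) (of_nat i) (of_nat c)))"
proof -
  let ?g = "\<lambda>l. gt l (of_nat i) (of_nat c)"
  let ?t = "2 * of_nat i - of_nat c + of_nat l + 1 :: 'a fps"
  let ?V = "\<lambda>N. M3.V N (cD2 + of_nat i) (cC2 + of_nat c)"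
  let ?h = "2 * cD2 - cC2"
  let ?X = "\<lambda>N. of_nat (N choose Suc l) * ((?h + 2 * of_nat i - of_nat c + of_nat N) * (?V N * f2 ^ (N - Suc l)))"
  have e3: "f2 ^ p * e3 = e3 * f2 ^ p" for p
    using cg3(6) power_commuting_commutes[of f2 e3 p] unfolding M3.cg_def by blast
  have VD: "M3.V N (cD2 + of_nat (Suc i)) (cC2 + of_nat c) = ?V N * (1 - e3)
      + z * (of_nat (Suc N) * ((?h + 2 * of_nat i - of_nat c + of_nat (Suc N)) * ?V (Suc N)))" for N
  proof -
    have x: "2 * (cD2 + of_nat i) - (cC2 + of_nat c) + of_nat N + 1 = ?h + 2 * of_nat i - of_nat c + of_nat (Suc N)"
      by (simp add: mult_2)
    have y: "cD2 + of_nat i + 1 = cD2 + of_nat (Suc i)" by simp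
    show ?thesis
      using M3.V_Suc_D[OF shifted_comm[of i c] cg_sum(1)[of i] cg_sum(2)[of c], of N] unfolding const_plus x y .
  qed
  have Ve: "e2 * M3.V N (cD2 + of_nat (Suc i)) (cC2 + of_nat c) = ?V N * e2" for N
  proof -
    have "M2.intertw e2 (M3.V N (cD2 + of_nat (Suc i)) (cC2 + of_nat c)) (?V N)"
      using weights cg3 by (intro M3.intertw_V)
        (auto simp: M2.intertw_def distrib_left distrib_right mult_of_nat_commute)
    then show ?thesis by (simp add: M2.intertw_def)
  qed
  have hV: "?V N * (?h + k) = (?h + k) * ?V N" if "central k" for N k
    using V3_comm[of N i c] central_comm[OF that, of "?V N"]
    by (simp add: mult_2 distrib_left distrib_right left_diff_distrib right_diff_distrib)
  have term_N: "(1 - e2) * gt l (of_nat (Suc i)) (of_nat c) N = ?g l N * (1 - eh) + z * of_nat (Suc l) * ?X (Suc N)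
      - z * (of_nat (Suc l) * (?X N - ?t * ?g (Suc l) N))" for N
  proof -
    let ?B = "of_nat (N choose l) :: 'a fps" and ?p = "N - l"
    have B1: "?B * of_nat (Suc N) = of_nat (Suc l) * of_nat (Suc N choose Suc l)"
      by (simp only: of_nat_mult[symmetric] Suc_times_binomial_eq mult.commute[of "Suc l"] mult.commute[of "N choose l"])
    have B2: "?B * of_nat ?p = of_nat (Suc l) * of_nat (N choose Suc l)"
      by (simp only: of_nat_mult[symmetric] choose_mult)
    have first: "gt l (of_nat (Suc i)) (of_nat c) N = ?g l N * (1 - e3) + z * of_nat (Suc l) * ?X (Suc N)"
    proof -
      have "gt l (of_nat (Suc i)) (of_nat c) N = ?g l N * (1 - e3)
          + z * (?B * (of_nat (Suc N) * ((?h + 2 * of_nat i - of_nat c + of_nat (Suc N)) * (?V (Suc N) * f2 ^ ?p))))"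
      proof -
        have "(1 - e3) * f2 ^ ?p = f2 ^ ?p * (1 - e3)"
          by (simp add: left_diff_distrib right_diff_distrib e3)
        then show ?thesis
          unfolding gt_def VD distrib_right distrib_left
          by (simp only: mult.assoc central_left_comm[OF central_fps_X, of ?B])
      qed
      also have "?B * (of_nat (Suc N) * ((?h + 2 * of_nat i - of_nat c + of_nat (Suc N)) * (?V (Suc N) * f2 ^ ?p)))
          = of_nat (Suc l) * ?X (Suc N)"
        by (simp only: mult.assoc[symmetric] B1 diff_Suc_Suc)
      finally show ?thesis by (simp only: mult.assoc)
    qed
    have second: "e2 * gt l (of_nat (Suc i)) (of_nat c) N = ?g l N * e2 + z * (of_nat (Suc l) * (?X N - ?t * ?g (Suc l) N))"
    proof -
      have "e2 * gt l (of_nat (Suc i)) (of_nat c) N = ?B * (?V N * (e2 * f2 ^ ?p))"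
        unfolding gt_def of_nat_left_comm[of e2] by (simp only: mult.assoc[symmetric] Ve)
      also have "\<dots> = ?g l N * e2 + z * (?B * (of_nat ?p * ((?h + of_nat ?p - 1) * (?V N * f2 ^ (?p - 1)))))"
      proof -
        have "?V N * ((?h + of_nat ?p - 1) * y) = (?h + of_nat ?p - 1) * (?V N * y)" for y
          using hV[of "of_nat ?p - 1" N] by (simp add: add_diff_eq flip: mult.assoc)
        then show ?thesis
          unfolding e2_f2_power gt_def distrib_left
          by (simp only: mult.assoc central_left_comm[OF central_fps_X, of "?V N"] central_left_comm[OF central_fps_X, of ?B] of_nat_left_comm[of "?V N"])
      qed
      also have "?B * (of_nat ?p * ((?h + of_nat ?p - 1) * (?V N * f2 ^ (?p - 1))))
          = of_nat (Suc l) * (of_nat (N choose Suc l) * ((?h + of_nat ?p - 1) * (?V N * f2 ^ (N - Suc l))))"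
        by (simp only: mult.assoc[symmetric] B2) (simp add: diff_diff_eq)
      also have "of_nat (N choose Suc l) * ((?h + of_nat ?p - 1) * (?V N * f2 ^ (N - Suc l))) = ?X N - ?t * ?g (Suc l) N"
      proof (cases "Suc l \<le> N")
        case True
        then have "?h + of_nat ?p - 1 = (?h + 2 * of_nat i - of_nat c + of_nat N) - ?t"
          by (simp add: of_nat_diff)
        then show ?thesis
          by (simp only: gt_def left_diff_distrib[of _ ?t] right_diff_distrib of_nat_left_comm[of ?t])
      qed (simp add: gt_low binomial_eq_0)
      finally show ?thesis .
    qed
    have "(1 - e2) * gt l (of_nat (Suc i)) (of_nat c) N = gt l (of_nat (Suc i)) (of_nat c) N - e2 * gt l (of_nat (Suc i)) (of_nat c) N"
      by (simp only: left_diff_distrib mult_1_left)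
    also have "\<dots> = ?g l N * (1 - e3) + z * of_nat (Suc l) * ?X (Suc N) - (?g l N * e2 + z * (of_nat (Suc l) * (?X N - ?t * ?g (Suc l) N)))"
      by (subst second, subst first) (rule refl)
    also have "\<dots> = ?g l N * (1 - eh) + z * of_nat (Suc l) * ?X (Suc N) - z * (of_nat (Suc l) * (?X N - ?t * ?g (Suc l) N))"
      unfolding hat by (simp only: right_diff_distrib distrib_left mult_1_right) (simp only: algebra_simps)
    finally show ?thesis .
  qed
  have VX: "((?h + 2 * of_nat i - of_nat c + of_nat N) * (?V N * f2 ^ k)) $ n = 0" if "n < N" for N k n
    by (rule nth_mult_low[of 0 _ N]) (use that in \<open>auto intro: V_f_low\<close>)
  have gX: "graded ?X"
    unfolding graded_def by (intro allI impI of_nat_mult_low VX)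
  have gX': "graded (\<lambda>N. ?X (Suc N))"
    using gX by (rule graded_Suc)
  have "(1 - e2) * GG l (of_nat (Suc i)) (of_nat c) = graded_sum (\<lambda>N. ?g l N * (1 - eh) + z * of_nat (Suc l) * ?X (Suc N)
      - z * (of_nat (Suc l) * (?X N - ?t * ?g (Suc l) N)))"
    unfolding GG_def by (simp only: mult_graded_sum[OF graded_gt] term_N)
  also have "\<dots> = GG l (of_nat i) (of_nat c) * (1 - eh) + z * of_nat (Suc l) * graded_sum (\<lambda>N. ?X (Suc N))
      - z * of_nat (Suc l) * (graded_sum ?X - ?t * GG (Suc l) (of_nat i) (of_nat c))"
  proof -
    have "graded (\<lambda>N. ?X N - ?t * ?g (Suc l) N)"
      using gX graded_mult_left[OF graded_gt, of ?t "Suc l" "of_nat i" "of_nat c"] by (auto simp: graded_def)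
    note gd = this
    have 1: "graded_sum ?X - ?t * GG (Suc l) (of_nat i) (of_nat c) = graded_sum (\<lambda>N. ?X N - ?t * ?g (Suc l) N)"
      unfolding GG_def mult_graded_sum[OF graded_gt] graded_sum_diff ..
    show ?thesis
      unfolding 1 unfolding GG_def graded_sum_mult[OF graded_gt] mult_graded_sum[OF gX'] mult_graded_sum[OF gd]
        graded_sum_add[symmetric] graded_sum_diff[symmetric] mult.assoc ..
  qed
  also have "graded_sum (\<lambda>N. ?X (Suc N)) = graded_sum ?X"
    by (rule graded_sum_shift[symmetric, OF gX]) simp
  finally show ?thesis
    by (simp only: right_diff_distrib mult.assoc) simp
qed

text \<open>The coefficient of \<open>f1\<^sup>m\<close> in \<open>G\<^sub>1\<^sub>2 (\<Delta> \<otimes> id)(G)\<close>; the shift \<open>D + k\<close> arises from moving \<open>f1\<^sup>k\<close> to the right of \<open>D\<close>.\<close>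

definition LL :: "nat \<Rightarrow> 'a fps \<Rightarrow> 'a fps \<Rightarrow> 'a fps" where
  "LL m D C = (\<Sum>k\<le>m. M2.V k D C * GG (m - k) (D + of_nat k) C)"

lemma LL_of_nat: "LL m (of_nat i) (of_nat c) = (\<Sum>k\<le>m. M2.V k (of_nat i) (of_nat c) * GG (m - k) (of_nat (i + k)) (of_nat c))"
  by (simp add: LL_def)

lemma cg2_of_nat: "M2.cg (fps_const (of_nat i))"
  by (simp add: fps_of_nat M2.cg_of_nat)

text \<open>\<open>?Q\<close> collects the terms in which \<open>s2\<close> passes through \<open>GG\<close>. Its part in \<open>q2\<close> cancels the discrepancy
  between the argument of \<open>M2.A\<close>, which depends on \<open>k\<close>, and the argument of \<open>MH.A\<close>, which does not.\<close>

lemma LL_Suc_C: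
  "LL m (of_nat i) (of_nat (Suc c)) = LL m (of_nat i) (of_nat c) * MH.A (2 * of_nat c - of_nat i - of_nat m + 1)
    - (case m of 0 \<Rightarrow> 0 | Suc l \<Rightarrow> LL l (of_nat i) (of_nat c) * sh)"
proof -
  let ?v = "\<lambda>k. M2.V k (of_nat i) (of_nat c)" and ?g = "\<lambda>l k. GG l (of_nat (i + k)) (of_nat c)"
  let ?y = "2 * of_nat c - of_nat i - of_nat m + 1 :: 'a fps"
  let ?R = "\<lambda>k. case m - k of 0 \<Rightarrow> 0 | Suc l \<Rightarrow> ?g l k * s3"
  let ?Q = "\<lambda>k. case k of 0 \<Rightarrow> 0 | Suc j \<Rightarrow>
    ?v j * (?g (m - Suc j) j * s2 + z * (of_nat (Suc (m - Suc j)) * (?g (Suc (m - Suc j)) j * q2)))"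
  have term_k: "M2.V k (of_nat i) (of_nat (Suc c)) * GG (m - k) (of_nat (i + k)) (of_nat (Suc c))
      = ?v k * ?g (m - k) k * (ah + ?y * (z * qh)) + ?v k * ?g (m - k) k * (of_nat (m - k) * (z * q2)) - ?v k * ?R k - ?Q k"
    if k: "k \<le> m" for k
  proof -
    let ?x = "2 * of_nat c - of_nat i - of_nat k + 1 :: 'a fps"
    let ?G = "GG (m - k) (of_nat (i + k)) (of_nat (Suc c))"
    have V: "M2.V k (of_nat i) (of_nat (Suc c)) = ?v k * M2.A ?x - (case k of 0 \<Rightarrow> 0 | Suc j \<Rightarrow> ?v j * s2)"
      using M2.V_Suc_C[OF _ cg2_of_nat cg2_of_nat, of i c k] mult_of_nat_commute[of i "of_nat c :: 'a"]
      by (cases k) (simp_all add: fps_of_nat add.commute)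
    have x: "?x = ?y + of_nat (m - k)" using k by (simp add: of_nat_diff)
    have "M2.A ?x * ?G = ?G + (a2 - 1) * ?G + ?x * (z * (q2 * ?G))"
      by (simp add: M2.A_def distrib_right left_diff_distrib mult.assoc)
    also have "\<dots> = ?G + ?g (m - k) k * (a2 - 1) + ?x * (z * (?g (m - k) k * q2))"
      by (simp only: GG_weight_C)
    also have "?x * (z * (?g (m - k) k * q2)) = ?g (m - k) k * (?x * (z * q2))"
    proof -
      have "central ?x" by simp
      then show ?thesis
        by (simp only: central_left_comm[OF central_fps_X, of "?g (m - k) k"] central_left_comm[of ?x "?g (m - k) k"])
    qed
    finally have A0: "M2.A ?x * ?G = ?G + ?g (m - k) k * (a2 - 1) + ?g (m - k) k * (?x * (z * q2))" .
    have G: "?G = ?g (m - k) k * (a3 + (?y + (2 * cC2 - cD2)) * (z * q3) - f2 * s3) - ?R k"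
    proof -
      have "2 * of_nat c - of_nat (i + k) - of_nat (m - k) + 1 = ?y" using k by (simp add: of_nat_diff)
      then show ?thesis by (simp only: GG_Suc_C)
    qed
    have "g * (a3 + (y + (2 * cC2 - cD2)) * (z * q3) - f2 * s3) - R + g * (a2 - 1) + g * ((y + n) * (z * q2))
        = g * (ah + y * (z * qh)) + g * (n * (z * q2)) - R" for g y n R
      unfolding hat by (simp add: distrib_left distrib_right right_diff_distrib left_diff_distrib)
    from this[of "?g (m - k) k" ?y "?R k" "of_nat (m - k)"]
    have A: "M2.A ?x * ?G = ?g (m - k) k * (ah + ?y * (z * qh)) + ?g (m - k) k * (of_nat (m - k) * (z * q2)) - ?R k"
      unfolding A0 unfolding G x .
    have "(case k of 0 \<Rightarrow> 0 | Suc j \<Rightarrow> ?v j * s2) * ?G = ?Q k"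
      by (cases k) (simp_all only: nat.case mult_zero_left mult.assoc add_Suc_right GG_weight_CD)
    then show ?thesis
      unfolding V left_diff_distrib mult.assoc A by (simp only: distrib_left right_diff_distrib mult.assoc)
  qed
  have R: "(\<Sum>k\<le>m. ?v k * ?R k) = (case m of 0 \<Rightarrow> 0 | Suc l \<Rightarrow> LL l (of_nat i) (of_nat c) * s3)"
  proof (cases m)
    case (Suc l)
    have "(\<Sum>k\<le>l. ?v k * ?R k) = (\<Sum>k\<le>l. ?v k * ?g (l - k) k) * s3"
      unfolding sum_distrib_right by (rule sum.cong[OF refl]) (simp add: Suc Suc_diff_le mult.assoc)
    then show ?thesis by (simp add: Suc LL_of_nat)
  qed simp
  have Q: "(\<Sum>k\<le>m. ?Q k) = (\<Sum>k\<le>m. ?v k * ?g (m - k) k * (of_nat (m - k) * (z * q2)))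
      + (case m of 0 \<Rightarrow> 0 | Suc l \<Rightarrow> LL l (of_nat i) (of_nat c) * s2)"
  proof (cases m)
    case (Suc l)
    have "(\<Sum>k\<le>m. ?Q k) = (\<Sum>j\<le>l. ?v j * (?g (l - j) j * s2 + z * (of_nat (Suc (l - j)) * (?g (Suc (l - j)) j * q2))))"
      unfolding Suc by (subst sum.atMost_Suc_shift) simp
    also have "\<dots> = (\<Sum>j\<le>l. ?v j * ?g (l - j) j * s2 + ?v j * ?g (m - j) j * (of_nat (m - j) * (z * q2)))"
    proof (rule sum.cong[OF refl])
      fix j assume "j \<in> {..l}"
      then have mj: "Suc (l - j) = m - j" by (simp add: Suc Suc_diff_le)
      have "z * (of_nat (m - j) * (?g (m - j) j * q2)) = ?g (m - j) j * (of_nat (m - j) * (z * q2))"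
        by (simp only: central_left_comm[OF central_fps_X, of "of_nat _"] central_left_comm[OF central_fps_X, of "?g _ _"] of_nat_left_comm[of "?g _ _"])
      then show "?v j * (?g (l - j) j * s2 + z * (of_nat (Suc (l - j)) * (?g (Suc (l - j)) j * q2)))
          = ?v j * ?g (l - j) j * s2 + ?v j * ?g (m - j) j * (of_nat (m - j) * (z * q2))"
        unfolding mj by (simp only: distrib_left mult.assoc)
    qed
    finally show ?thesis
      by (simp add: Suc LL_of_nat sum.distrib sum_distrib_right del: of_nat_Suc)
  qed simp
  have "LL m (of_nat i) (of_nat (Suc c)) = (\<Sum>k\<le>m. ?v k * ?g (m - k) k) * (ah + ?y * (z * qh))
      + (\<Sum>k\<le>m. ?v k * ?g (m - k) k * (of_nat (m - k) * (z * q2))) - (\<Sum>k\<le>m. ?v k * ?R k) - (\<Sum>k\<le>m. ?Q k)"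
    unfolding LL_of_nat sum_distrib_right sum.distrib[symmetric] sum_subtractf[symmetric]
    by (rule sum.cong[OF refl]) (rule term_k, simp)
  then show ?thesis
    unfolding R Q LL_of_nat[of m i c, symmetric] MH.A_def hat(4)
    by (cases m) (simp_all add: distrib_left)
qed

text \<open>The shift \<open>D \<mapsto> D + 1\<close> hits both \<open>V\<^sub>k\<close> and \<open>GG\<close>; after reindexing, the two coefficients of the \<open>k\<close>-th term of
  \<open>LL (m + 1)\<close> add up to a number independent of \<open>k\<close> (\<open>coeff\<close>).\<close>

lemma LL_Suc_D:
  "LL m (of_nat (Suc i)) (of_nat c) = LL m (of_nat i) (of_nat c) * (1 - eh)
    + z * (of_nat (Suc m) * ((2 * of_nat i - of_nat c + of_nat m + 1) * LL (Suc m) (of_nat i) (of_nat c)))"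
proof -
  let ?v = "\<lambda>k. M2.V k (of_nat i) (of_nat c)" and ?g = "\<lambda>l k. GG l (of_nat (i + k)) (of_nat c)"
  let ?b = "\<lambda>k. of_nat (Suc (m - k)) * (2 * of_nat (i + k) - of_nat c + of_nat (m - k) + 1) :: 'a fps"
  let ?d = "\<lambda>k. of_nat k * (2 * of_nat i - of_nat c + of_nat k) :: 'a fps"
  let ?t = "\<lambda>k. ?v k * ?g (Suc m - k) k"
  have term_k: "M2.V k (of_nat (Suc i)) (of_nat c) * GG (m - k) (of_nat (Suc i + k)) (of_nat c)
    = ?v k * ?g (m - k) k * (1 - eh) + z * (?b k * ?t k) + z * (?d (Suc k) * ?t (Suc k))" if k: "k \<le> m" for k
  proof -
    have V: "M2.V k (of_nat (Suc i)) (of_nat c) = ?v k * (1 - e2) + z * (?d (Suc k) * ?v (Suc k))"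
      using M2.V_Suc_D[OF _ cg2_of_nat cg2_of_nat, of i c k] mult_of_nat_commute[of i "of_nat c :: 'a"]
      by (simp add: fps_of_nat add_ac mult.assoc)
    have G: "(1 - e2) * GG (m - k) (of_nat (Suc i + k)) (of_nat c) = ?g (m - k) k * (1 - eh) + z * (?b k * ?g (Suc m - k) k)"
      using GG_Suc_D[of "m - k" "i + k" c] k by (simp only: mult.assoc add_Suc Suc_diff_le)
    have cb: "central (?b k)" by simp
    have "M2.V k (of_nat (Suc i)) (of_nat c) * GG (m - k) (of_nat (Suc i + k)) (of_nat c)
      = ?v k * ((1 - e2) * GG (m - k) (of_nat (Suc i + k)) (of_nat c)) + z * (?d (Suc k) * (?v (Suc k) * GG (m - k) (of_nat (Suc i + k)) (of_nat c)))"
      unfolding V by (simp only: distrib_right mult.assoc)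
    also have "?v (Suc k) * GG (m - k) (of_nat (Suc i + k)) (of_nat c) = ?t (Suc k)"
      by (simp only: diff_Suc_Suc add_Suc add_Suc_right)
    also have "?v k * ((1 - e2) * GG (m - k) (of_nat (Suc i + k)) (of_nat c)) = ?v k * ?g (m - k) k * (1 - eh) + z * (?b k * ?t k)"
    proof -
      have "v * (g * y + z * (x * u)) = v * g * y + z * (x * (v * u))" if "central x" for v g y x u
        by (simp only: distrib_left mult.assoc central_left_comm[OF central_fps_X, of v] central_left_comm[OF that, of v])
      from this[OF cb] show ?thesis unfolding G .
    qed
    finally show ?thesis .
  qed
  have shift: "(\<Sum>k\<le>m. ?d (Suc k) * ?t (Suc k)) = (\<Sum>k\<le>Suc m. ?d k * ?t k)"
    by (subst sum.atMost_Suc_shift) simp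
  have coeff: "(if k \<le> m then ?b k else 0) + ?d k = of_nat (Suc m) * (2 * of_nat i - of_nat c + of_nat m + 1)"
    if k: "k \<le> Suc m" for k
  proof -
    obtain r where r: "Suc m = k + r" using k nat_le_iff_add by blast
    have com: "of_nat k * x = x * of_nat k" "of_nat r * x = x * of_nat r" for x :: "'a fps"
      by (simp_all add: mult_of_nat_commute)
    have b: "(if k \<le> m then ?b k else 0) = of_nat r * (2 * of_nat i + 2 * of_nat k - of_nat c + of_nat r)"
    proof (cases "k \<le> m")
      case True
      obtain t where t: "r = Suc t" "m - k = t" using True r by (cases r) auto
      show ?thesis using True by (simp add: t mult_2 add_ac)
    next
      case False
      then have "r = 0" using r by simp
      then show ?thesis using False by simp
    qed
    have m1: "of_nat m + 1 = (of_nat k + of_nat r :: 'a fps)"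
      using r by (metis of_nat_Suc of_nat_add add.commute)
    then have m2: "2 * of_nat i - of_nat c + of_nat m + 1 = 2 * of_nat i - of_nat c + (of_nat k + of_nat r :: 'a fps)"
      by (simp only: add.assoc)
    have kr: "of_nat r * of_nat k = (of_nat k * of_nat r :: 'a fps)"
      by (rule mult_of_nat_commute)
    show ?thesis
      unfolding b unfolding m2 r of_nat_add
      by (simp add: distrib_left distrib_right right_diff_distrib left_diff_distrib mult_2 kr)
  qed
  have "LL m (of_nat (Suc i)) (of_nat c) = (\<Sum>k\<le>m. ?v k * ?g (m - k) k * (1 - eh) + z * (?b k * ?t k) + z * (?d (Suc k) * ?t (Suc k)))"
    unfolding LL_of_nat by (rule sum.cong[OF refl]) (rule term_k, simp)
  also have "\<dots> = (\<Sum>k\<le>m. ?v k * ?g (m - k) k) * (1 - eh) + z * ((\<Sum>k\<le>m. ?b k * ?t k) + (\<Sum>k\<le>m. ?d (Suc k) * ?t (Suc k)))"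
    by (simp only: sum.distrib sum_distrib_left[symmetric] sum_distrib_right[symmetric] distrib_left add.assoc)
  also have "(\<Sum>k\<le>m. ?b k * ?t k) = (\<Sum>k\<le>Suc m. (if k \<le> m then ?b k else 0) * ?t k)"
    by simp
  also have "\<dots> + (\<Sum>k\<le>m. ?d (Suc k) * ?t (Suc k)) = (\<Sum>k\<le>Suc m. ((if k \<le> m then ?b k else 0) + ?d k) * ?t k)"
    unfolding shift by (simp only: sum.distrib[symmetric] distrib_right)
  also have "\<dots> = (\<Sum>k\<le>Suc m. of_nat (Suc m) * (2 * of_nat i - of_nat c + of_nat m + 1) * ?t k)"
    by (rule sum.cong[OF refl], subst coeff) auto
  also have "\<dots> = of_nat (Suc m) * ((2 * of_nat i - of_nat c + of_nat m + 1) * LL (Suc m) (of_nat i) (of_nat c))"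
    unfolding LL_of_nat by (simp only: sum_distrib_left mult.assoc)
  finally show ?thesis unfolding LL_of_nat[of m i c] .
qed

text \<open>For \<open>i = c = m = 0\<close> both sides are \<open>GG 0 0 0\<close>, and the recursions do the rest.\<close>

lemma LL_eq_nat:
  assumes "c \<ge> i + m"
  shows "LL m (of_nat i) (of_nat c) = GG 0 0 0 * MH.V m (of_nat i) (of_nat c)"
proof -
  let ?\<Omega> = "\<lambda>m i c. LL m (of_nat i) (of_nat c) - GG 0 0 0 * MH.V m (of_nat i) (of_nat c)"
  have VC: "MH.V m (of_nat i) (of_nat (Suc c)) = MH.V m (of_nat i) (of_nat c) * MH.A (2 * of_nat c - of_nat i - of_nat m + 1)
     - (case m of 0 \<Rightarrow> 0 | Suc l \<Rightarrow> MH.V l (of_nat i) (of_nat c) * sh)" for m i c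
    using MH.V_Suc_C[of "of_nat i" "of_nat c" m] MH.cg_of_nat mult_of_nat_commute[of i "of_nat c :: 'a"]
    by (simp only: fps_of_nat of_nat_Suc add.commute)
  have VD: "MH.V m (of_nat (Suc i)) (of_nat c) = MH.V m (of_nat i) (of_nat c) * (1 - eh)
     + z * (of_nat (Suc m) * ((2 * of_nat i - of_nat c + of_nat m + 1) * MH.V (Suc m) (of_nat i) (of_nat c)))" for m i c
    using MH.V_Suc_D[of "of_nat i" "of_nat c" m] MH.cg_of_nat mult_of_nat_commute[of i "of_nat c :: 'a"]
    by (simp only: fps_of_nat of_nat_Suc add.commute)
  have "?\<Omega> m i c = 0"
  proof (rule MH.family_zero[where L = ?\<Omega>])
    fix m i c :: nat
    show "?\<Omega> m i (Suc c) = ?\<Omega> m i c * MH.A (2 * of_nat c - of_nat i - of_nat m + 1)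
        - (case m of 0 \<Rightarrow> 0 | Suc l \<Rightarrow> ?\<Omega> l i c * sh)"
      unfolding LL_Suc_C VC
      by (cases m) (simp_all only: nat.case left_diff_distrib right_diff_distrib mult.assoc diff_0_right, simp)
    have swap: "g * (z * (k * (x * v))) = z * (k * (x * (g * v)))" if "central k" "central x" for g k x v :: "'a fps"
      by (simp only: central_left_comm[OF central_fps_X, of g] central_left_comm[OF that(1), of g] central_left_comm[OF that(2), of g])
    show "?\<Omega> m (Suc i) c = ?\<Omega> m i c * (1 - eh)
        + z * (of_nat (Suc m) * ((2 * of_nat i - of_nat c + of_nat m + 1) * ?\<Omega> (Suc m) i c))"
    proof -
      have "GG 0 0 0 * (z * (of_nat (Suc m) * ((2 * of_nat i - of_nat c + of_nat m + 1) * MH.V (Suc m) (of_nat i) (of_nat c))))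
          = z * (of_nat (Suc m) * ((2 * of_nat i - of_nat c + of_nat m + 1) * (GG 0 0 0 * MH.V (Suc m) (of_nat i) (of_nat c))))"
        by (rule swap) simp_all
      moreover have "l1 + p - (g * v + p') = (l1 - g * v) + (p - p')" for l1 p g v p' :: "'a fps"
        by simp
      ultimately show ?thesis
        unfolding LL_Suc_D VD distrib_left[of "GG 0 0 0"]
        by (simp only: left_diff_distrib[of _ _ "1 - eh"] right_diff_distrib[of _ "LL (Suc m) _ _"] right_diff_distrib[of _ "_ * LL (Suc m) _ _"]
            right_diff_distrib[of _ "_ * (_ * LL (Suc m) _ _)"] mult.assoc[of "GG 0 0 0"])
    qed
    show "?\<Omega> 0 0 0 = 0"
      using M2.V_of_nat[of 0 0 0] MH.V_of_nat[of 0 0 0] by (simp add: LL_def M2.Vn_def MH.Vn_def)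
  qed fact
  then show ?thesis by simp
qed

lemma polyfam_GG:
  assumes "M2.polyfam D1 C1 \<Phi> x" "M2.polyfam D1 C1 \<Psi> y"
  shows "M2.polyfam D1 C1 (\<lambda>i c. GG l (\<Phi> i c) (\<Psi> i c)) (GG l x y)"
  unfolding GG_def
proof (rule M2.polyfam_graded_sum)
  fix N
  have "M2.polyfam D1 C1 (\<lambda>_ _. cD2) cD2" "M2.polyfam D1 C1 (\<lambda>_ _. cC2) cC2" "M2.polyfam D1 C1 (\<lambda>_ _. f2) f2"
    using slots12 by (simp_all add: M2.polyfam_const fps_const_mult)
  then show "M2.polyfam D1 C1 (\<lambda>i c. gt l (\<Phi> i c) (\<Psi> i c) N) (gt l x y N)"
    unfolding gt_def by (intro M3.polyfam_intros M3.polyfam_V cg3 assms)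
qed

lemma LL_eq: "LL m cD1 cC1 = GG 0 0 0 * MH.V m cD1 cC1"
proof (rule M2.polyfam_unique)
  show "M2.polyfam D1 C1 (\<lambda>i c. LL m (of_nat i) (of_nat c)) (LL m cD1 cC1)"
    unfolding LL_def
    by (intro M2.polyfam_sum M2.polyfam_intros M2.polyfam_V polyfam_GG M2.polyfam_D M2.polyfam_C cg2)
  show "M2.polyfam D1 C1 (\<lambda>i c. GG 0 0 0 * MH.V m (of_nat i) (of_nat c)) (GG 0 0 0 * MH.V m cD1 cC1)"
    by (intro M2.polyfam_intros MH.polyfam_V polyfam_GG M2.polyfam_D M2.polyfam_C cgH)
  show "D1 * C1 = C1 * D1" using slot1(1) by simp
qed (rule LL_eq_nat)

lemma f1_power_GG: "f1 ^ k * GG l cD1 cC1 = GG l (cD1 + of_nat k) cC1 * f1 ^ k"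
proof -
  have com: "x * f1 = f1 * x \<Longrightarrow> f1 ^ k * x = x * f1 ^ k" for x
    by (rule power_commuting_commutes) simp
  have "f1 ^ k * cD1 = (cD1 + of_nat k) * f1 ^ k"
  proof (induction k)
    case (Suc k)
    have "f1 ^ Suc k * cD1 = f1 * (cD1 + of_nat k) * f1 ^ k" by (simp add: Suc mult.assoc)
    also have "f1 * (cD1 + of_nat k) = (cD1 + of_nat (Suc k)) * f1"
      by (simp add: distrib_left distrib_right slot1 mult_of_nat_commute)
    finally show ?case by (simp add: mult.assoc)
  qed simp
  moreover have "M3.cg (f1 ^ k)"
    using cg3(3) com by (simp add: M3.cg_def)
  ultimately have "M2.intertw (f1 ^ k) (gt l cD1 cC1 N) (gt l (cD1 + of_nat k) cC1 N)" for N
    unfolding gt_def using slots12 slot1(3) com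
    by (intro M2.intertw_mult M2.intertw_of_nat M3.intertw_V M2.intertw_power M2.intertw_add)
      (simp_all add: M2.intertw_def distrib_left distrib_right)
  then show ?thesis
    unfolding GG_def using M2.intertw_graded_sum[OF graded_gt graded_gt] by (simp add: M2.intertw_def)
qed

lemma twist_total: "M3.T (cD1 + cD2) (cC1 + cC2) (f1 + f2) = graded_sum (\<lambda>l. GG l cD1 cC1 * f1 ^ l)"
proof -
  have cg_tot: "M3.cg (f1 + f2)" "M3.cg (cD1 + cD2)" "M3.cg (cC1 + cC2)"
    by (intro M3.cg_add cg3)+
  have "M3.T (cD1 + cD2) (cC1 + cC2) (f1 + f2) = graded_sum (\<lambda>N. M3.V N (cD2 + cD1) (cC2 + cC1) * (f1 + f2) ^ N)"
    unfolding add.commute[of cD1] add.commute[of cC1]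
    by (rule M3.T_eq) (use cg_tot slot1 slot2 slots12 in \<open>simp_all add: algebra_simps fps_const_mult\<close>)
  also have "\<dots> = graded_sum (\<lambda>N. \<Sum>l\<le>N. gt l cD1 cC1 N * f1 ^ l)"
  proof (rule graded_sum_cong)
    fix N
    have "(f1 + f2) ^ N = (\<Sum>l\<le>N. of_nat (N choose l) * (f1 ^ l * f2 ^ (N - l)))"
    proof (rule binomial_ordered)
      fix m
      have "(f1 + f2) ^ m * f2 = f2 * (f1 + f2) ^ m"
        by (rule power_commuting_commutes) (simp add: distrib_left distrib_right slots12)
      then show "(f1 + f2) ^ Suc m = f1 * (f1 + f2) ^ m + (f1 + f2) ^ m * f2"
        by (simp add: distrib_right)
    qed simp
    moreover have "f1 ^ l * f2 ^ n = f2 ^ n * f1 ^ l" for l n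
      by (intro power_commuting_commutes power_commuting_commutes[symmetric] slots12) (simp add: slots12 power_commuting_commutes)
    ultimately show "M3.V N (cD2 + cD1) (cC2 + cC1) * (f1 + f2) ^ N = (\<Sum>l\<le>N. gt l cD1 cC1 N * f1 ^ l)"
      by (simp only: gt_def sum_distrib_left of_nat_left_comm[of "M3.V _ _ _"] mult.assoc)
  qed
  also have "graded_sum (\<lambda>N. \<Sum>l\<le>N. gt l cD1 cC1 N * f1 ^ l) = graded_sum (\<lambda>l. GG l cD1 cC1 * f1 ^ l)"
  proof (rule fps_ext)
    fix n
    have "graded_sum (\<lambda>N. \<Sum>l\<le>N. gt l cD1 cC1 N * f1 ^ l) $ n = (\<Sum>N\<le>n. \<Sum>l\<le>n. (gt l cD1 cC1 N * f1 ^ l) $ n)"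
      unfolding graded_sum_nth fps_sum_nth
      by (intro sum.cong refl sum.mono_neutral_left) (auto simp: gt_low)
    also have "\<dots> = (\<Sum>l\<le>n. \<Sum>N\<le>n. (gt l cD1 cC1 N * f1 ^ l) $ n)"
      by (rule sum.swap)
    finally show "graded_sum (\<lambda>N. \<Sum>l\<le>N. gt l cD1 cC1 N * f1 ^ l) $ n = graded_sum (\<lambda>l. GG l cD1 cC1 * f1 ^ l) $ n"
      by (simp add: GG_def graded_sum_mult[OF graded_gt] graded_sum_nth)
  qed
  finally show ?thesis .
qed

theorem cocycle:
  "M2.T cD1 cC1 f1 * M3.T (cD1 + cD2) (cC1 + cC2) (f1 + f2) = M3.T cD2 cC2 f2 * MH.T cD1 cC1 f1"
proof -
  have T2: "M2.T cD1 cC1 f1 = graded_sum (\<lambda>k. M2.V k cD1 cC1 * f1 ^ k)"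
    by (rule M2.T_eq) (use cg2 slot1 in \<open>simp_all add: fps_const_mult\<close>)
  have TH: "MH.T cD1 cC1 f1 = graded_sum (\<lambda>k. MH.V k cD1 cC1 * f1 ^ k)"
    by (rule MH.T_eq) (use cgH slot1 in \<open>simp_all add: fps_const_mult\<close>)
  have T3: "M3.T cD2 cC2 f2 = GG 0 0 0"
    unfolding GG_def gt_def
    by (subst M3.T_eq) (use cg3 slot2 in \<open>simp_all add: fps_const_mult\<close>)
  have g2: "graded (\<lambda>k. M2.V k cD1 cC1 * f1 ^ k)" and gH: "graded (\<lambda>k. MH.V k cD1 cC1 * f1 ^ k)"
    by (auto intro!: graded_mult simp: M2.V_low MH.V_low)
  have GG_low: "GG l D C $ n = 0" if "n < l" for l n D C
    using that by (simp add: GG_def graded_sum_nth gt_low)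
  have gG: "graded (\<lambda>l. GG l cD1 cC1 * f1 ^ l)"
    by (auto intro!: graded_mult simp: GG_low)
  have "M2.T cD1 cC1 f1 * M3.T (cD1 + cD2) (cC1 + cC2) (f1 + f2)
      = graded_sum (\<lambda>m. \<Sum>k\<le>m. M2.V k cD1 cC1 * f1 ^ k * (GG (m - k) cD1 cC1 * f1 ^ (m - k)))"
    unfolding T2 twist_total by (rule graded_sum_times[OF g2 gG])
  also have "\<dots> = graded_sum (\<lambda>m. LL m cD1 cC1 * f1 ^ m)"
  proof (rule graded_sum_cong)
    fix m
    have "M2.V k cD1 cC1 * f1 ^ k * (GG (m - k) cD1 cC1 * f1 ^ (m - k))
        = M2.V k cD1 cC1 * GG (m - k) (cD1 + of_nat k) cC1 * f1 ^ m" if "k \<le> m" for k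
    proof -
      have "M2.V k cD1 cC1 * f1 ^ k * (GG (m - k) cD1 cC1 * f1 ^ (m - k))
        = M2.V k cD1 cC1 * (f1 ^ k * GG (m - k) cD1 cC1) * f1 ^ (m - k)"
        by (simp only: mult.assoc)
      also have "\<dots> = M2.V k cD1 cC1 * GG (m - k) (cD1 + of_nat k) cC1 * (f1 ^ k * f1 ^ (m - k))"
        by (simp only: f1_power_GG mult.assoc)
      finally show ?thesis using that by (simp flip: power_add)
    qed
    then show "(\<Sum>k\<le>m. M2.V k cD1 cC1 * f1 ^ k * (GG (m - k) cD1 cC1 * f1 ^ (m - k))) = LL m cD1 cC1 * f1 ^ m"
      by (simp add: LL_def sum_distrib_right)
  qed
  also have "\<dots> = M3.T cD2 cC2 f2 * MH.T cD1 cC1 f1"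
    unfolding LL_eq T3 TH mult_graded_sum[OF gH] by (simp only: mult.assoc)
  finally show ?thesis .
qed

end

section \<open>Algebra homomorphisms and power series\<close>

lemma fps_map_nth: "fps_map h x $ n = h (x $ n)"
  by (simp add: fps_map_def)

lemma fps_map_commute:
  assumes "\<And>x y. g y * h x = h x * (g y :: 'c::ring_1)"
  shows "fps_map g b * fps_map h a = fps_map h a * fps_map g b"
proof (rule fps_ext)
  fix n
  have "(fps_map g b * fps_map h a) $ n = (\<Sum>i=0..n. h (a $ (n - i)) * g (b $ i))"
    by (simp add: fps_mult_nth fps_map_nth assms)
  also have "\<dots> = (\<Sum>i=0..n. h (a $ i) * g (b $ (n - i)))"
    by (rule sum.reindex_bij_witness[of _ "\<lambda>i. n - i" "\<lambda>i. n - i"]) auto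
  finally show "(fps_map g b * fps_map h a) $ n = (fps_map h a * fps_map g b) $ n"
    by (simp add: fps_mult_nth fps_map_nth)
qed

locale algebra_hom = A: char0_algebra s + B: char0_algebra t
  for s :: "'k::field_char_0 \<Rightarrow> 'a::ring_1 \<Rightarrow> 'a" and t :: "'k \<Rightarrow> 'b::ring_1 \<Rightarrow> 'b" +
  fixes h :: "'a \<Rightarrow> 'b"
  assumes hom_add: "h (x + y) = h x + h y" and hom_mult: "h (x * y) = h x * h y"
    and hom_1: "h 1 = 1" and hom_scale: "h (s c x) = t c (h x)"
begin

lemma hom_0: "h 0 = 0"
  using hom_add[of 0 0] by simp

lemma hom_diff: "h (x - y) = h x - h y"
  using hom_add[of "x - y" y] by (simp add: algebra_simps)

lemma hom_sum: "h (\<Sum>i\<in>I. f i) = (\<Sum>i\<in>I. h (f i))"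
  by (induction I rule: infinite_finite_induct) (simp_all add: hom_0 hom_add)

lemma map_add: "fps_map h (x + y) = fps_map h x + fps_map h y"
  and map_diff: "fps_map h (x - y) = fps_map h x - fps_map h y"
  and map_mult: "fps_map h (x * y) = fps_map h x * fps_map h y"
  and map_0: "fps_map h 0 = 0" and map_1: "fps_map h 1 = 1" and map_X: "fps_map h fps_X = fps_X"
  and map_const: "fps_map h (fps_const c) = fps_const (h c)"
  by (simp_all add: fps_eq_iff fps_map_nth hom_add hom_diff hom_0 hom_1 fps_mult_nth hom_sum hom_mult fps_X_def)

lemma map_minus: "fps_map h (- x) = - fps_map h x"
  using map_diff[of 0 x] by (simp add: map_0)

lemma map_power: "fps_map h (x ^ n) = fps_map h x ^ n"
  by (induction n) (simp_all add: map_1 map_mult)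

lemma map_of_nat: "fps_map h (of_nat n) = of_nat n"
  by (induction n) (simp_all add: map_0 map_1 map_add)

lemma map_numeral: "fps_map h (numeral v) = numeral v"
  using map_of_nat[of "numeral v"] by simp

lemma map_subst: "fps_map h (A.Sub a x) = B.Sub a (fps_map h x)"
  by (simp add: fps_eq_iff fps_map_nth fps_subst_def hom_sum hom_scale flip: map_power)

lemma map_Exp: "fps_map h (A.Exp x) = B.Exp (fps_map h x)"
  by (simp add: fps_Exp_def map_subst)

lemma map_Ln: "fps_map h (A.Lnf x) = B.Lnf (fps_map h x)"
  by (simp add: fps_Ln_def map_subst map_diff map_1)

lemmas map_simps = map_add map_diff map_mult map_0 map_1 map_X map_const map_minus map_power map_of_nat map_numeral map_Exp map_Ln

lemma map_quad_rels:
  assumes "quad_rels a e q u w"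
  shows "quad_rels (fps_map h a) (fps_map h e) (fps_map h q) (fps_map h u) (fps_map h w)"
  using assms unfolding quad_rels_def
  by (auto simp: fps_map_nth hom_1 hom_0 dest!: arg_cong[where f = "fps_map h"])
    (simp_all add: map_simps)

end

interpretation U: char0_algebra "usl4_scale :: 'k::field_char_0 \<Rightarrow> 'k usl4 \<Rightarrow> 'k usl4"
  by (intro char0_algebra.intro usl4.assoc_algebra_axioms)

interpretation TT: char0_algebra "tensor_scale :: 'k::field_char_0 \<Rightarrow> ('k, 'n::finite) usl4_tensor \<Rightarrow> _"
  by (intro char0_algebra.intro tensor.assoc_algebra_axioms)

text \<open>Pure tensors span the tensor square.\<close>

lemma tensor2_hom:
  assumes add: "\<And>t u. h (t + u) = h t + h u" and scale: "\<And>c t. h (tensor_scale c t) = s c (h t)"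
    and "assoc_algebra s"
    and mult: "\<And>a b c d. h ((a * c) \<otimes> (b * d)) = h (a \<otimes> b) * h (c \<otimes> d)"
  shows "h (t * u) = h t * (h u :: 'b::ring_1)"
proof -
  interpret S: assoc_algebra s by fact
  show ?thesis
  proof (induction t rule: tensor_induct)
    case (scale c v)
    show ?case
    proof (induction u rule: tensor_induct)
      case (scale d w)
      show ?case
        by (simp add: tensor2_eq tensor2_mult tensor.scale_mult_left tensor.scale_mult_right
            S.scale_mult_left S.scale_mult_right assms(2) mult)
    qed (simp add: distrib_left add)
  qed (simp add: distrib_right add)
qed

lemma tensor_append_mult: "tensor_append (t * u) (c * d) = tensor_append t c * tensor_append u d"
proof (induction t rule: tensor_induct)
  case (scale x v)
  show ?case
  proof (induction u rule: tensor_induct)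
    case (scale y w)
    show ?case
      by (simp add: tensor2_eq tensor2_mult tensor3_mult tensor.scale_mult_left tensor.scale_mult_right tensor_append_simps)
  qed (simp add: distrib_left tensor_append_simps)
qed (simp add: distrib_right tensor_append_simps)

lemma tensor_prepend_mult: "tensor_prepend (c * d) (t * u) = tensor_prepend c t * tensor_prepend d u"
proof (induction t rule: tensor_induct)
  case (scale x v)
  show ?case
  proof (induction u rule: tensor_induct)
    case (scale y w)
    show ?case
      by (simp add: tensor2_eq tensor2_mult tensor3_mult tensor.scale_mult_left tensor.scale_mult_right tensor_prepend_simps)
  qed (simp add: distrib_left tensor_prepend_simps)
qed (simp add: distrib_right tensor_prepend_simps)

lemmas lift_simps =
  tensor.tensor_lift_add[OF multilinear_comult_id] tensor.tensor_lift_scale[OF multilinear_comult_id]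
  tensor.tensor_lift_add[OF multilinear_id_comult] tensor.tensor_lift_scale[OF multilinear_id_comult]
  usl4.tensor_lift_add[OF multilinear_counit_id] usl4.tensor_lift_scale[OF multilinear_counit_id]
  usl4.tensor_lift_add[OF multilinear_id_counit] usl4.tensor_lift_scale[OF multilinear_id_counit]
  tensor.tensor_lift_add[OF multilinear_flip] tensor.tensor_lift_scale[OF multilinear_flip]

lemma tensor3_one': "tensor_append 1 1 = 1" "tensor_prepend 1 1 = 1"
  by (simp_all add: tensor2_one[symmetric] tensor_append_simps tensor_prepend_simps tensor3_one[symmetric])

interpretation I1: algebra_hom usl4_scale tensor_scale "\<lambda>a :: 'k::field_char_0 usl4. a \<otimes> 1"
  by unfold_locales (simp_all add: tensor2_add_left tensor2_scale_left tensor2_mult tensor2_one)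

interpretation I2: algebra_hom usl4_scale tensor_scale "\<lambda>a :: 'k::field_char_0 usl4. 1 \<otimes> a"
  by unfold_locales (simp_all add: tensor2_add_right tensor2_scale_right tensor2_mult tensor2_one)

interpretation L12: algebra_hom tensor_scale tensor_scale "leg12 :: ('k::field_char_0, 2) usl4_tensor \<Rightarrow> _"
  by unfold_locales (simp_all add: leg12_def tensor_append_simps tensor_append_mult[where c = 1 and d = 1, simplified] tensor3_one')

interpretation L23: algebra_hom tensor_scale tensor_scale "leg23 :: ('k::field_char_0, 2) usl4_tensor \<Rightarrow> _"
  by unfold_locales (simp_all add: leg23_def tensor_prepend_simps tensor_prepend_mult[where c = 1 and d = 1, simplified] tensor3_one')

interpretation J3: algebra_hom usl4_scale tensor_scale "\<lambda>a :: 'k::field_char_0 usl4. tensor3 1 1 a"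
  by unfold_locales (simp_all add: tensor3_add tensor3_scale tensor3_mult tensor3_one)

interpretation CM: algebra_hom usl4_scale tensor_scale "usl4_comult :: 'k::field_char_0 usl4 \<Rightarrow> _"
  by unfold_locales (simp_all add: usl4_comult_simps)

interpretation CI: algebra_hom tensor_scale tensor_scale "comult_id :: ('k::field_char_0, 2) usl4_tensor \<Rightarrow> _"
proof unfold_locales
  fix t u :: "('k, 2) usl4_tensor" and c :: 'k
  show add: "comult_id (t + u) = comult_id t + comult_id u" for t u :: "('k, 2) usl4_tensor"
    by (simp add: comult_id_def lift_simps)
  show scale: "comult_id (tensor_scale c t) = tensor_scale c (comult_id t)" for c and t :: "('k, 2) usl4_tensor"
    by (simp add: comult_id_def lift_simps)
  show "comult_id (t * u) = comult_id t * comult_id u"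
    by (rule tensor2_hom[OF add scale tensor.assoc_algebra_axioms])
      (simp add: structure_maps_tensor2 usl4_comult_simps tensor_append_mult)
  show "comult_id 1 = (1 :: ('k, 3) usl4_tensor)"
    using structure_maps_tensor2(2)[of "1 :: 'k usl4" 1] by (simp add: tensor2_one usl4_comult_simps tensor3_one')
qed

interpretation IC: algebra_hom tensor_scale tensor_scale "id_comult :: ('k::field_char_0, 2) usl4_tensor \<Rightarrow> _"
proof unfold_locales
  fix t u :: "('k, 2) usl4_tensor" and c :: 'k
  show add: "id_comult (t + u) = id_comult t + id_comult u" for t u :: "('k, 2) usl4_tensor"
    by (simp add: id_comult_def lift_simps)
  show scale: "id_comult (tensor_scale c t) = tensor_scale c (id_comult t)" for c and t :: "('k, 2) usl4_tensor"
    by (simp add: id_comult_def lift_simps)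
  show "id_comult (t * u) = id_comult t * id_comult u"
    by (rule tensor2_hom[OF add scale tensor.assoc_algebra_axioms])
      (simp add: structure_maps_tensor2 usl4_comult_simps tensor_prepend_mult)
  show "id_comult 1 = (1 :: ('k, 3) usl4_tensor)"
    using structure_maps_tensor2(3)[of "1 :: 'k usl4" 1] by (simp add: tensor2_one usl4_comult_simps tensor3_one')
qed

interpretation EI: algebra_hom tensor_scale usl4_scale "counit_id :: ('k::field_char_0, 2) usl4_tensor \<Rightarrow> _"
proof unfold_locales
  fix t u :: "('k, 2) usl4_tensor" and c :: 'k
  show add: "counit_id (t + u) = counit_id t + counit_id u" for t u :: "('k, 2) usl4_tensor"
    by (simp add: counit_id_def lift_simps)
  show scale: "counit_id (tensor_scale c t) = usl4_scale c (counit_id t)" for c and t :: "('k, 2) usl4_tensor"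
    by (simp add: counit_id_def lift_simps)
  show "counit_id (t * u) = counit_id t * counit_id u"
    by (rule tensor2_hom[OF add scale usl4.assoc_algebra_axioms])
      (simp add: structure_maps_tensor2 usl4_counit_simps usl4.scale_mult_left usl4.scale_mult_right mult.commute)
  show "counit_id 1 = (1 :: 'k usl4)"
    using structure_maps_tensor2(4)[of "1 :: 'k usl4" 1] by (simp add: tensor2_one usl4_counit_simps)
qed

interpretation IE: algebra_hom tensor_scale usl4_scale "id_counit :: ('k::field_char_0, 2) usl4_tensor \<Rightarrow> _"
proof unfold_locales
  fix t u :: "('k, 2) usl4_tensor" and c :: 'k
  show add: "id_counit (t + u) = id_counit t + id_counit u" for t u :: "('k, 2) usl4_tensor"
    by (simp add: id_counit_def lift_simps)
  show scale: "id_counit (tensor_scale c t) = usl4_scale c (id_counit t)" for c and t :: "('k, 2) usl4_tensor"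
    by (simp add: id_counit_def lift_simps)
  show "id_counit (t * u) = id_counit t * id_counit u"
    by (rule tensor2_hom[OF add scale usl4.assoc_algebra_axioms])
      (simp add: structure_maps_tensor2 usl4_counit_simps usl4.scale_mult_left usl4.scale_mult_right mult.commute)
  show "id_counit 1 = (1 :: 'k usl4)"
    using structure_maps_tensor2(5)[of "1 :: 'k usl4" 1] by (simp add: tensor2_one usl4_counit_simps)
qed

section \<open>Commutation relations in \<open>U(sl\<^sub>4)\<close>\<close>

lemma index4_distinct: "(1::4) \<noteq> 2" "(1::4) \<noteq> 3" "(1::4) \<noteq> 4" "(2::4) \<noteq> 3" "(2::4) \<noteq> 4" "(3::4) \<noteq> 4"
  "(2::4) \<noteq> 1" "(3::4) \<noteq> 1" "(4::4) \<noteq> 1" "(3::4) \<noteq> 2" "(4::4) \<noteq> 2" "(4::4) \<noteq> 3"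
  by simp_all

lemma matrix_unit_mult: "matrix_unit i j ** matrix_unit k l = (if j = k then matrix_unit i l else 0)"
  by (auto simp: vec_eq_iff matrix_matrix_mult_def matrix_unit_def if_distrib[of "\<lambda>x. x * _"] sum.delta cong: if_cong)

lemma gen_bracket:
  assumes "trace A = 0" "trace B = 0"
  shows "usl4_gen (Abs_sl4 A) * usl4_gen (Abs_sl4 B) - usl4_gen (Abs_sl4 B) * usl4_gen (Abs_sl4 A)
    = usl4_gen (Abs_sl4 (A ** B - B ** A))"
proof -
  have "sl4_bracket (Abs_sl4 A) (Abs_sl4 B) = Abs_sl4 (A ** B - B ** A)"
    using assms by (simp add: sl4_bracket_def Abs_sl4_inverse)
  moreover have "usl4_gen (sl4_bracket x y) = usl4_gen x * usl4_gen y - usl4_gen y * usl4_gen x" for x y :: "'a sl4"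
    using lie_map_usl4_gen unfolding lie_map_def by blast
  ultimately show ?thesis by metis
qed

lemma usl4_gen_add: "usl4_gen (x + y) = usl4_gen x + usl4_gen y"
  and usl4_gen_scale: "usl4_gen (sl4_scale c x) = usl4_scale c (usl4_gen x)"
  using lie_map_usl4_gen unfolding lie_map_def by blast+

lemma usl4_gen_0: "usl4_gen 0 = 0"
  using usl4_gen_add[of 0 0] by simp

lemma usl4_gen_minus: "usl4_gen (- x) = - usl4_gen x"
  using minus_unique[of "usl4_gen x" "usl4_gen (- x)"] usl4_gen_add[of x "- x"] by (simp add: usl4_gen_0)

lemma Abs_sl4_0: "Abs_sl4 0 = 0"
  by (simp add: zero_sl4_def)

lemma gen_Abs_add: "trace A = 0 \<Longrightarrow> trace B = 0 \<Longrightarrow> usl4_gen (Abs_sl4 (A + B)) = usl4_gen (Abs_sl4 A) + usl4_gen (Abs_sl4 B)"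
  by (simp add: usl4_gen_add[symmetric] plus_sl4_def Abs_sl4_inverse)

lemma gen_Abs_minus: "trace A = 0 \<Longrightarrow> usl4_gen (Abs_sl4 (- A)) = - usl4_gen (Abs_sl4 A)"
  by (simp add: usl4_gen_minus[symmetric] uminus_sl4_def Abs_sl4_inverse)

lemma gen_Abs_scale: "trace A = 0 \<Longrightarrow> usl4_gen (Abs_sl4 (matrix_scale c A)) = usl4_scale c (usl4_gen (Abs_sl4 A))"
  by (simp add: usl4_gen_scale[symmetric] sl4_scale_def Abs_sl4_inverse)

lemma trace_matrix_unit: "i \<noteq> j \<Longrightarrow> trace (matrix_unit i j) = 0"
  by (auto simp: trace_def matrix_unit_def intro!: sum.neutral)

lemma trace_D_matrix: "p \<in> {1, 2, 3} \<Longrightarrow> trace (D_matrix p :: 'k::field_char_0 ^ 4 ^ 4) = 0"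
  by (metis Rep_D Rep_sl4 mem_Collect_eq)

lemma E_bracket:
  assumes "i \<noteq> j" "k \<noteq> l" "j \<noteq> k \<or> i \<noteq> l"
  shows "E\<^sub>U i j * E\<^sub>U k l = E\<^sub>U k l * E\<^sub>U i j + (if j = k then E\<^sub>U i l else 0) - (if i = l then E\<^sub>U k j else 0)"
proof -
  have "E\<^sub>U i j * E\<^sub>U k l - E\<^sub>U k l * E\<^sub>U i j
      = usl4_gen (Abs_sl4 ((if j = k then matrix_unit i l else 0) - (if l = i then matrix_unit k j else 0)))"
    unfolding E\<^sub>U_def using assms by (subst gen_bracket) (simp_all add: trace_matrix_unit matrix_unit_mult)
  also have "\<dots> = (if j = k then E\<^sub>U i l else 0) - (if i = l then E\<^sub>U k j else 0)"
    using assms by (auto simp: E\<^sub>U_def Abs_sl4_0 usl4_gen_0 gen_Abs_minus trace_matrix_unit)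
  finally show ?thesis by (simp add: algebra_simps)
qed

definition diag_matrix :: "(4 \<Rightarrow> 'k::field) \<Rightarrow> 'k ^ 4 ^ 4" where
  "diag_matrix f = vec_lambda (\<lambda>a. vec_lambda (\<lambda>b. if a = b then f a else 0))"

lemma diag_matrix_mult:
  "diag_matrix f ** diag_matrix g = diag_matrix (\<lambda>a. f a * g a)"
  "diag_matrix f ** matrix_unit i j = matrix_scale (f i) (matrix_unit i j)"
  "matrix_unit i j ** diag_matrix f = matrix_scale (f j) (matrix_unit i j)"
  by (auto simp: vec_eq_iff matrix_matrix_mult_def matrix_unit_def diag_matrix_def matrix_scale_def
      if_distrib[of "\<lambda>x. x * _"] if_distrib[of "\<lambda>x. _ * x"] sum.delta sum.delta' cong: if_cong)

lemma D_diag: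
  "D_matrix 1 = diag_matrix (\<lambda>a. if a = 1 then 3/4 else - 1/4 :: 'k::field_char_0)"
  "D_matrix 2 = diag_matrix (\<lambda>a. if a = 1 \<or> a = 2 then 1/2 else - 1/2 :: 'k::field_char_0)"
  "D_matrix 3 = diag_matrix (\<lambda>a. if a = 4 then - 3/4 else 1/4 :: 'k::field_char_0)"
proof -
  have ivl: "{Suc 0..2} = {1, 2::nat}" "{Suc 0..3} = {1, 2, 3::nat}"
    "{2..4} = {2, 3, 4::nat}" "{3..4} = {3, 4::nat}" "{Suc 2..4} = {3, 4::nat}" "{Suc 3..4} = {4::nat}"
    "{Suc (Suc 0)..4} = {2, 3, 4::nat}"
    by auto
  show "D_matrix 1 = diag_matrix (\<lambda>a. if a = 1 then 3/4 else - 1/4 :: 'k::field_char_0)"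
    "D_matrix 2 = diag_matrix (\<lambda>a. if a = 1 \<or> a = 2 then 1/2 else - 1/2 :: 'k::field_char_0)"
    "D_matrix 3 = diag_matrix (\<lambda>a. if a = 4 then - 3/4 else 1/4 :: 'k::field_char_0)"
    by (simp_all add: vec_eq_iff forall_4 D_matrix_def matrix_scale_def matrix_unit_def diag_matrix_def ivl)
qed

lemma D_matrix_diag: "p \<in> {1, 2, 3} \<Longrightarrow> \<exists>f. D_matrix p = (diag_matrix f :: 'k::field_char_0 ^ 4 ^ 4)"
  using D_diag[where 'k = 'k] by (elim insertE emptyE) blast+

lemma D_E_bracket:
  assumes "p \<in> {1, 2, 3}" "i \<noteq> j" "D_matrix p = (diag_matrix f :: 'k::field_char_0 ^ 4 ^ 4)"
  shows "D\<^sub>U p * E\<^sub>U i j = E\<^sub>U i j * D\<^sub>U p + usl4_scale (f i - f j) (E\<^sub>U i j :: 'k usl4)"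
proof -
  have "D_matrix p ** matrix_unit i j - matrix_unit i j ** D_matrix p = matrix_scale (f i - f j) (matrix_unit i j)"
    unfolding assms(3) diag_matrix_mult by (simp add: matrix_scale_def vec_eq_iff algebra_simps)
  then have "D\<^sub>U p * E\<^sub>U i j - E\<^sub>U i j * D\<^sub>U p = usl4_gen (Abs_sl4 (matrix_scale (f i - f j) (matrix_unit i j)))"
    unfolding E\<^sub>U_def D\<^sub>U_def
    by (simp only: gen_bracket[OF trace_D_matrix[OF assms(1)] trace_matrix_unit[OF assms(2)]])
  then show ?thesis
    using assms(2) by (simp add: gen_Abs_scale trace_matrix_unit E\<^sub>U_def algebra_simps)
qed

lemma D_D_bracket:
  assumes "p \<in> {1, 2, 3}" "p' \<in> {1, 2, 3}"
  shows "D\<^sub>U p * D\<^sub>U p' = D\<^sub>U p' * (D\<^sub>U p :: 'k::field_char_0 usl4)"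
proof -
  have *: "D_matrix p ** D_matrix p' = (D_matrix p' ** D_matrix p :: 'k ^ 4 ^ 4)"
  proof -
    obtain f g where "D_matrix p = (diag_matrix f :: 'k ^ 4 ^ 4)" "D_matrix p' = (diag_matrix g :: 'k ^ 4 ^ 4)"
      using assms D_matrix_diag by metis
    then show ?thesis by (simp only: diag_matrix_mult mult.commute)
  qed
  have "D\<^sub>U p * D\<^sub>U p' - D\<^sub>U p' * (D\<^sub>U p :: 'k usl4) = usl4_gen (Abs_sl4 0)"
    unfolding D\<^sub>U_def using assms by (subst gen_bracket) (simp_all only: trace_D_matrix * diff_self)
  then show ?thesis by (simp add: Abs_sl4_0 usl4_gen_0)
qed

lemma Cartan_bracket:
  assumes "i \<noteq> j" and p: "p \<in> {1, 2, 3}" "p' \<in> {1, 2, 3}" "p'' \<in> {1, 2, 3}"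
    and "matrix_unit i i - matrix_unit j j = matrix_scale c (D_matrix p) + (matrix_scale c' (D_matrix p') + matrix_scale c'' (D_matrix p'' :: 'k::field_char_0 ^ 4 ^ 4))"
  shows "E\<^sub>U i j * E\<^sub>U j i = E\<^sub>U j i * E\<^sub>U i j + (usl4_scale c (D\<^sub>U p) + (usl4_scale c' (D\<^sub>U p') + usl4_scale c'' (D\<^sub>U p'')))"
proof -
  have tr: "trace (matrix_scale c A) = 0" if "trace A = 0" for A :: "'k ^ 4 ^ 4" and c
    using that by (simp add: trace_def matrix_scale_def flip: sum_distrib_left)
  have "E\<^sub>U i j * E\<^sub>U j i - E\<^sub>U j i * (E\<^sub>U i j :: 'k usl4) = usl4_gen (Abs_sl4 (matrix_unit i i - matrix_unit j j))"
    unfolding E\<^sub>U_def using assms(1) by (subst gen_bracket) (simp_all add: trace_matrix_unit matrix_unit_mult)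
  also have "\<dots> = usl4_scale c (D\<^sub>U p) + (usl4_scale c' (D\<^sub>U p') + usl4_scale c'' (D\<^sub>U p''))"
    unfolding assms(5) D\<^sub>U_def
    by (simp only: gen_Abs_add gen_Abs_scale trace_add tr trace_D_matrix p add_0_left)
  finally show ?thesis by (simp add: algebra_simps)
qed

definition eU :: "4 \<Rightarrow> 4 \<Rightarrow> 'k::field usl4 fps" where "eU i j = fps_const (E\<^sub>U i j)"
definition dU :: "nat \<Rightarrow> 'k::field_char_0 usl4 fps" where "dU p = fps_const (D\<^sub>U p)"

lemma fps_const_eqI: "x = y \<Longrightarrow> fps_const x = fps_const y" by simp

lemma e_e:
  assumes "i \<noteq> j" "k \<noteq> l" "j \<noteq> k \<or> i \<noteq> l"
  shows "eU i j * eU k l = eU k l * eU i j + (if j = k then eU i l else 0) - (if i = l then eU k j else 0)"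
  using E_bracket[OF assms, THEN fps_const_eqI] by (simp add: eU_def split: if_splits)

lemma d_e:
  "p \<in> {1, 2, 3} \<Longrightarrow> i \<noteq> j \<Longrightarrow> D_matrix p = (diag_matrix f :: 'k::field_char_0 ^ 4 ^ 4) \<Longrightarrow>
    dU p * eU i j = eU i j * dU p + U.sc (f i - f j) * (eU i j :: 'k usl4 fps)"
  using D_E_bracket[of p i j f, THEN fps_const_eqI] by (simp add: eU_def dU_def U.sc_def usl4.scale_mult_left)

lemma d_d: "p \<in> {1, 2, 3} \<Longrightarrow> p' \<in> {1, 2, 3} \<Longrightarrow> dU p * dU p' = dU p' * (dU p :: 'k::field_char_0 usl4 fps)"
  using D_D_bracket[of p p'] by (simp add: dU_def)

lemma brackets_32:
  "eU 3 2 * eU 1 2 = eU 1 2 * eU 3 2" "eU 3 2 * eU 1 3 = eU 1 3 * eU 3 2 - eU 1 2"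
  "eU 3 2 * eU 1 4 = eU 1 4 * eU 3 2" "eU 3 2 * eU 3 4 = eU 3 4 * eU 3 2"
  "eU 3 2 * eU 4 3 = eU 4 3 * eU 3 2 - eU 4 2" "eU 4 2 * eU 3 2 = eU 3 2 * eU 4 2"
  and brackets_42:
  "eU 4 2 * eU 1 2 = eU 1 2 * eU 4 2" "eU 4 2 * eU 1 3 = eU 1 3 * eU 4 2"
  "eU 4 2 * eU 1 4 = eU 1 4 * eU 4 2 - eU 1 2" "eU 4 2 * eU 3 4 = eU 3 4 * eU 4 2 - eU 3 2"
  "eU 4 2 * eU 4 3 = eU 4 3 * eU 4 2" "eU 4 2 * eU 2 3 = eU 2 3 * eU 4 2 + eU 4 3"
  by (subst e_e; simp add: index4_distinct)+

lemma brackets_pos: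
  "eU 1 3 * eU 1 2 = eU 1 2 * eU 1 3" "eU 1 4 * eU 1 2 = eU 1 2 * eU 1 4" "eU 1 4 * eU 1 3 = eU 1 3 * eU 1 4"
  "eU 1 2 * eU 3 4 = eU 3 4 * eU 1 2" "eU 1 2 * eU 4 3 = eU 4 3 * eU 1 2"
  "eU 1 2 * eU 2 3 = eU 2 3 * eU 1 2 + eU 1 3" "eU 1 2 * eU 2 4 = eU 2 4 * eU 1 2 + eU 1 4"
  "eU 1 3 * eU 3 4 = eU 3 4 * eU 1 3 + eU 1 4" "eU 1 4 * eU 3 4 = eU 3 4 * eU 1 4"
  "eU 1 3 * eU 4 3 = eU 4 3 * eU 1 3" "eU 1 4 * eU 4 3 = eU 4 3 * eU 1 4 + eU 1 3"
  "eU 1 3 * eU 2 3 = eU 2 3 * eU 1 3" "eU 1 4 * eU 2 3 = eU 2 3 * eU 1 4"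
  "eU 1 3 * eU 2 4 = eU 2 4 * eU 1 3" "eU 1 4 * eU 2 4 = eU 2 4 * eU 1 4"
  "eU 2 3 * eU 3 4 = eU 3 4 * eU 2 3 + eU 2 4" "eU 2 4 * eU 3 4 = eU 3 4 * eU 2 4" "eU 2 4 * eU 2 3 = eU 2 3 * eU 2 4"
  "eU 4 3 * eU 2 3 = eU 2 3 * eU 4 3"
  by (subst e_e; simp add: index4_distinct)+

lemma weights:
  "dU 1 * eU 1 2 = eU 1 2 * dU 1 + eU 1 2" "dU 1 * eU 1 3 = eU 1 3 * dU 1 + eU 1 3" "dU 1 * eU 1 4 = eU 1 4 * dU 1 + eU 1 4"
  "dU 1 * eU 3 2 = eU 3 2 * dU 1" "dU 1 * eU 4 2 = eU 4 2 * dU 1" "dU 1 * eU 2 3 = eU 2 3 * dU 1"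
  "dU 1 * eU 3 4 = eU 3 4 * dU 1" "dU 1 * eU 4 3 = eU 4 3 * dU 1"
  "dU 2 * eU 1 2 = eU 1 2 * dU 2" "dU 2 * eU 1 3 = eU 1 3 * dU 2 + eU 1 3" "dU 2 * eU 1 4 = eU 1 4 * dU 2 + eU 1 4"
  "dU 2 * eU 2 3 = eU 2 3 * dU 2 + eU 2 3" "dU 2 * eU 3 4 = eU 3 4 * dU 2" "dU 2 * eU 4 3 = eU 4 3 * dU 2"
  "dU 2 * eU 3 2 = eU 3 2 * dU 2 - eU 3 2" "dU 2 * eU 4 2 = eU 4 2 * dU 2 - eU 4 2"
  "dU 3 * eU 1 2 = eU 1 2 * dU 3" "dU 3 * eU 1 3 = eU 1 3 * dU 3" "dU 3 * eU 1 4 = eU 1 4 * dU 3 + eU 1 4"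
  "dU 3 * eU 2 3 = eU 2 3 * dU 3" "dU 3 * eU 3 4 = eU 3 4 * dU 3 + eU 3 4" "dU 3 * eU 4 3 = eU 4 3 * dU 3 - eU 4 3"
  "dU 3 * eU 3 2 = eU 3 2 * dU 3" "dU 3 * eU 4 2 = eU 4 2 * dU 3 - eU 4 2"
  by (subst d_e[OF _ _ D_diag(1)] d_e[OF _ _ D_diag(2)] d_e[OF _ _ D_diag(3)]; simp add: index4_distinct U.sc_minus)+

lemma Cartan_brackets:
  "eU 3 4 * eU 4 3 = eU 4 3 * eU 3 4 + (2 * dU 3 - dU 2 :: 'k::field_char_0 usl4 fps)"
  "eU 3 2 * eU 2 3 = eU 2 3 * eU 3 2 + (dU 3 - 2 * dU 2 + dU 1 :: 'k::field_char_0 usl4 fps)"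
proof -
  have two: "usl4_scale 2 u = u + u" for u :: "'k usl4"
    using usl4.scale_left_distrib[of 1 1 u] by simp
  have "matrix_unit 3 3 - matrix_unit 4 4 = matrix_scale 2 (D_matrix 3) + (matrix_scale (-1) (D_matrix 2) + matrix_scale 0 (D_matrix 1 :: 'k ^ 4 ^ 4))"
    unfolding D_diag by (simp add: vec_eq_iff forall_4 matrix_unit_def matrix_scale_def diag_matrix_def)
  from Cartan_bracket[OF _ _ _ _ this]
  have "E\<^sub>U 3 4 * E\<^sub>U 4 3 = E\<^sub>U 4 3 * E\<^sub>U 3 4 + (D\<^sub>U 3 + D\<^sub>U 3 - D\<^sub>U 2 :: 'k usl4)"
    by (simp add: two index4_distinct)
  then show "eU 3 4 * eU 4 3 = eU 4 3 * eU 3 4 + (2 * dU 3 - dU 2 :: 'k usl4 fps)"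
    unfolding mult_2 by (simp add: eU_def dU_def)
  have "matrix_unit 3 3 - matrix_unit 2 2 = matrix_scale 1 (D_matrix 3) + (matrix_scale (-2) (D_matrix 2) + matrix_scale 1 (D_matrix 1 :: 'k ^ 4 ^ 4))"
    unfolding D_diag by (simp add: vec_eq_iff forall_4 matrix_unit_def matrix_scale_def diag_matrix_def)
  from Cartan_bracket[OF _ _ _ _ this]
  have "E\<^sub>U 3 2 * E\<^sub>U 2 3 = E\<^sub>U 2 3 * E\<^sub>U 3 2 + (D\<^sub>U 3 - (D\<^sub>U 2 + D\<^sub>U 2) + D\<^sub>U 1 :: 'k usl4)"
    by (simp add: two index4_distinct)
  then show "eU 3 2 * eU 2 3 = eU 2 3 * eU 3 2 + (dU 3 - 2 * dU 2 + dU 1 :: 'k usl4 fps)"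
    unfolding mult_2 by (simp add: eU_def dU_def)
qed

section \<open>Conjugation by exponentials\<close>

declare One_nat_def [simp del]

context char0_algebra
begin

text \<open>Here \<open>[Y, X] = V + W\<close>, \<open>[Y, V] = - 2 W\<close> and \<open>[Y, W] = 0\<close>, so that the adjoint series
  \<open>X + [Y, X] + [Y, [Y, X]] / 2 + \<dots>\<close> of \<open>exp(Y) X exp(- Y)\<close> stops there and equals \<open>X + V\<close>.\<close>

lemma Exp_conj:
  assumes Y: "Y $ 0 = 0" and X: "Y * X = X * Y + V + W" and V: "Y * V = V * Y - 2 * W" and W: "Y * W = W * Y"
  shows "Exp Y * X = (X + V) * Exp Y"
proof -
  define y where "y k = sc (1 / fact k) * Y ^ k" for k
  have gy: "graded y"
    unfolding y_def by (rule graded_subst[OF Y])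
  have y0: "y 0 = 1" and y_Suc: "Y * y k = of_nat (Suc k) * y (Suc k)" for k
  proof -
    have "of_nat (Suc k) * sc (1 / fact (Suc k)) = sc (of_nat (Suc k) * (1 / fact (Suc k)))"
      by (simp only: sc_mult sc_of_nat)
    also have "of_nat (Suc k) * (1 / fact (Suc k)) = (1 / fact k :: 'k)"
      by (simp add: field_simps del: of_nat_Suc)
    finally have "of_nat (Suc k) * (sc (1 / fact (Suc k)) * t) = sc (1 / fact k) * t" for t
      by (simp only: mult.assoc[symmetric])
    then show "Y * y k = of_nat (Suc k) * y (Suc k)"
      by (simp only: y_def power_Suc sc_left_comm[of Y])
  qed (simp add: y_def)
  have yc: "y k * Y = Y * y k" for k
    by (simp add: y_def sc_left_comm[of Y] mult.assoc power_commutes)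
  define t where "t k Z = (case k of 0 \<Rightarrow> 0 | Suc j \<Rightarrow> Z * y j)" for k and Z :: "'a fps"
  define t2 where "t2 k Z = (case k of 0 \<Rightarrow> 0 | Suc j \<Rightarrow> t j Z)" for k and Z :: "'a fps"
  have yX: "y k * X = X * y k + t k (V + W) - t2 k W" for k
  proof -
    have "Y * y j * Z = y j * (Y * Z)" for j Z by (simp add: yc[symmetric] mult.assoc)
    show ?thesis
    proof (induction k)
      case 0
      show ?case by (simp add: y0 t_def t2_def)
    next
      case (Suc k)
      have YW: "Y * (W * y j) = of_nat (Suc j) * (W * y (Suc j))" for j
        using W y_Suc[of j] by (metis mult.assoc of_nat_left_comm)
      have YV: "Y * (V * y j) = of_nat (Suc j) * (V * y (Suc j)) - 2 * (W * y j)" for j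
      proof -
        have "Y * (V * y j) = (V * Y - 2 * W) * y j" by (simp only: V mult.assoc[symmetric])
        also have "\<dots> = V * (Y * y j) - 2 * (W * y j)" by (simp only: left_diff_distrib mult.assoc)
        finally show ?thesis by (simp only: y_Suc of_nat_left_comm)
      qed
      have YX: "Y * (X * y k) = of_nat (Suc k) * (X * y (Suc k)) + (V + W) * y k"
      proof -
        have "Y * (X * y k) = (X * Y + V + W) * y k" by (simp only: X mult.assoc[symmetric])
        also have "\<dots> = X * (Y * y k) + (V + W) * y k" by (simp only: distrib_right mult.assoc add.assoc)
        finally show ?thesis by (simp only: y_Suc of_nat_left_comm)
      qed
      have Yt: "Y * t k (V + W) = of_nat k * t (Suc k) (V + W) - 2 * t k W"
        by (cases k) (simp_all add: t_def distrib_left distrib_right YW YV del: of_nat_Suc)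
      have Yt2: "Y * t2 k W = of_nat (k - 1) * t2 (Suc k) W"
        by (cases k; cases "k - 1") (auto simp: t2_def t_def YW simp del: of_nat_Suc)
      have t_Suc: "t (Suc k) Z = Z * y k" for Z by (simp add: t_def)
      have t2_Suc: "t2 (Suc k) W = t k W" by (simp add: t2_def)
      have "of_nat (Suc k) * (y (Suc k) * X) = Y * (y k * X)"
        by (simp only: y_Suc[symmetric] mult.assoc[symmetric])
      also have "\<dots> = of_nat (Suc k) * (X * y (Suc k)) + (V + W) * y k
          + (of_nat k * t (Suc k) (V + W) - 2 * t k W) - of_nat (k - 1) * t2 (Suc k) W"
        unfolding Suc distrib_left right_diff_distrib YX Yt Yt2 ..
      also have "\<dots> = of_nat (Suc k) * (X * y (Suc k) + t (Suc k) (V + W) - t2 (Suc k) W)"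
      proof (cases k)
        case 0
        then show ?thesis by (simp add: t_def t2_def)
      next
        case (Suc j)
        have k2: "of_nat (Suc k) * t k W = 2 * t k W + of_nat (k - 1) * t k W"
          by (simp add: Suc mult_2 distrib_right)
        have k1: "of_nat (Suc k) * t (Suc k) (V + W) = t (Suc k) (V + W) + of_nat k * t (Suc k) (V + W)"
          by (simp add: distrib_right)
        show ?thesis
          unfolding t2_Suc distrib_left[of "of_nat (Suc k)"] right_diff_distrib[of "of_nat (Suc k)"] k1 k2
          by (simp add: t_Suc del: of_nat_Suc)
      qed
      finally have "of_nat (Suc k) * (y (Suc k) * X - (X * y (Suc k) + t (Suc k) (V + W) - t2 (Suc k) W)) = 0"
        by (simp add: right_diff_distrib del: of_nat_Suc)
      then have "sc (of_nat (Suc k)) * (y (Suc k) * X - (X * y (Suc k) + t (Suc k) (V + W) - t2 (Suc k) W)) = 0"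
        by (simp only: sc_of_nat)
      then have "y (Suc k) * X - (X * y (Suc k) + t (Suc k) (V + W) - t2 (Suc k) W) = 0"
        by (rule sc_cancel[rotated]) (simp del: of_nat_Suc)
      then show ?case by simp
    qed
  qed
  have 0: "(V + W) $ 0 = 0" "W $ 0 = 0" "W $ 1 = 0"
  proof -
    have XYV: "V + W = Y * X - X * Y" and W2: "2 * W = V * Y - Y * V" using X V by (simp_all add: algebra_simps)
    have two: "x = 0" if "2 * x = (0 :: 'a)" for x
      using of_nat_cancel[of 2 x] that by simp
    show VW: "(V + W) $ 0 = 0" unfolding XYV by (simp add: Y)
    have W_2: "2 * W $ n = (V * Y - Y * V) $ n" for n
      using arg_cong[OF W2, of "\<lambda>x. x $ n"] by (simp add: mult_2)
    show W0: "W $ 0 = 0" by (rule two) (simp add: W_2 Y)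
    with VW have "V $ 0 = 0" by simp
    then have "2 * W $ 1 = 0"
      unfolding W_2 by (simp add: Y fps_mult_nth_1)
    then show "W $ 1 = 0" by (rule two)
  qed
  have gt: "graded (\<lambda>k. t k Z)" if "Z $ 0 = 0" for Z
    unfolding graded_def
  proof (intro allI impI)
    show "t k Z $ n = 0" if "n < k" for k n
    proof (cases k)
      case (Suc j)
      have "(Z * y j) $ n = 0"
        by (rule nth_mult_low[of 1 _ j]) (use that Suc \<open>Z $ 0 = 0\<close> in \<open>simp_all add: gradedD[OF gy]\<close>)
      then show ?thesis by (simp add: t_def Suc)
    qed (use that in simp)
  qed
  have gt2: "graded (\<lambda>k. t2 k W)"
    unfolding graded_def
  proof (intro allI impI)
    fix k n :: nat assume "n < k"
    have W1: "W $ j = 0" if "j < 2" for j using that 0(2,3) by (auto simp: less_2_cases_iff One_nat_def)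
    show "t2 k W $ n = 0"
    proof (cases "k < 2")
      case True
      then have "k = 0 \<or> k = Suc 0" by auto
      then show ?thesis by (auto simp: t2_def t_def)
    next
      case False
      then obtain j where k: "k = Suc (Suc j)" by (metis add_2_eq_Suc le_Suc_ex not_less)
      have "(W * y j) $ n = 0"
        by (rule nth_mult_low[of 2 _ j]) (use \<open>n < k\<close> k in \<open>simp_all add: gradedD[OF gy] W1\<close>)
      then show ?thesis by (simp add: t2_def t_def k)
    qed
  qed
  have sum_t: "graded_sum (\<lambda>k. t k Z) = Z * graded_sum y" if "Z $ 0 = 0" for Z
    by (subst graded_sum_shift[OF gt[OF that]]) (simp_all add: t_def mult_graded_sum[OF gy])
  have sum_t2: "graded_sum (\<lambda>k. t2 k W) = W * graded_sum y"
    by (subst graded_sum_shift[OF gt2]) (simp_all add: t2_def sum_t[OF 0(2), symmetric])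
  have E: "Exp Y = graded_sum y"
    unfolding Exp_eq y_def ..
  show ?thesis
    unfolding E graded_sum_mult[OF gy] yX graded_sum_diff graded_sum_add sum_t[OF 0(1)] sum_t2 mult_graded_sum[OF gy, symmetric]
    by (simp add: distrib_right)
qed

lemma Ln_Exp: "x $ 0 = 0 \<Longrightarrow> Lnf (Exp x) = x"
proof -
  assume x: "x $ 0 = 0"
  have "fps_ln 1 oo (fps_exp 1 - 1) = (fps_X :: 'k fps)"
    unfolding fps_ln_fps_exp_inv[OF one_neq_zero] by (rule fps_inv) auto
  moreover have "Exp x - 1 = Sub (fps_exp 1 - 1) x"
    using subst_add[of "fps_exp 1 - 1" 1 x] by (simp add: fps_Exp_def subst_1)
  ultimately show ?thesis
    unfolding fps_Ln_def using x by (simp add: subst_X flip: subst_compose)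
qed

lemma Ln_mult:
  assumes "u $ 0 = 1" "v $ 0 = 1" "u * v = v * u"
  shows "Lnf (u * v) = Lnf u + Lnf v"
proof -
  have "intertw u v v" using assms(3) by (simp add: intertw_def)
  then have "intertw u (Lnf v) (Lnf v)" by (intro intertw_Ln assms)
  then have "intertw (Lnf v) u u" by (simp add: intertw_def)
  then have "intertw (Lnf v) (Lnf u) (Lnf u)" by (intro intertw_Ln assms)
  then have "Lnf u * Lnf v = Lnf v * Lnf u" by (simp add: intertw_def)
  then have "u * v = Exp (Lnf u + Lnf v)"
    by (simp add: Exp_add Ln_nth_0 Exp_Ln assms)
  then show ?thesis by (simp add: Ln_Exp Ln_nth_0)
qed

end

lemma assoc_rule: "x * y = z \<Longrightarrow> x * (y * t) = z * (t :: 'a::semigroup_mult)"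
  by (simp flip: mult.assoc)

section \<open>The extended Jordanian twist\<close>

text \<open>In the notation of the introduction, \<open>xU = e\<^sup>\<sigma>\<close> and \<open>yU = e\<^sup>-\<^sup>\<sigma>\<close>.\<close>

definition xU :: "'k::field_char_0 usl4 fps" where "xU = 1 - fps_X * eU 1 2"
definition yU :: "'k::field_char_0 usl4 fps" where "yU = fps_Exp usl4_scale (- fps_Ln usl4_scale xU)"
definition qU :: "'k::field_char_0 usl4 fps" where "qU = fps_X * (eU 1 3 * yU)"
definition uU :: "'k::field_char_0 usl4 fps" where "uU = fps_X * (eU 1 4 * yU)"
definition wU :: "'k::field_char_0 usl4 fps" where "wU = fps_X * eU 2 4 - fps_X * (eU 3 4 * qU)"

lemma xU_nth_0 [simp]: "xU $ 0 = 1" and qU_nth_0 [simp]: "qU $ 0 = 0" and uU_nth_0 [simp]: "uU $ 0 = 0" and wU_nth_0 [simp]: "wU $ 0 = 0"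
  by (simp_all add: xU_def qU_def uU_def wU_def)

lemma x_y: "xU * yU = 1" "yU * xU = 1"
  using U.Exp_uminus[of "fps_Ln usl4_scale xU"] by (simp_all add: yU_def U.Exp_Ln U.Ln_nth_0)

lemma y_comm_if: "xU * v = v * xU \<Longrightarrow> yU * v = v * yU"
  by (metis mult.assoc mult_1_left mult_1_right x_y)

lemmas X_left = fps_mult_fps_X_commute[symmetric]

lemma X_left_comm: "a * (fps_X * t) = fps_X * (a * (t :: 'a::ring_1 fps))"
  by (metis fps_mult_fps_X_commute mult.assoc)

lemmas X_front = X_left[of yU] X_left[of xU] X_left[of "eU _ _"] X_left[of "dU _"]
  X_left_comm[of yU] X_left_comm[of xU] X_left_comm[of "eU _ _"] X_left_comm[of "dU _"]

lemmas distribs = distrib_left distrib_right left_diff_distrib right_diff_distrib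

lemma x_comm:
  "xU * eU 1 2 = eU 1 2 * xU" "xU * eU 1 3 = eU 1 3 * xU" "xU * eU 1 4 = eU 1 4 * xU" "xU * eU 3 4 = eU 3 4 * xU" "xU * eU 4 3 = eU 4 3 * xU"
  "xU * dU 2 = dU 2 * xU" "xU * dU 3 = dU 3 * xU" "xU * eU 3 2 = eU 3 2 * xU" "xU * eU 4 2 = eU 4 2 * xU"
  "xU * eU 2 3 = eU 2 3 * xU - fps_X * eU 1 3" "xU * eU 2 4 = eU 2 4 * xU - fps_X * eU 1 4"
  by (simp_all add: xU_def distribs X_front mult.assoc brackets_pos brackets_32 brackets_42 weights)

lemma y_comm:
  "yU * eU 1 2 = eU 1 2 * yU" "yU * eU 1 3 = eU 1 3 * yU" "yU * eU 1 4 = eU 1 4 * yU" "yU * eU 3 4 = eU 3 4 * yU" "yU * eU 4 3 = eU 4 3 * yU"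
  "yU * dU 2 = dU 2 * yU" "yU * dU 3 = dU 3 * yU"
  by (rule y_comm_if, rule x_comm)+

text \<open>These follow from the brackets of \<open>x\<close> by multiplying with \<open>y = x\<^sup>-\<^sup>1\<close> on both sides.\<close>

lemma y_comm_nontrivial:
  "yU * eU 2 3 = eU 2 3 * yU + fps_X * (eU 1 3 * (yU * yU))"
  "yU * eU 2 4 = eU 2 4 * yU + fps_X * (eU 1 4 * (yU * yU))"
proof -
  have *: "yU * v = v * yU + fps_X * (p * (yU * yU))" if "xU * v = v * xU - fps_X * p" "yU * p = p * yU" for v p
  proof -
    have "yU * v = yU * (v * xU) * yU" by (simp add: mult.assoc x_y)
    also have "v * xU = xU * v + fps_X * p" using that(1) by simp
    also have "yU * (xU * v + fps_X * p) * yU = (yU * xU) * v * yU + fps_X * (yU * p * yU)"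
      by (simp add: distribs mult.assoc X_front)
    finally show ?thesis by (simp add: x_y that(2) mult.assoc)
  qed
  show "yU * eU 2 3 = eU 2 3 * yU + fps_X * (eU 1 3 * (yU * yU))"
  "yU * eU 2 4 = eU 2 4 * yU + fps_X * (eU 1 4 * (yU * yU))"
    by (rule *; simp add: x_comm y_comm)+
qed

lemmas U_order = distribs mult.assoc X_front
  brackets_pos brackets_pos[THEN assoc_rule] y_comm y_comm[THEN assoc_rule]
  y_comm_nontrivial y_comm_nontrivial[THEN assoc_rule]
  weights weights[THEN assoc_rule] x_y x_y[THEN assoc_rule]

lemma q_rules:
  "qU * eU 1 2 = eU 1 2 * qU" "qU * eU 1 3 = eU 1 3 * qU" "qU * eU 1 4 = eU 1 4 * qU"
  "qU * eU 3 4 = eU 3 4 * qU + uU" "qU * eU 4 3 = eU 4 3 * qU" "qU * dU 2 = dU 2 * qU - qU" "qU * dU 3 = dU 3 * qU"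
  "qU * eU 2 3 = eU 2 3 * qU + qU * qU"
  "uU * eU 1 2 = eU 1 2 * uU" "uU * eU 1 3 = eU 1 3 * uU" "uU * eU 1 4 = eU 1 4 * uU"
  "uU * eU 3 4 = eU 3 4 * uU" "uU * eU 4 3 = eU 4 3 * uU + qU" "uU * dU 2 = dU 2 * uU - uU" "uU * dU 3 = dU 3 * uU - uU"
  "uU * eU 2 3 = eU 2 3 * uU + qU * uU" "uU * qU = qU * uU"
  "qU * xU = fps_X * eU 1 3" "uU * xU = fps_X * eU 1 4" "xU * qU = fps_X * eU 1 3" "xU * uU = fps_X * eU 1 4"
  by (simp_all add: qU_def uU_def U_order x_comm x_comm[THEN assoc_rule])

lemma quad_rels_U: "quad_rels (1 - fps_X * eU 2 3) (fps_X * eU 3 4) qU (fps_X * uU) wU"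
  unfolding quad_rels_def
  by (simp add: qU_def uU_def wU_def U_order)

abbreviation lf :: "'k::field_char_0 usl4 fps \<Rightarrow> ('k, 2) usl4_tensor fps" where "lf \<equiv> fps_map (\<lambda>a. a \<otimes> 1)"
abbreviation rf :: "'k::field_char_0 usl4 fps \<Rightarrow> ('k, 2) usl4_tensor fps" where "rf \<equiv> fps_map (\<lambda>a. 1 \<otimes> a)"

lemma rf_lf: "rf b * lf a = lf a * rf b"
  by (rule fps_map_commute) (simp add: tensor2_mult)

lemma fps_tensor_eq: "A \<otimes>\<^sub>\<zeta> B = lf A * rf B"
  by (simp add: fps_eq_iff fps_tensor_def fps_mult_nth fps_map_nth tensor2_mult)

lemma comult_eU: "fps_map usl4_comult (eU i j) = lf (eU i j) + rf (eU i j)"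
  and comult_dU: "fps_map usl4_comult (dU p) = lf (dU p) + rf (dU p)"
  by (simp_all add: eU_def dU_def E\<^sub>U_def D\<^sub>U_def CM.map_const I1.map_const I2.map_const usl4_comult_simps)

lemmas lf_rules = brackets_32[THEN arg_cong[of _ _ lf], unfolded I1.map_simps]
  brackets_42[THEN arg_cong[of _ _ lf], unfolded I1.map_simps]
  weights[THEN arg_cong[of _ _ lf], unfolded I1.map_simps] Cartan_brackets[THEN arg_cong[of _ _ lf], unfolded I1.map_simps]
lemmas rf_rules = q_rules[THEN arg_cong[of _ _ rf], unfolded I2.map_simps]
lemmas T2_order = distribs mult.assoc rf_lf rf_lf[THEN assoc_rule] lf_rules lf_rules[THEN assoc_rule] rf_rules rf_rules[THEN assoc_rule]

definition YT :: "('k::field_char_0, 2) usl4_tensor fps" where "YT = lf (eU 3 2) * rf qU + lf (eU 4 2) * rf uU"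
definition ZT :: "('k::field_char_0, 2) usl4_tensor fps" where "ZT = lf (dU 1) * rf (fps_Ln usl4_scale xU)"
definition JT :: "('k::field_char_0, 2) usl4_tensor fps" where "JT = fps_Exp tensor_scale YT * fps_Exp tensor_scale ZT"

lemma YT_0 [simp]: "YT $ 0 = 0" and ZT_0 [simp]: "ZT $ 0 = 0"
  by (simp_all add: YT_def ZT_def fps_map_nth U.Ln_nth_0 I2.hom_0)

abbreviation "eT \<equiv> fps_Exp tensor_scale"

text \<open>An element of weight \<open>1\<close> for \<open>D\<^sub>1\<close> turns \<open>exp(D\<^sub>1 \<otimes> \<sigma>)\<close> into \<open>exp((D\<^sub>1 + 1) \<otimes> \<sigma>)\<close>, which contributes \<open>1 \<otimes> e\<^sup>\<sigma>\<close>.\<close>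

lemma Exp_ZT_weight_1:
  fixes v :: "'k::field_char_0 usl4 fps"
  assumes "dU 1 * v = v * dU 1 + v"
  shows "eT ZT * lf v = lf v * rf xU * eT ZT"
proof -
  let ?L = "rf (fps_Ln usl4_scale xU) :: ('k, 2) usl4_tensor fps"
  have v: "lf (dU 1) * lf v = lf v * lf (dU 1) + lf v"
    using assms[THEN arg_cong, of lf] by (simp add: I1.map_simps)
  have "TT.intertw (lf v) (?L + ZT) ZT"
    unfolding TT.intertw_def ZT_def by (simp add: distribs mult.assoc rf_lf v[THEN assoc_rule])
  then have "TT.intertw (lf v) (eT (?L + ZT)) (eT ZT)"
    by (rule TT.intertw_Exp[rotated 2]) (simp_all add: fps_map_nth U.Ln_nth_0 I2.hom_0)
  moreover have "eT (?L + ZT) = eT ?L * eT ZT"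
    by (rule TT.Exp_add) (simp_all add: ZT_def fps_map_nth U.Ln_nth_0 I2.hom_0 mult.assoc rf_lf[THEN assoc_rule])
  moreover have "eT ?L = rf (xU :: 'k usl4 fps)"
    by (simp add: U.Exp_Ln flip: I2.map_Exp)
  ultimately show ?thesis
    by (simp add: TT.intertw_def mult.assoc)
qed

lemma Exp_ZT_comm:
  assumes "v * ZT = ZT * v"
  shows "eT ZT * v = v * eT ZT"
proof -
  have "TT.intertw v ZT ZT" using assms by (simp add: TT.intertw_def)
  then have "TT.intertw v (eT ZT) (eT ZT)" by (intro TT.intertw_Exp) auto
  then show ?thesis by (simp add: TT.intertw_def)
qed

lemma ZT_comm_lf: "dU 1 * v = v * dU 1 \<Longrightarrow> eT ZT * lf v = lf v * eT ZT"
proof (rule Exp_ZT_comm)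
  assume "dU 1 * v = v * dU 1"
  then have "lf (dU 1) * lf v = lf v * lf (dU 1)" by (simp flip: I1.map_mult)
  then show "lf v * ZT = ZT * lf v" by (simp add: ZT_def mult.assoc rf_lf) (simp flip: mult.assoc)
qed

lemma ZT_comm_rf: "xU * v = v * xU \<Longrightarrow> eT ZT * rf v = rf v * eT ZT"
proof (rule Exp_ZT_comm)
  assume "xU * v = v * xU"
  then have "U.intertw v xU xU" by (simp add: U.intertw_def)
  then have "U.intertw v (fps_Ln usl4_scale xU) (fps_Ln usl4_scale xU)" by (intro U.intertw_Ln) auto
  then have "v * fps_Ln usl4_scale xU = fps_Ln usl4_scale xU * v" by (simp add: U.intertw_def)
  then have "rf v * rf (fps_Ln usl4_scale xU) = rf (fps_Ln usl4_scale xU) * rf v" by (simp flip: I2.map_mult)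
  then show "rf v * ZT = ZT * rf v" by (simp add: ZT_def mult.assoc rf_lf[THEN assoc_rule])
qed

text \<open>With a natural number \<open>n\<close> in place of \<open>D\<^sub>1\<close> this is the commutation rule of \<open>xU\<^sup>n\<close> and \<open>E\<^sub>2\<^sub>3\<close>, proved by
  induction; it transfers to \<open>D\<^sub>1\<close> because both sides are polynomial families.\<close>

lemma ZT_23: "eT ZT * rf (eU 2 3) = (rf (eU 2 3) - lf (dU 1) * rf qU) * (eT ZT :: ('k::field_char_0, 2) usl4_tensor fps)"
proof -
  let ?D = "D\<^sub>U 1 \<otimes> 1 :: ('k, 2) usl4_tensor"
  have D: "lf (dU 1) = fps_const ?D" by (simp add: dU_def I1.map_const)
  have c: "TT.polyfam ?D 0 (\<lambda>_ _. rf v) (rf v)" for v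
    by (rule TT.polyfam_const) (simp_all add: rf_lf flip: D)
  note pf = TT.polyfam_mult TT.polyfam_diff TT.polyfam_Exp TT.polyfam_D c
  have ex: "eT (of_nat n * rf (fps_Ln usl4_scale xU)) = rf ((xU :: 'k usl4 fps) ^ n)" for n
    by (simp add: U.Exp_of_nat_Ln[symmetric] I2.map_simps)
  have pw: "xU ^ n * eU 2 3 = (eU 2 3 - of_nat n * qU) * (xU :: 'k usl4 fps) ^ n" for n
  proof (induction n)
    case (Suc n)
    have "xU ^ Suc n * eU 2 3 = xU * (eU 2 3 - of_nat n * qU) * (xU :: 'k usl4 fps) ^ n" by (simp add: Suc mult.assoc)
    also have "xU * (eU 2 3 - of_nat n * qU) = (eU 2 3 - of_nat (Suc n) * qU) * (xU :: 'k usl4 fps)"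
      by (simp add: distribs of_nat_left_comm[of xU] mult.assoc x_comm q_rules)
    finally show ?case by (simp add: mult.assoc)
  qed simp
  have "eT (fps_const ?D * rf (fps_Ln usl4_scale xU)) * rf (eU 2 3) = (rf (eU 2 3) - fps_const ?D * rf qU) * eT (fps_const ?D * rf (fps_Ln usl4_scale xU))"
  proof (rule TT.polyfam_unique)
    show "TT.polyfam ?D 0 (\<lambda>i _. eT (of_nat i * rf (fps_Ln usl4_scale xU)) * rf (eU 2 3)) (eT (fps_const ?D * rf (fps_Ln usl4_scale xU)) * rf (eU 2 3))"
      by (intro pf)
    show "TT.polyfam ?D 0 (\<lambda>i _. (rf (eU 2 3) - of_nat i * rf qU) * eT (of_nat i * rf (fps_Ln usl4_scale xU)))
        ((rf (eU 2 3) - fps_const ?D * rf qU) * eT (fps_const ?D * rf (fps_Ln usl4_scale xU)))"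
      by (intro pf)
    show "eT (of_nat i * rf (fps_Ln usl4_scale xU)) * rf (eU 2 3)
      = (rf (eU 2 3) - of_nat i * rf qU) * (eT (of_nat i * rf (fps_Ln usl4_scale xU)) :: ('k, 2) usl4_tensor fps)" for i
      unfolding ex using pw[of i, THEN arg_cong, of rf] by (simp only: I2.map_mult I2.map_diff I2.map_of_nat)
  qed simp
  then show ?thesis by (simp add: ZT_def D)
qed

lemma YT_comm: "YT * v = v * YT \<Longrightarrow> eT YT * v = v * eT YT"
  using TT.Exp_conj[of YT v 0 0] by simp

lemma JT_conj:
  assumes "eT ZT * a = b * eT ZT" "eT YT * b = c * eT YT"
  shows "JT * a = c * JT"
proof -
  have "JT * a = eT YT * b * eT ZT" by (simp only: JT_def mult.assoc assms(1))
  then show ?thesis by (simp only: JT_def mult.assoc assms(2))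
qed

lemma JT_comm_primitive:
  "JT * (lf (eU 3 4) + rf (eU 3 4)) = (lf (eU 3 4) + rf (eU 3 4)) * JT"
  "JT * (lf (eU 4 3) + rf (eU 4 3)) = (lf (eU 4 3) + rf (eU 4 3)) * JT"
  "JT * (lf (dU 2) + rf (dU 2)) = (lf (dU 2) + rf (dU 2)) * JT"
  "JT * (lf (dU 3) + rf (dU 3)) = (lf (dU 3) + rf (dU 3)) * JT"
proof -
  have *: "JT * (lf v + rf v) = (lf v + rf v) * JT"
    if "dU 1 * v = v * dU 1" "xU * v = v * xU" "YT * (lf v + rf v) = (lf v + rf v) * YT" for v
  proof -
    have "JT * (lf v + rf v) = eT YT * (eT ZT * lf v + eT ZT * rf v)"
      by (simp add: JT_def distrib_left mult.assoc)
    also have "\<dots> = eT YT * (lf v + rf v) * eT ZT"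
      using that by (simp add: ZT_comm_lf ZT_comm_rf distribs mult.assoc)
    finally show ?thesis
      using YT_comm[OF that(3)] by (simp add: JT_def mult.assoc)
  qed
  show "JT * (lf (eU 3 4) + rf (eU 3 4)) = (lf (eU 3 4) + rf (eU 3 4)) * JT"
    by (rule *) (simp_all add: weights x_comm YT_def T2_order)
  show "JT * (lf (eU 4 3) + rf (eU 4 3)) = (lf (eU 4 3) + rf (eU 4 3)) * JT"
    by (rule *) (simp_all add: weights x_comm YT_def T2_order)
  show "JT * (lf (dU 2) + rf (dU 2)) = (lf (dU 2) + rf (dU 2)) * JT"
    by (rule *) (simp_all add: d_d x_comm YT_def T2_order)
  show "JT * (lf (dU 3) + rf (dU 3)) = (lf (dU 3) + rf (dU 3)) * JT"
    by (rule *) (simp_all add: d_d x_comm YT_def T2_order)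
qed

text \<open>Conjugation by \<open>exp(D\<^sub>1 \<otimes> \<sigma>)\<close> already makes \<open>e\<^sup>\<sigma>\<close> group-like, and the other factor commutes with \<open>e\<^sup>\<sigma> \<otimes> e\<^sup>\<sigma>\<close>.\<close>

lemma JT_x: "JT * fps_map usl4_comult xU = lf xU * rf xU * (JT :: ('k::field_char_0, 2) usl4_tensor fps)"
proof -
  let ?x = "xU :: 'k usl4 fps"
  have dx: "fps_map usl4_comult ?x = 1 - fps_X * (lf (eU 1 2) + rf (eU 1 2))"
    by (simp add: xU_def CM.map_simps comult_eU)
  have lx: "lf ?x = 1 - fps_X * lf (eU 1 2)" and rx: "rf ?x = 1 - fps_X * rf (eU 1 2)"
    by (simp_all add: xU_def I1.map_simps I2.map_simps)
  have 1: "eT ZT * lf (eU 1 2) = lf (eU 1 2) * rf ?x * eT ZT"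
    by (rule Exp_ZT_weight_1) (rule weights)
  have 2: "eT ZT * rf (eU 1 2 :: 'k usl4 fps) = rf (eU 1 2) * eT ZT"
    by (rule ZT_comm_rf) (rule x_comm)
  have "eT ZT * fps_map usl4_comult ?x = eT ZT - fps_X * (eT ZT * lf (eU 1 2) + eT ZT * rf (eU 1 2))"
    by (simp add: dx distribs X_left_comm[of "eT ZT"])
  also have "\<dots> = lf xU * rf xU * eT ZT"
    unfolding 1 2 lx by (simp add: rx distribs mult.assoc X_left_comm[of "lf _"])
  finally have "JT * fps_map usl4_comult ?x = eT YT * (lf xU * rf xU) * eT ZT"
    by (simp add: JT_def mult.assoc)
  moreover have "YT * (lf ?x * rf xU) = lf xU * rf xU * YT"
  proof -
    have c: "lf (eU 3 2) * lf ?x = lf ?x * lf (eU 3 2)" "lf (eU 4 2) * lf ?x = lf ?x * lf (eU 4 2)"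
      "rf qU * rf ?x = rf ?x * rf qU" "rf uU * rf ?x = rf ?x * rf uU"
      by (simp_all add: x_comm q_rules flip: I1.map_mult I2.map_mult)
    then show ?thesis
      by (simp add: YT_def distribs mult.assoc rf_lf rf_lf[THEN assoc_rule] c c[THEN assoc_rule])
  qed
  ultimately show ?thesis
    by (simp add: YT_comm JT_def mult.assoc)
qed

lemma JT_y: "JT * fps_map usl4_comult yU = lf yU * rf yU * (JT :: ('k::field_char_0, 2) usl4_tensor fps)"
proof -
  let ?x = "xU :: 'k usl4 fps" and ?y = "yU :: 'k usl4 fps"
  have d: "fps_map usl4_comult ?x * fps_map usl4_comult ?y = 1"
    by (simp add: x_y CM.map_1 flip: CM.map_mult)
  have "lf ?y * rf ?y * (lf ?x * rf ?x) = lf (?y * ?x) * rf (?y * ?x)"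
    by (simp add: I1.map_mult I2.map_mult mult.assoc rf_lf[THEN assoc_rule])
  also have "\<dots> = 1" by (simp add: x_y I1.map_1 I2.map_1)
  finally have "lf ?y * rf ?y * (JT * fps_map usl4_comult ?x) = JT"
    unfolding JT_x by (simp flip: mult.assoc)
  then have "lf ?y * rf ?y * JT * (fps_map usl4_comult ?x * fps_map usl4_comult ?y) = JT * fps_map usl4_comult ?y"
    by (simp flip: mult.assoc)
  then show ?thesis by (simp add: d)
qed

text \<open>Both cases run alike with \<open>g = E\<^sub>1\<^sub>3\<close> or \<open>g = E\<^sub>1\<^sub>4\<close>: conjugation by the Jordanian factor yields
  \<open>g \<otimes> e\<^sup>\<sigma> + 1 \<otimes> g\<close>, the other factor subtracts \<open>\<zeta> E\<^sub>1\<^sub>2 \<otimes> g\<close>, and the total \<open>g \<otimes> e\<^sup>\<sigma> + e\<^sup>\<sigma> \<otimes> g\<close> becomes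
  primitive when it is multiplied by \<open>e\<^sup>-\<^sup>\<sigma> \<otimes> e\<^sup>-\<^sup>\<sigma>\<close>.\<close>

lemma JT_q:
  "JT * fps_map usl4_comult qU = (lf qU + rf qU) * (JT :: ('k::field_char_0, 2) usl4_tensor fps)"
  "JT * fps_map usl4_comult uU = (lf uU + rf uU) * (JT :: ('k::field_char_0, 2) usl4_tensor fps)"
proof -
  let ?x = "xU :: 'k usl4 fps" and ?y = "yU :: 'k usl4 fps"
  have *: "JT * fps_map usl4_comult v = (lf v + rf v) * (JT :: ('k, 2) usl4_tensor fps)"
    if v: "v = fps_X * (g * ?y)" and g: "fps_map usl4_comult g = lf g + rf g" "?x * g = g * ?x"
      and w: "dU 1 * g = g * dU 1 + g" and Y: "YT * (lf g * rf ?x) = lf g * rf ?x * YT - fps_X * (lf (eU 1 2) * rf g)" "YT * rf g = rf g * YT"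
      and c: "YT * (fps_X * (lf (eU 1 2) * rf g)) = fps_X * (lf (eU 1 2) * rf g) * YT" for v g
  proof -
    let ?W = "fps_X * (lf (eU 1 2) * rf g)"
    have "eT ZT * (lf g + rf g) = (lf g * rf ?x + rf g) * eT ZT"
      using Exp_ZT_weight_1[OF w] ZT_comm_rf[OF g(2)] by (simp add: distribs)
    from JT_conj[OF this] have "JT * (lf g + rf g) = (lf g * rf ?x + rf g - ?W) * JT" if "eT YT * (lf g * rf ?x + rf g) = (lf g * rf ?x + rf g - ?W) * eT YT"
      using that by simp
    moreover have "eT YT * (lf g * rf ?x + rf g) = (lf g * rf ?x + rf g - ?W) * eT YT"
      using TT.Exp_conj[of YT "lf g * rf ?x + rf g" "- ?W" 0] Y c by (simp add: distribs)
    moreover have "lf g * rf ?x + rf g - ?W = lf g * rf ?x + lf ?x * rf g"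
      by (simp add: xU_def I1.map_simps distribs mult.assoc)
    ultimately have J: "JT * (lf g + rf g) = (lf g * rf ?x + lf ?x * rf g) * JT"
      by simp
    have xy: "lf ?x * lf ?y = 1" "rf ?x * rf ?y = 1" "lf ?y * lf ?x = 1" "rf ?y * rf ?x = 1"
      by (simp_all add: x_y I1.map_1 I2.map_1 flip: I1.map_mult I2.map_mult)
    have gx: "lf ?y * lf g = lf g * lf ?y" "rf ?y * rf g = rf g * rf ?y"
      using y_comm_if[OF g(2)] by (simp_all flip: I1.map_mult I2.map_mult)
    have gx': "rf ?x * rf g = rf g * rf ?x"
      using g(2) by (simp flip: I2.map_mult)
    have "JT * fps_map usl4_comult v = fps_X * (JT * (lf g + rf g) * fps_map usl4_comult ?y)"
      by (simp add: v CM.map_simps g(1) mult.assoc X_left_comm[of JT])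
    also have "\<dots> = fps_X * ((lf g * rf ?x + lf ?x * rf g) * (lf ?y * rf ?y)) * JT"
      unfolding J by (simp add: mult.assoc JT_y)
    also have "(lf g * rf ?x + lf ?x * rf g) * (lf ?y * rf ?y) = lf g * lf ?y + rf g * rf ?y"
      by (simp add: distribs mult.assoc rf_lf rf_lf[THEN assoc_rule] xy xy[THEN assoc_rule])
    finally show ?thesis
      by (simp add: v I1.map_simps I2.map_simps distribs)
  qed
  show "JT * fps_map usl4_comult qU = (lf qU + rf qU) * (JT :: ('k, 2) usl4_tensor fps)"
    by (rule *[OF qU_def comult_eU]) (simp_all add: x_comm weights YT_def T2_order I2.map_simps X_left_comm[of "lf _"] X_left_comm[of "rf _"])
  show "JT * fps_map usl4_comult uU = (lf uU + rf uU) * (JT :: ('k, 2) usl4_tensor fps)"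
    by (rule *[OF uU_def comult_eU]) (simp_all add: x_comm weights YT_def T2_order I2.map_simps X_left_comm[of "lf _"] X_left_comm[of "rf _"])
qed

text \<open>The bracket with \<open>E\<^sub>3\<^sub>2 \<otimes> q\<close> produces the Cartan element \<open>[E\<^sub>3\<^sub>2, E\<^sub>2\<^sub>3]\<close>, whose \<open>D\<^sub>1\<close>-part cancels the
  correction of \<open>ZT_23\<close>; the bracket with \<open>E\<^sub>4\<^sub>2 \<otimes> u\<close> produces \<open>E\<^sub>4\<^sub>3 \<otimes> u\<close>.\<close>

lemma JT_23:
  "JT * (lf (eU 2 3) + rf (eU 2 3)) = (lf (eU 2 3) + rf (eU 2 3) + lf (dU 3 - 2 * dU 2) * rf qU + lf (eU 4 3) * rf uU)
    * (JT :: ('k::field_char_0, 2) usl4_tensor fps)"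
proof -
  let ?X = "lf (eU 2 3) + rf (eU 2 3) - lf (dU 1) * rf qU :: ('k, 2) usl4_tensor fps"
  let ?V = "lf (dU 3 - 2 * dU 2 + dU 1) * rf qU + lf (eU 4 3) * rf uU :: ('k, 2) usl4_tensor fps"
  let ?W = "lf (eU 3 2) * (rf qU * rf qU) + lf (eU 4 2) * (rf qU * rf uU) :: ('k, 2) usl4_tensor fps"
  have Z: "eT ZT * (lf (eU 2 3) + rf (eU 2 3)) = ?X * eT ZT"
    by (simp add: distribs ZT_comm_lf[OF weights(6)] ZT_23)
  have "eT YT * ?X = (?X + ?V) * eT YT"
    by (rule TT.Exp_conj[where W = ?W]) (simp_all add: YT_def T2_order I1.map_simps mult_2 fps_map_nth I2.hom_0)
  moreover have "?X + ?V = lf (eU 2 3) + rf (eU 2 3) + lf (dU 3 - 2 * dU 2) * rf qU + lf (eU 4 3) * rf uU"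
    by (simp add: I1.map_simps distribs)
  ultimately show ?thesis
    using JT_conj[OF Z] by simp
qed

section \<open>The parabolic twist as a product\<close>

lemma is_inverse_mult:
  assumes "is_inverse x G" "is_inverse y H"
  shows "is_inverse (x * y) (H * G :: 'a::monoid_mult)"
proof -
  have *: "x * G = 1" "G * x = 1" "y * H = 1" "H * y = 1" using assms by (auto simp: is_inverse_def)
  have "x * y * (H * G) = x * (y * H) * G" "H * G * (x * y) = H * (G * x) * y" by (simp_all only: mult.assoc)
  then show ?thesis by (simp add: is_inverse_def *)
qed

context char0_algebra
begin

text \<open>The product of the first six factors with arbitrary elements in all places, so that it can be
  compared in different rings and moved past intertwiners.\<close>

definition twist_prod :: "'a fps \<Rightarrow> 'a fps \<Rightarrow> 'a fps \<Rightarrow> 'a fps \<Rightarrow> 'a fps \<Rightarrow> 'a fps \<Rightarrow> 'a fps \<Rightarrow> 'a fps \<Rightarrow> 'a fps" where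
  "twist_prod D C f a e q s w = Exp (D * Lnf (a + D * (fps_X * q))) * Exp (D * Lnf (1 - e)) * Exp (- (f * (C + D) * s)) * Exp (f * w)
     * Exp (f * q) * Exp ((C - D) * Lnf (a + C * (fps_X * q)))"

lemma intertw_twist_prod:
  assumes "intertw y D D'" "intertw y C C'" "intertw y f f'" "intertw y a a'" "intertw y e e'" "intertw y q q'" "intertw y s s'" "intertw y w w'"
    and "a $ 0 = 1" "e $ 0 = 0" "q $ 0 = 0" "s $ 0 = 0" "w $ 0 = 0"
    and "a' $ 0 = 1" "e' $ 0 = 0" "q' $ 0 = 0" "s' $ 0 = 0" "w' $ 0 = 0"
  shows "intertw y (twist_prod D C f a e q s w) (twist_prod D' C' f' a' e' q' s' w')"
  unfolding twist_prod_def
  by (intro intertw_mult intertw_Exp intertw_Ln intertw_add intertw_diff intertw_minus intertw_X intertw_1 assms(1-8))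
    (simp_all add: assms Ln_nth_0)

lemma twist_prod_0: "a $ 0 = 1 \<Longrightarrow> twist_prod 0 0 0 a e q s w = 1"
  by (simp add: twist_prod_def)

lemma twist_prod_1: "twist_prod D C f 1 0 0 0 0 = 1"
  by (simp add: twist_prod_def)

lemma Exp_nth_1: "x $ 0 = 0 \<Longrightarrow> Exp x $ 1 = x $ 1"
  and Ln_nth_1: "y $ 0 = 1 \<Longrightarrow> Lnf y $ 1 = y $ 1"
  by (simp_all add: fps_Exp_def fps_Ln_def fps_subst_def fps_ln_nth One_nat_def)

lemma twist_prod_nth:
  assumes "a $ 0 = 1" "e $ 0 = 0" "q $ 0 = 0" "s $ 0 = 0" "w $ 0 = 0"
  shows "twist_prod D C f a e q s w $ 0 = 1"
    and "twist_prod D C f a e q s w $ 1 = C $ 0 * a $ 1 - D $ 0 * e $ 1 - f $ 0 * (C $ 0 + D $ 0) * s $ 1 + f $ 0 * w $ 1 + f $ 0 * q $ 1"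
  by (simp_all add: twist_prod_def Exp_nth_0 Exp_nth_1 Ln_nth_0 Ln_nth_1 fps_mult_nth_1 assms algebra_simps)

lemma is_inverse_Exp: "x $ 0 = 0 \<Longrightarrow> is_inverse (Exp x) (Exp (- x))"
  by (simp add: is_inverse_def Exp_uminus)

lemma twist_prod_invertible:
  assumes "a $ 0 = 1" "e $ 0 = 0" "q $ 0 = 0" "s $ 0 = 0" "w $ 0 = 0"
  shows "\<exists>G. is_inverse (twist_prod D C f a e q s w) G"
proof -
  have m: "\<exists>G. is_inverse x G \<Longrightarrow> \<exists>G. is_inverse y G \<Longrightarrow> \<exists>G. is_inverse (x * y) G" for x y :: "'a fps"
    using is_inverse_mult by blast
  have E: "x $ 0 = 0 \<Longrightarrow> \<exists>G. is_inverse (Exp x) G" for x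
    using is_inverse_Exp by blast
  show ?thesis
    unfolding twist_prod_def
    by (intro m E) (simp_all add: Ln_nth_0 assms)
qed

lemma conj_quad_rels:
  assumes J: "J * JI = 1" "JI * J = 1" and "quad_rels a e q s w"
  shows "quad_rels (J * a * JI) (J * e * JI) (J * q * JI) (J * s * JI) (J * w * JI)"
proof -
  define c where "c x = J * x * JI" for x
  have [simp]: "c (x + y) = c x + c y" "c (x - y) = c x - c y" "c (fps_X * x) = fps_X * c x" for x y
    by (simp_all add: c_def algebra_simps X_left_comm[of J])
  have c_mult: "c (x * y) = c x * c y" for x y
    by (simp add: c_def mult.assoc assoc_rule[OF J(2)])
  have "J $ 0 * JI $ 0 = 1"
    using arg_cong[OF J(1), of "\<lambda>x. x $ 0"] by simp
  then have [simp]: "x $ 0 = 0 \<Longrightarrow> c x $ 0 = 0" "x $ 0 = 1 \<Longrightarrow> c x $ 0 = 1" for x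
    by (simp_all add: c_def)
  show ?thesis
    unfolding c_def[symmetric]
    using assms(3) unfolding quad_rels_def
    by (simp flip: c_mult)
qed

end

lemma (in quad_alg) T_twist_prod: "T D C f = twist_prod D C f a e q s w"
  by (simp add: T_def twist_prod_def A_def b_def)

lemma (in algebra_hom) map_twist_prod:
  "fps_map h (A.twist_prod D C f a e q u w) = B.twist_prod (fps_map h D) (fps_map h C) (fps_map h f) (fps_map h a) (fps_map h e) (fps_map h q) (fps_map h u) (fps_map h w)"
  by (simp add: A.twist_prod_def B.twist_prod_def map_simps)

definition aU :: "'k::field_char_0 usl4 fps" where "aU = 1 - fps_X * eU 2 3"
definition e34 :: "'k::field_char_0 usl4 fps" where "e34 = fps_X * eU 3 4"
definition sU :: "'k::field_char_0 usl4 fps" where "sU = fps_X * uU"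
definition lU :: "'k::field_char_0 usl4 fps" where "lU = fps_Ln usl4_scale xU"

definition GT :: "('k::field_char_0, 2) usl4_tensor fps" where
  "GT = TT.twist_prod (lf (dU 3)) (lf (dU 2)) (lf (eU 4 3)) (rf aU) (rf e34) (rf qU) (rf sU) (rf wU)"

lemma quad_gens_nth_0 [simp]: "aU $ 0 = 1" "e34 $ 0 = 0" "sU $ 0 = 0"
  by (simp_all add: aU_def e34_def sU_def)

lemma quad_rels_gens: "quad_rels aU e34 qU sU wU"
  unfolding aU_def e34_def sU_def by (rule quad_rels_U)

lemma JT_eq: "JT = eT YT * eT (lf (dU 1) * rf lU)"
  by (simp add: JT_def ZT_def lU_def)

lemma twist_p_eq: "twist_p = GT * (JT :: ('k::field_char_0, 2) usl4_tensor fps)"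
proof -
  have one: "lf (1 :: 'k usl4 fps) = 1" "rf (1 :: 'k usl4 fps) = 1" by (rule I1.map_1 I2.map_1)+
  have X2: "fps_X ^ 2 * (lf v * rf g) = lf v * (fps_X * (fps_X * rf g))" for v g :: "'k usl4 fps"
    by (simp add: power2_eq_square mult.assoc X_left_comm[of "lf v"])
  have X1: "fps_X * (lf v * rf g) = lf v * (fps_X * rf g)" for v g :: "'k usl4 fps"
    by (simp add: X_left_comm[of "lf v"])
  have w: "fps_X * rf (eU 2 4 - fps_X * eU 3 4 * eU 1 3 * yU) = rf (wU :: 'k usl4 fps)"
    by (simp add: wU_def qU_def I2.map_simps right_diff_distrib mult.assoc X_left_comm[of "rf _"])
  have y: "fps_Exp usl4_scale (- lU) = (yU :: 'k usl4 fps)"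
    by (simp add: yU_def lU_def)
  have q: "rf qU = fps_X * rf (eU 1 3 * yU :: 'k usl4 fps)" and u: "rf uU = fps_X * rf (eU 1 4 * yU :: 'k usl4 fps)"
    and s: "rf sU = fps_X * (fps_X * rf (eU 1 4 * yU :: 'k usl4 fps))"
    and a: "rf aU = 1 - fps_X * rf (eU 2 3 :: 'k usl4 fps)" and e: "rf e34 = fps_X * rf (eU 3 4 :: 'k usl4 fps)"
    by (simp_all add: qU_def uU_def sU_def aU_def e34_def I2.map_mult I2.map_X I2.map_1 I2.map_diff)
  show ?thesis
    unfolding twist_p_def Let_def tensor_powr_def eU_def[symmetric] dU_def[symmetric] xU_def[symmetric] lU_def[symmetric] y fps_tensor_eq one
      mult_1_left mult_1_right X1 X2 w
    by (simp only: GT_def TT.twist_prod_def JT_eq YT_def q u s a e I1.map_diff I1.map_mult I1.map_add mult.assoc add.commute[of "dU 2"])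
      (simp only: add.commute)
qed

section \<open>Counits, invertibility and the classical r-matrix\<close>

lemma counit_gen: "usl4_counit (E\<^sub>U i j) = 0" "usl4_counit (D\<^sub>U p) = 0" "usl4_counit 0 = 0"
  using usl4_counit_simps(5)[of 0 0] by (simp_all add: E\<^sub>U_def D\<^sub>U_def usl4_counit_simps)

lemma EI_lf: "fps_map counit_id (lf (eU i j)) = 0" "fps_map counit_id (lf (dU p)) = 0"
  and EI_rf: "fps_map counit_id (rf v) = v"
  by (simp_all add: fps_eq_iff fps_map_nth structure_maps_tensor2 usl4_counit_simps)
    (simp_all add: eU_def dU_def structure_maps_tensor2 counit_gen usl4_counit_simps)

lemma IE_rf: "fps_map id_counit (rf (eU i j)) = 0"
  and IE_lf: "fps_map id_counit (lf v) = v"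
  by (simp_all add: fps_eq_iff fps_map_nth structure_maps_tensor2 usl4_counit_simps)
    (simp_all add: eU_def structure_maps_tensor2 counit_gen usl4_counit_simps)

lemma counits:
  "fps_map counit_id twist_p = (1 :: 'k::field_char_0 usl4 fps)" "fps_map id_counit twist_p = (1 :: 'k::field_char_0 usl4 fps)"
proof -
  show "fps_map counit_id twist_p = (1 :: 'k usl4 fps)"
    by (simp add: twist_p_eq GT_def JT_eq YT_def EI.map_mult EI.map_add EI.map_Exp EI.map_twist_prod EI_lf EI_rf U.twist_prod_0)
  have gens: "fps_map id_counit (rf qU) = (0 :: 'k usl4 fps)" "fps_map id_counit (rf uU) = (0 :: 'k usl4 fps)"
    "fps_map id_counit (rf sU) = (0 :: 'k usl4 fps)" "fps_map id_counit (rf wU) = (0 :: 'k usl4 fps)"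
    "fps_map id_counit (rf aU) = (1 :: 'k usl4 fps)" "fps_map id_counit (rf e34) = (0 :: 'k usl4 fps)"
    "fps_map id_counit (rf lU) = (0 :: 'k usl4 fps)"
    by (simp_all add: qU_def uU_def sU_def wU_def aU_def e34_def lU_def xU_def I2.map_simps IE.map_simps IE_rf)
  show "fps_map id_counit twist_p = (1 :: 'k usl4 fps)"
    by (simp add: twist_p_eq GT_def JT_eq YT_def IE.map_mult IE.map_add IE.map_Exp IE.map_twist_prod IE_lf gens U.twist_prod_1)
qed

lemma rf_gens_nth_0 [simp]: "rf aU $ 0 = 1" "rf e34 $ 0 = 0" "rf qU $ 0 = 0" "rf sU $ 0 = 0" "rf wU $ 0 = 0" "rf uU $ 0 = 0" "rf lU $ 0 = 0"
  by (simp_all add: fps_map_nth I2.hom_0 I2.hom_1 lU_def U.Ln_nth_0)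

lemma JT_inverse: "is_inverse JT (eT (- ZT) * eT (- YT))"
  unfolding JT_def by (intro is_inverse_mult TT.is_inverse_Exp) simp_all

lemma twist_invertible: "\<exists>G. is_inverse (twist_p :: ('k::field_char_0, 2) usl4_tensor fps) G"
proof -
  obtain G where "is_inverse (GT :: ('k, 2) usl4_tensor fps) G"
    unfolding GT_def using TT.twist_prod_invertible[OF rf_gens_nth_0(1-5)] by blast
  then show ?thesis
    unfolding twist_p_eq using is_inverse_mult[OF _ JT_inverse] by blast
qed

lemma twist_nth:
  "twist_p $ 0 = (1 :: ('k::field_char_0, 2) usl4_tensor)"
  "twist_p $ 1 = E\<^sub>U 4 3 \<otimes> E\<^sub>U 2 4 + E\<^sub>U 4 3 \<otimes> E\<^sub>U 1 3 + E\<^sub>U 3 2 \<otimes> E\<^sub>U 1 3 + E\<^sub>U 4 2 \<otimes> E\<^sub>U 1 4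
     - D\<^sub>U 2 \<otimes> E\<^sub>U 2 3 - D\<^sub>U 3 \<otimes> E\<^sub>U 3 4 - D\<^sub>U 1 \<otimes> (E\<^sub>U 1 2 :: 'k usl4)"
proof -
  have y: "yU $ 0 = (1 :: 'k usl4)" by (simp add: yU_def U.Exp_nth_0)
  have nth: "(fps_X * x) $ 1 = (x $ 0 :: 'k usl4)" for x by (simp add: fps_mult_nth_1)
  have gens: "rf aU $ 1 = 1 \<otimes> (- E\<^sub>U 2 3 :: 'k usl4)" "rf e34 $ 1 = 1 \<otimes> (E\<^sub>U 3 4 :: 'k usl4)" "rf qU $ 1 = 1 \<otimes> (E\<^sub>U 1 3 :: 'k usl4)"
    "rf uU $ 1 = 1 \<otimes> (E\<^sub>U 1 4 :: 'k usl4)" "rf sU $ 1 = (0 :: ('k, 2) usl4_tensor)" "rf wU $ 1 = 1 \<otimes> (E\<^sub>U 2 4 :: 'k usl4)"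
    "rf lU $ 1 = 1 \<otimes> (- E\<^sub>U 1 2 :: 'k usl4)"
    by (simp_all add: fps_map_nth aU_def e34_def qU_def uU_def sU_def wU_def lU_def U.Ln_nth_1 nth y eU_def I2.hom_0)
      (simp_all add: xU_def nth eU_def)
  have lf0: "lf (eU i j) $ 0 = E\<^sub>U i j \<otimes> 1" "lf (dU p) $ 0 = D\<^sub>U p \<otimes> (1 :: 'k usl4)" for i j p
    by (simp_all add: fps_map_nth eU_def dU_def)
  have G: "GT $ 0 = (1 :: ('k, 2) usl4_tensor)"
    "GT $ 1 = D\<^sub>U 2 \<otimes> (- E\<^sub>U 2 3 :: 'k usl4) - D\<^sub>U 3 \<otimes> E\<^sub>U 3 4 + E\<^sub>U 4 3 \<otimes> E\<^sub>U 2 4 + E\<^sub>U 4 3 \<otimes> E\<^sub>U 1 3"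
    unfolding GT_def by (simp_all add: TT.twist_prod_nth gens lf0 tensor2_mult)
  have J: "JT $ 0 = (1 :: ('k, 2) usl4_tensor)"
    "JT $ 1 = E\<^sub>U 3 2 \<otimes> E\<^sub>U 1 3 + E\<^sub>U 4 2 \<otimes> E\<^sub>U 1 4 + D\<^sub>U 1 \<otimes> (- E\<^sub>U 1 2 :: 'k usl4)"
    unfolding JT_eq YT_def by (simp_all add: TT.Exp_nth_0 TT.Exp_nth_1 fps_mult_nth_1 gens lf0 tensor2_mult)
  have neg: "a \<otimes> (- b) = - (a \<otimes> b)" for a b :: "'k usl4"
    using tensor2_add_right[of a b "- b"] tensor2_add_right[of a 0 0] by (simp add: add_eq_0_iff)
  show "twist_p $ 0 = (1 :: ('k, 2) usl4_tensor)" by (simp add: twist_p_eq G J)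
  show "twist_p $ 1 = E\<^sub>U 4 3 \<otimes> E\<^sub>U 2 4 + E\<^sub>U 4 3 \<otimes> E\<^sub>U 1 3 + E\<^sub>U 3 2 \<otimes> E\<^sub>U 1 3 + E\<^sub>U 4 2 \<otimes> E\<^sub>U 1 4
     - D\<^sub>U 2 \<otimes> E\<^sub>U 2 3 - D\<^sub>U 3 \<otimes> E\<^sub>U 3 4 - D\<^sub>U 1 \<otimes> (E\<^sub>U 1 2 :: 'k usl4)"
    by (simp add: twist_p_eq fps_mult_nth_1 G J neg)
qed

text \<open>To first order \<open>F\<^sub>2\<^sub>1 F\<^sup>-\<^sup>1\<close> is \<open>1\<close> plus the flip of the linear term of \<open>F\<close> minus that term.\<close>

lemma universal_R_expansion:
  "\<exists>X. universal_R (twist_p :: ('k::field_char_0, 2) usl4_tensor fps) = fps_const (1 \<otimes> 1) + fps_X * fps_const r_p + fps_X ^ 2 * X"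
proof -
  obtain G where G: "is_inverse (twist_p :: ('k, 2) usl4_tensor fps) G"
    using twist_invertible by blast
  then have FG: "twist_p * G = 1" by (simp add: is_inverse_def)
  have G0: "G $ 0 = 1" using arg_cong[OF FG, of "\<lambda>x. x $ 0"] by (simp add: twist_nth(1))
  have G1: "G $ 1 = - (twist_p $ 1)"
    using arg_cong[OF FG, of "\<lambda>x. x $ 1"] by (simp add: fps_mult_nth_1 twist_nth(1) G0 add_eq_0_iff)
  have add: "tensor_flip (t + u) = tensor_flip t + tensor_flip u" for t u :: "('k, 2) usl4_tensor"
    by (simp add: tensor_flip_def lift_simps)
  have diff: "tensor_flip (t - u) = tensor_flip t - tensor_flip u" for t u :: "('k, 2) usl4_tensor"
    using add[of "t - u" u] by (simp add: algebra_simps)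
  define R where "R = universal_R (twist_p :: ('k, 2) usl4_tensor fps)"
  have R: "R = fps_map tensor_flip twist_p * G"
    unfolding R_def universal_R_def ring_inverse_eq[OF G] ..
  have flip1: "tensor_flip 1 = (1 :: ('k, 2) usl4_tensor)"
    using structure_maps_tensor2(1)[of "1 :: 'k usl4" 1] by (simp add: tensor2_one)
  have R0: "R $ 0 = 1" by (simp add: R fps_map_nth twist_nth(1) G0 flip1)
  have R1: "R $ 1 = r_p"
  proof -
    have "R $ 1 = tensor_flip (twist_p $ 1) - twist_p $ 1"
      by (simp add: R fps_mult_nth_1 fps_map_nth twist_nth(1) G0 flip1 G1)
    then show ?thesis
      unfolding twist_nth(2) by (simp add: add diff structure_maps_tensor2 r_p_def wedge_def)
  qed
  have "R = fps_const (1 \<otimes> 1) + fps_X * fps_const r_p + fps_X ^ 2 * fps_shift 2 R"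
  proof (rule fps_ext)
    fix n
    consider "n = 0" | "n = 1" | m where "n = Suc (Suc m)" by (metis not0_implies_Suc One_nat_def)
    then show "R $ n = (fps_const (1 \<otimes> 1) + fps_X * fps_const r_p + fps_X ^ 2 * fps_shift 2 R) $ n"
    proof cases
      case 3
      have "(fps_X ^ 2 * fps_shift 2 R) $ n = R $ n"
        by (simp add: 3 power2_eq_square mult.assoc)
      then show ?thesis by (simp add: 3)
    qed (simp_all add: R0 R1[unfolded One_nat_def] tensor2_one power2_eq_square mult.assoc One_nat_def)
  qed
  then show ?thesis unfolding R_def ..
qed

section \<open>Three tensor factors\<close>

interpretation J1: algebra_hom usl4_scale tensor_scale "\<lambda>a :: 'k::field_char_0 usl4. tensor3 a 1 1"
  by unfold_locales (simp_all add: tensor3_add tensor3_scale tensor3_mult tensor3_one)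

interpretation J2: algebra_hom usl4_scale tensor_scale "\<lambda>a :: 'k::field_char_0 usl4. tensor3 1 a 1"
  by unfold_locales (simp_all add: tensor3_add tensor3_scale tensor3_mult tensor3_one)

abbreviation j1 :: "'k::field_char_0 usl4 fps \<Rightarrow> ('k, 3) usl4_tensor fps" where "j1 \<equiv> fps_map (\<lambda>a. tensor3 a 1 1)"
abbreviation j2 :: "'k::field_char_0 usl4 fps \<Rightarrow> ('k, 3) usl4_tensor fps" where "j2 \<equiv> fps_map (\<lambda>a. tensor3 1 a 1)"
abbreviation j3 :: "'k::field_char_0 usl4 fps \<Rightarrow> ('k, 3) usl4_tensor fps" where "j3 \<equiv> fps_map (\<lambda>a. tensor3 1 1 a)"
abbreviation delta :: "'k::field_char_0 usl4 fps \<Rightarrow> ('k, 2) usl4_tensor fps" where "delta \<equiv> fps_map usl4_comult"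

lemma legs:
  "fps_map leg12 (lf v) = j1 v" "fps_map leg12 (rf v) = j2 v" "fps_map leg23 (lf v) = j2 v" "fps_map leg23 (rf v) = j3 v"
  by (simp_all add: fps_eq_iff fps_map_nth leg12_def leg23_def tensor_append_simps tensor_prepend_simps)

lemma coproduct_legs:
  "fps_map comult_id (lf v) = fps_map leg12 (delta v)" "fps_map comult_id (rf v) = j3 v"
  "fps_map id_comult (lf v) = j1 v" "fps_map id_comult (rf v) = fps_map leg23 (delta v)"
  by (simp_all add: fps_eq_iff fps_map_nth leg12_def leg23_def structure_maps_tensor2 usl4_comult_simps
      tensor2_one[symmetric] tensor_append_simps tensor_prepend_simps)

lemma slots: "j2 b * j1 a = j1 a * j2 b" "j3 b * j1 a = j1 a * j3 b" "j3 b * j2 a = j2 a * j3 b"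
  by (rule fps_map_commute, simp add: tensor3_mult)+

lemma leg_slots: "fps_map leg12 t * j3 v = j3 v * fps_map leg12 t" "fps_map leg23 t * j1 v = j1 v * fps_map leg23 t"
proof -
  have "leg12 u * tensor3 1 1 a = tensor3 1 1 a * leg12 u" for u :: "('k::field_char_0, 2) usl4_tensor" and a
    using tensor_append_mult[of u 1 1 a] tensor_append_mult[of 1 u a 1]
    by (simp add: leg12_def tensor_append_simps(1)[symmetric] tensor2_one)
  then show "fps_map leg12 t * j3 v = j3 v * fps_map leg12 t" by (rule fps_map_commute)
  have "leg23 u * tensor3 a 1 1 = tensor3 a 1 1 * leg23 u" for u :: "('k::field_char_0, 2) usl4_tensor" and a
    using tensor_prepend_mult[of 1 a u 1] tensor_prepend_mult[of a 1 1 u]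
    by (simp add: leg23_def tensor_prepend_simps(1)[symmetric] tensor2_one)
  then show "fps_map leg23 t * j1 v = j1 v * fps_map leg23 t" by (rule fps_map_commute)
qed

section \<open>The cocycle identity of the extended Jordanian twist\<close>

lemma l_comm_if: "xU * v = v * xU \<Longrightarrow> lU * v = v * (lU :: 'k::field_char_0 usl4 fps)"
proof -
  assume "xU * v = v * (xU :: 'k usl4 fps)"
  then have "U.intertw v xU xU" by (simp add: U.intertw_def)
  then have "U.intertw v lU lU" unfolding lU_def by (intro U.intertw_Ln) auto
  then show "lU * v = v * lU" by (simp add: U.intertw_def)
qed

lemma l_comm: "lU * eU 3 2 = eU 3 2 * lU" "lU * eU 4 2 = eU 4 2 * lU" "lU * qU = qU * lU" "lU * uU = uU * lU"
  by (rule l_comm_if; simp add: x_comm q_rules)+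

lemma JT_l: "JT * delta lU = (lf lU + rf lU) * (JT :: ('k::field_char_0, 2) usl4_tensor fps)"
proof -
  let ?x = "xU :: 'k usl4 fps"
  have "TT.intertw JT (delta ?x) (lf ?x * rf ?x)"
    by (simp add: TT.intertw_def JT_x)
  then have "TT.intertw JT (fps_Ln tensor_scale (delta ?x)) (fps_Ln tensor_scale (lf ?x * rf ?x))"
    by (rule TT.intertw_Ln[rotated 2]) (simp_all add: fps_map_nth CM.hom_1 I1.hom_1 I2.hom_1)
  moreover have "fps_Ln tensor_scale (lf ?x * rf ?x) = lf lU + rf lU"
    by (subst TT.Ln_mult) (simp_all add: fps_map_nth I1.hom_1 I2.hom_1 rf_lf lU_def I1.map_Ln I2.map_Ln)
  ultimately show ?thesis
    by (simp add: TT.intertw_def lU_def CM.map_Ln)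
qed

lemma Exp_commute:
  assumes "x $ 0 = 0" "y $ 0 = 0" "x * y = y * x"
  shows "fps_Exp tensor_scale x * fps_Exp tensor_scale y = fps_Exp tensor_scale y * (fps_Exp tensor_scale x :: ('k::field_char_0, 3) usl4_tensor fps)"
  using TT.Exp_add[OF assms] TT.Exp_add[OF assms(2,1) assms(3)[symmetric]] by (simp add: add.commute)

lemma slot_gens_nth_0 [simp]:
  "j2 aU $ 0 = 1" "j2 e34 $ 0 = 0" "j2 qU $ 0 = 0" "j2 sU $ 0 = 0" "j2 wU $ 0 = 0" "j2 uU $ 0 = 0" "j2 lU $ 0 = 0"
  "j3 aU $ 0 = 1" "j3 e34 $ 0 = 0" "j3 qU $ 0 = 0" "j3 sU $ 0 = 0" "j3 wU $ 0 = 0" "j3 uU $ 0 = 0" "j3 lU $ 0 = 0"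
  by (simp_all add: fps_map_nth J2.hom_0 J2.hom_1 J3.hom_0 J3.hom_1 lU_def U.Ln_nth_0)

text \<open>With \<open>Y\<^sub>i\<^sub>j\<close>, \<open>Z\<^sub>i\<^sub>j\<close> the exponents of \<open>J\<^sub>i\<^sub>j\<close>, the left side is \<open>J\<^sub>1\<^sub>2 exp(Y\<^sub>1\<^sub>3 + Y\<^sub>2\<^sub>3) exp(Z\<^sub>1\<^sub>3 + Z\<^sub>2\<^sub>3)\<close>. On the right
  \<open>J\<^sub>2\<^sub>3\<close> makes \<open>q\<close>, \<open>u\<close>, \<open>\<sigma>\<close> primitive and so gives \<open>exp(Y\<^sub>1\<^sub>2 + Y\<^sub>1\<^sub>3) exp(Z\<^sub>1\<^sub>2 + Z\<^sub>1\<^sub>3) J\<^sub>2\<^sub>3\<close>.\<close>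

lemma JT_cocycle:
  "fps_map leg12 JT * fps_map comult_id JT = fps_map leg23 JT * (fps_map id_comult JT :: ('k::field_char_0, 3) usl4_tensor fps)"
proof -
  define Y12 Y13 Y23 :: "('k, 3) usl4_tensor fps" where
    Y: "Y12 = j1 (eU 3 2) * j2 qU + j1 (eU 4 2) * j2 uU"
       "Y13 = j1 (eU 3 2) * j3 qU + j1 (eU 4 2) * j3 uU"
       "Y23 = j2 (eU 3 2) * j3 qU + j2 (eU 4 2) * j3 uU"
  define Z12 Z13 Z23 :: "('k, 3) usl4_tensor fps" where
    Z: "Z12 = j1 (dU 1) * j2 lU" "Z13 = j1 (dU 1) * j3 lU" "Z23 = j2 (dU 1) * j3 lU"
  let ?E = "fps_Exp tensor_scale :: ('k, 3) usl4_tensor fps \<Rightarrow> _"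
  have [simp]: "Y12 $ 0 = 0" "Y13 $ 0 = 0" "Y23 $ 0 = 0" "Z12 $ 0 = 0" "Z13 $ 0 = 0" "Z23 $ 0 = 0"
    by (simp_all add: Y Z)
  note U = brackets_32(6) weights(4,5) q_rules(17) l_comm
  note j = U[THEN arg_cong[of _ _ j1], unfolded J1.map_mult] U[THEN arg_cong[of _ _ j2], unfolded J2.map_mult]
    U[THEN arg_cong[of _ _ j3], unfolded J3.map_mult]
  note order = distribs mult.assoc slots slots[THEN assoc_rule] j j[THEN assoc_rule]
  have comm: "Z12 * Y13 = Y13 * Z12" "Z12 * Y23 = Y23 * Z12" "Z13 * Y23 = Y23 * Z13"
    "Y13 * Y23 = Y23 * Y13" "Y12 * Y13 = Y13 * Y12" "Z13 * Z23 = Z23 * Z13" "Z12 * Z13 = Z13 * Z12"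
    unfolding Y Z by (simp_all add: order add_ac)
  have J12: "fps_map leg12 JT = ?E Y12 * ?E Z12" and J23: "fps_map leg23 JT = ?E Y23 * ?E Z23"
    by (simp_all add: JT_eq YT_def Y Z L12.map_mult L12.map_add L12.map_Exp L23.map_mult L23.map_add L23.map_Exp legs)
  have CI: "fps_map comult_id JT = ?E (Y13 + Y23) * ?E (Z13 + Z23)"
    by (simp add: JT_eq YT_def Y Z CI.map_mult CI.map_add CI.map_Exp coproduct_legs comult_eU comult_dU L12.map_add legs distribs add_ac)
  have IC: "fps_map id_comult JT
      = ?E (j1 (eU 3 2) * fps_map leg23 (delta qU) + j1 (eU 4 2) * fps_map leg23 (delta uU)) * ?E (j1 (dU 1) * fps_map leg23 (delta lU))"
    by (simp add: JT_eq YT_def IC.map_mult IC.map_add IC.map_Exp coproduct_legs)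
  let ?J = "fps_map leg23 JT :: ('k, 3) usl4_tensor fps"
  have J: "?J * fps_map leg23 (delta v) = (j2 v + j3 v) * ?J" if "JT * delta v = (lf v + rf v) * JT" for v
    using arg_cong[OF that, of "fps_map leg23"] by (simp add: L23.map_mult L23.map_add legs)
  have J1: "?J * (j1 g * t) = j1 g * (?J * t)" for g t
    by (simp add: leg_slots(2)[THEN assoc_rule] mult.assoc)
  have "TT.intertw ?J (j1 (eU 3 2) * fps_map leg23 (delta qU) + j1 (eU 4 2) * fps_map leg23 (delta uU)) (Y12 + Y13)"
    unfolding TT.intertw_def Y by (simp add: distrib_left distrib_right J1 J[OF JT_q(1)] J[OF JT_q(2)] mult.assoc add_ac)
  then have iY: "TT.intertw ?J (?E (j1 (eU 3 2) * fps_map leg23 (delta qU) + j1 (eU 4 2) * fps_map leg23 (delta uU))) (?E (Y12 + Y13))"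
    by (rule TT.intertw_Exp[rotated 2]) (simp_all add: fps_map_nth CM.hom_0 L23.hom_0)
  have "TT.intertw ?J (j1 (dU 1) * fps_map leg23 (delta lU)) (Z12 + Z13)"
    unfolding TT.intertw_def Z by (simp add: distrib_left distrib_right J1 J[OF JT_l] mult.assoc)
  then have iZ: "TT.intertw ?J (?E (j1 (dU 1) * fps_map leg23 (delta lU))) (?E (Z12 + Z13))"
    by (rule TT.intertw_Exp[rotated 2]) (simp_all add: fps_map_nth CM.hom_0 L23.hom_0 lU_def U.Ln_nth_0)
  have R: "?J * fps_map id_comult JT = ?E (Y12 + Y13) * ?E (Z12 + Z13) * ?J"
    using TT.intertw_mult[OF iY iZ] by (simp add: TT.intertw_def IC)
  have add: "?E (Y13 + Y23) = ?E Y13 * ?E Y23" "?E (Z13 + Z23) = ?E Z13 * ?E Z23"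
    "?E (Y12 + Y13) = ?E Y12 * ?E Y13" "?E (Z12 + Z13) = ?E Z12 * ?E Z13"
    by (simp_all add: TT.Exp_add comm)
  have c: "?E Z12 * ?E Y13 = ?E Y13 * ?E Z12" "?E Z12 * ?E Y23 = ?E Y23 * ?E Z12" "?E Z13 * ?E Y23 = ?E Y23 * ?E Z13"
    by (simp_all add: Exp_commute comm)
  show ?thesis
    unfolding R unfolding J12 J23 CI add
    by (simp add: mult.assoc c c[THEN assoc_rule])
qed

section \<open>The cocycle identity of the parabolic twist\<close>

definition JI :: "('k::field_char_0, 2) usl4_tensor fps" where "JI = eT (- ZT) * eT (- YT)"

text \<open>The twisted coproduct \<open>\<Delta>\<^sub>J\<close>; as a conjugate of a homomorphism it respects \<open>quad_rels\<close>.\<close>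

definition hat :: "'k::field_char_0 usl4 fps \<Rightarrow> ('k, 2) usl4_tensor fps" where "hat v = JT * delta v * JI"

lemma JT_JI: "JT * JI = 1" "JI * JT = 1"
  using JT_inverse unfolding is_inverse_def JI_def by blast+

lemma hatI: "JT * delta v = h * JT \<Longrightarrow> hat v = h"
  by (simp add: hat_def mult.assoc JT_JI)

lemma JT_delta: "JT * delta v = hat v * JT"
  by (simp add: hat_def mult.assoc JT_JI)

lemma quad_rels_hat: "quad_rels (hat aU) (hat e34) (hat qU) (hat sU) (hat wU)"
  unfolding hat_def by (rule TT.conj_quad_rels[OF JT_JI CM.map_quad_rels[OF quad_rels_gens]])

lemma hat_eqs:
  "hat aU = lf aU + rf aU - 1 + (2 * lf (dU 2) - lf (dU 3)) * (fps_X * rf qU) - lf (eU 4 3) * rf (sU :: 'k::field_char_0 usl4 fps)"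
  "hat e34 = lf e34 + rf (e34 :: 'k usl4 fps)" "hat qU = lf qU + rf (qU :: 'k usl4 fps)" "hat sU = lf sU + rf (sU :: 'k usl4 fps)"
proof -
  have JX: "JT * (fps_X * t) = fps_X * (JT * t)" for t :: "('k, 2) usl4_tensor fps"
    by (rule X_left_comm)
  let ?t = "lf (eU 2 3) + rf (eU 2 3) + lf (dU 3 - 2 * dU 2) * rf qU + lf (eU 4 3) * rf uU :: ('k, 2) usl4_tensor fps"
  have "JT * delta aU = JT - fps_X * (JT * (lf (eU 2 3) + rf (eU 2 3)) :: ('k, 2) usl4_tensor fps)"
    by (simp add: aU_def CM.map_simps comult_eU right_diff_distrib JX)
  also have "\<dots> = (1 - fps_X * ?t) * JT"
    unfolding JT_23 by (simp add: left_diff_distrib mult.assoc)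
  finally have "hat aU = 1 - fps_X * ?t" by (rule hatI)
  then show "hat aU = lf aU + rf aU - 1 + (2 * lf (dU 2) - lf (dU 3)) * (fps_X * rf qU) - lf (eU 4 3) * rf (sU :: 'k usl4 fps)"
    by (simp add: aU_def sU_def I1.map_simps I2.map_simps distribs mult.assoc X_left_comm[of "lf _"] X_left_comm[of 2])
  show "hat qU = lf qU + rf (qU :: 'k usl4 fps)" by (rule hatI) (rule JT_q)
  show "hat sU = lf sU + rf (sU :: 'k usl4 fps)"
    by (rule hatI) (simp add: sU_def CM.map_simps I1.map_simps I2.map_simps JX JT_q distribs mult.assoc)
  show "hat e34 = lf e34 + rf (e34 :: 'k usl4 fps)"
    by (rule hatI) (simp add: e34_def CM.map_simps I1.map_simps I2.map_simps JX JT_comm_primitive comult_eU mult.assoc distrib_left[symmetric])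
qed

lemma gen_weights:
  "dU 3 * e34 = e34 * (dU 3 + 1)" "dU 2 * e34 = e34 * dU 2"
  "e34 * eU 4 3 = eU 4 3 * e34 + fps_X * (2 * dU 3 - dU 2)"
  "dU 2 * (aU - 1) = (aU - 1) * (dU 2 + 1)" "dU 3 * aU = aU * dU 3" "eU 4 3 * aU = aU * eU 4 3"
  "dU 2 * qU = qU * (dU 2 + 1)" "dU 3 * qU = qU * dU 3" "eU 4 3 * qU = qU * eU 4 3"
  "dU 2 * sU = sU * (dU 2 + 1)" "dU 3 * sU = sU * (dU 3 + 1)" "sU * eU 4 3 = eU 4 3 * sU + fps_X * qU"
  "eU 4 3 * dU 3 = (dU 3 + 1) * eU 4 3" "eU 4 3 * dU 2 = dU 2 * eU 4 3"
  by (simp_all add: e34_def aU_def sU_def distribs mult.assoc X_front weights q_rules brackets_pos Cartan_brackets)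

lemma GT_cocycle:
  "fps_map leg12 GT * fps_map comult_id GT = fps_map leg23 GT *
    TT.twist_prod (j1 (dU 3)) (j1 (dU 2)) (j1 (eU 4 3)) (fps_map leg23 (hat aU)) (fps_map leg23 (hat e34)) (fps_map leg23 (hat qU))
      (fps_map leg23 (hat sU)) (fps_map leg23 (hat wU :: ('k::field_char_0, 2) usl4_tensor fps))"
proof -
  let ?h = "\<lambda>v. fps_map leg23 (hat v) :: ('k, 3) usl4_tensor fps"
  interpret M2: quad_alg "tensor_scale :: 'k \<Rightarrow> ('k, 3) usl4_tensor \<Rightarrow> _" "j2 aU" "j2 e34" "j2 qU" "j2 sU" "j2 wU"
    by unfold_locales (rule J2.map_quad_rels[OF quad_rels_gens])
  interpret M3: quad_alg "tensor_scale :: 'k \<Rightarrow> ('k, 3) usl4_tensor \<Rightarrow> _" "j3 aU" "j3 e34" "j3 qU" "j3 sU" "j3 wU"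
    by unfold_locales (rule J3.map_quad_rels[OF quad_rels_gens])
  interpret MH: quad_alg "tensor_scale :: 'k \<Rightarrow> ('k, 3) usl4_tensor \<Rightarrow> _" "?h aU" "?h e34" "?h qU" "?h sU" "?h wU"
    by unfold_locales (rule L23.map_quad_rels[OF quad_rels_hat])
  have d: "fps_const (tensor3 (D\<^sub>U p) 1 1) = j1 (dU p)" "fps_const (tensor3 1 (D\<^sub>U p) 1) = j2 (dU p :: 'k usl4 fps)" for p
    by (simp_all add: dU_def J1.map_const J2.map_const)
  note w1 = gen_weights(13,14)[THEN arg_cong[of _ _ j1], unfolded J1.map_simps]
  note w2 = gen_weights[THEN arg_cong[of _ _ j2], unfolded J2.map_simps]
  have dd: "D\<^sub>U 2 * D\<^sub>U 3 = D\<^sub>U 3 * (D\<^sub>U 2 :: 'k usl4)" by (rule D_D_bracket) simp_all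
  interpret twist_data "tensor_scale :: 'k \<Rightarrow> ('k, 3) usl4_tensor \<Rightarrow> _" "j2 aU" "j2 e34" "j2 qU" "j2 sU" "j2 wU"
    "j3 aU" "j3 e34" "j3 qU" "j3 sU" "j3 wU" "?h aU" "?h e34" "?h qU" "?h sU" "?h wU"
    "tensor3 (D\<^sub>U 2) 1 1" "tensor3 (D\<^sub>U 3) 1 1" "tensor3 1 (D\<^sub>U 2) 1" "tensor3 1 (D\<^sub>U 3) 1" "j1 (eU 4 3)" "j2 (eU 4 3)"
    unfolding twist_data_def twist_data_axioms_def
    by (intro conjI M2.quad_alg_axioms M3.quad_alg_axioms MH.quad_alg_axioms;
        (simp only: d M2.cg_def M3.cg_def MH.cg_def slots leg_slots w1 w2 simp_thms tensor3_mult dd mult_1_left mult_1_right)?)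
      (simp_all add: hat_eqs L23.map_simps legs)
  have "M2.T (j1 (dU 3)) (j1 (dU 2)) (j1 (eU 4 3)) * M3.T (j1 (dU 3) + j2 (dU 3)) (j1 (dU 2) + j2 (dU 2)) (j1 (eU 4 3) + j2 (eU 4 3))
      = M3.T (j2 (dU 3)) (j2 (dU 2)) (j2 (eU 4 3)) * MH.T (j1 (dU 3)) (j1 (dU 2)) (j1 (eU 4 3))"
    using cocycle unfolding d .
  then show ?thesis
    by (simp add: M2.T_twist_prod M3.T_twist_prod MH.T_twist_prod GT_def L12.map_twist_prod L23.map_twist_prod CI.map_twist_prod legs coproduct_legs comult_eU comult_dU L12.map_add)
qed

text \<open>\<open>J\<^sub>1\<^sub>2\<close> commutes with \<open>(\<Delta> \<otimes> id)(G)\<close>, whose first two tensor factors carry coproducts of elements that stay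
  primitive under \<open>\<Delta>\<^sub>J\<close>, and \<open>J\<^sub>2\<^sub>3\<close> turns \<open>(id \<otimes> \<Delta>)(G)\<close> into \<open>(id \<otimes> \<Delta>\<^sub>J)(G)\<close>. What remains are the two
  Drinfeld equations \<open>GT_cocycle\<close> and \<open>JT_cocycle\<close>.\<close>

lemma twist_cocycle:
  "fps_map leg12 twist_p * fps_map comult_id twist_p = fps_map leg23 twist_p * (fps_map id_comult twist_p :: ('k::field_char_0, 3) usl4_tensor fps)"
proof -
  let ?J12 = "fps_map leg12 JT :: ('k, 3) usl4_tensor fps" and ?J23 = "fps_map leg23 JT :: ('k, 3) usl4_tensor fps"
  let ?h = "\<lambda>v. fps_map leg23 (hat v) :: ('k, 3) usl4_tensor fps"
  let ?T = "TT.twist_prod (j1 (dU 3)) (j1 (dU 2)) (j1 (eU 4 3)) (?h aU) (?h e34) (?h qU) (?h sU) (?h wU)"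
  have prim: "TT.intertw ?J12 (j1 v + j2 v) (j1 v + j2 v)" if "JT * (lf v + rf v) = (lf v + rf v) * JT" for v
    using arg_cong[OF that, of "fps_map leg12"] by (simp add: TT.intertw_def L12.map_mult L12.map_add legs)
  have "TT.intertw ?J12 (fps_map comult_id GT) (fps_map comult_id GT)"
    unfolding GT_def CI.map_twist_prod coproduct_legs comult_eU comult_dU L12.map_add legs
    by (intro TT.intertw_twist_prod prim JT_comm_primitive) (simp_all add: TT.intertw_def leg_slots)
  then have 1: "?J12 * fps_map comult_id GT = fps_map comult_id GT * ?J12"
    by (simp add: TT.intertw_def)
  have h: "TT.intertw ?J23 (fps_map leg23 (delta v)) (?h v)" for v
    using arg_cong[OF JT_delta, of "fps_map leg23" v] by (simp add: TT.intertw_def L23.map_mult)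
  have h0: "?h aU $ 0 = 1" "?h e34 $ 0 = 0" "?h qU $ 0 = 0" "?h sU $ 0 = 0" "?h wU $ 0 = 0"
    using L23.map_quad_rels[OF quad_rels_hat[where 'a = 'k]] unfolding quad_rels_def by blast+
  have "TT.intertw ?J23 (fps_map id_comult GT) ?T"
    unfolding GT_def IC.map_twist_prod coproduct_legs
    by (intro TT.intertw_twist_prod h h0) (simp_all add: TT.intertw_def leg_slots fps_map_nth CM.hom_0 CM.hom_1 L23.hom_0 L23.hom_1)
  then have 2: "?J23 * fps_map id_comult GT = ?T * ?J23"
    by (simp add: TT.intertw_def)
  have "fps_map leg12 twist_p * fps_map comult_id twist_p
      = (fps_map leg12 GT * fps_map comult_id GT) * (?J12 * fps_map comult_id JT)"
    by (simp only: twist_p_eq L12.map_mult CI.map_mult mult.assoc assoc_rule[OF 1])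
  also have "\<dots> = fps_map leg23 GT * (?T * ?J23) * fps_map id_comult JT"
    by (simp only: GT_cocycle JT_cocycle mult.assoc)
  also have "\<dots> = fps_map leg23 twist_p * fps_map id_comult twist_p"
    by (simp only: 2[symmetric] twist_p_eq L23.map_mult IC.map_mult mult.assoc)
  finally show ?thesis .
qed

theorem mainTheorem1:
  shows "usl4_twist (twist_p :: ('k::field_char_0, 2) usl4_tensor fps) \<and>
    (\<exists>X. universal_R (twist_p :: ('k, 2) usl4_tensor fps)
       = fps_const (1 \<otimes> 1) + fps_X * fps_const r_p + fps_X ^ 2 * X)"
  unfolding usl4_twist_def
  by (intro conjI twist_invertible twist_cocycle counits universal_R_expansion)

end
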